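(* Let $p\in\{0,1,\ldots,6\}$, $\rho>0$, and let $f:B(\rho)\to\mathbb{O}$ be a (left) generalized partial-slice monogenic function of type $p$, where $B(\rho)=\{\boldsymbol{x}\in\mathbb{O}:|\boldsymbol{x}|<\rho\}$. Then, for all $0<R<\rho$, all $\underline{\eta}\in\mathbb{S}$ and all $\boldsymbol{x}\in B(R)_{\underline{\eta}}$, $$f(\boldsymbol{x})=\sum_{k=0}^{+\infty}\ \sum_{|\mathrm{k}|=k}\Big(\mathcal{P}_{\mathrm{k}}(\boldsymbol{x})\,\partial_{\mathrm{k}}f(0)+T_{\mathrm{k}}(\boldsymbol{x})\Big),\qquad\mathrm{k}=(k_0,k_1,\ldots,k_p)\in\mathbb{N}^{p+1},$$ where $$T_{\mathrm{k}}(\boldsymbol{x})=\int_{\partial B(R)_{\underline{\eta}}}\big[\mathcal{P}_{\mathrm{k}}(\boldsymbol{x}),\,\mathcal{Q}_{\mathrm{k}}(\boldsymbol{y}),\,\boldsymbol{n}(\boldsymbol{y})f(\boldsymbol{y})\big]\,dS(\boldsymbol{y}),$$ with $\boldsymbol{n}(\boldsymbol{y})=\boldsymbol{y}/R$ the unit exterior normal to $\partial B(R)_{\underline{\eta}}$ at $\boldsymbol{y}$ and $dS$ the classical Lebesgue surface element in $\mathbb{R}^{p+2}$.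
   Context: $\mathbb{O}$ is the real, non-associative, alternative algebra of octonions with basis $e_0=1,e_1,\ldots,e_7$ and product $e_ie_j=-\delta_{ij}+\sum_k\epsilon_{ijk}e_k$ for $1\le i,j\le 7$, where $\epsilon_{ijk}$ is totally antisymmetric, equals $1$ on the triples $(1,2,3),(1,4,5),(2,4,6),(3,4,7),(5,3,6),(6,1,7),(7,2,5)$, and vanishes on triples that are not permutations of these. $\mathbb{O}$ is identified with $\mathbb{R}^8$ with Euclidean norm $|\cdot|$; conjugation is $\overline{x}=x_0-\sum_{i=1}^7x_ie_i$. The associator is $[a,b,c]=(ab)c-a(bc)$. $\mathbb{N}=\{0,1,2,\ldots\}$. Fix $p\in\{0,\ldots,6\}$. $\mathbb{R}^{p+1}$ denotes the real span of $e_0,\ldots,e_p$, with elements $\boldsymbol{x}_p=\sum_{i=0}^px_ie_i$, and $\mathbb{S}=\{\sum_{i=p+1}^7x_ie_i:\sum_{i=p+1}^7x_i^2=1\}$. For $\Omega\subseteq\mathbb{O}$ open and $\underline{\omega}\in\mathbb{S}$, $\Omega_{\underline{\omega}}=\Omega\cap(\mathbb{R}^{p+1}\oplus\underline{\omega}\mathbb{R})$ is viewed as an open subset of $\mathbb{R}^{p+2}$ with coordinates $(x_0,\ldots,x_p,r)\leftrightarrow\boldsymbol{x}_p+r\underline{\omega}$; $\partial B(R)_{\underline{\eta}}$ is the sphere of radius $R$ centred at $0$ in $\mathbb{R}^{p+1}\oplus\underline{\eta}\mathbb{R}$. A function $f:\Omega\to\mathbb{O}$ on a domain $\Omega$ is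 (left) generalized partial-slice monogenic of type $p$ if, for every $\underline{\omega}\in\mathbb{S}$, the restriction $f_{\underline{\omega}}$ to $\Omega_{\underline{\omega}}$ is of class $C^1$ and satisfies $\sum_{i=0}^pe_i\,\partial_{x_i}f_{\underline{\omega}}+\underline{\omega}\,\partial_rf_{\underline{\omega}}=0$ on $\Omega_{\underline{\omega}}$. (Each $f_{\underline{\omega}}$ is then $C^\infty$.) For $\mathrm{k}=(k_0,\ldots,k_p)\in\mathbb{N}^{p+1}$: $|\mathrm{k}|=k_0+\cdots+k_p$ and $\partial_{\mathrm{k}}=\partial^{|\mathrm{k}|}/\partial x_0^{k_0}\cdots\partial x_p^{k_p}$. Fueter variables: $z_\ell(\boldsymbol{x}_p+r\underline{\omega})=x_\ell+r\,\underline{\omega}e_\ell$, $\ell=0,\ldots,p$. Fueter polynomials: for $\mathrm{k}$ with $k=|\mathrm{k}|\ge1$, let $\overrightarrow{\mathrm{k}}=(j_1,\ldots,j_k)$ be the nondecreasing list in which each $\ell\in\{0,\ldots,p\}$ appears $k_\ell$ times; $\mathcal{P}_{\mathrm{k}}=\frac{1}{k!}\sum z_{i_1}z_{i_2}\cdots z_{i_k}$, the sum running over all the distinct permutations $(i_1,\ldots,i_k)$ of $\overrightarrow{\mathrm{k}}$ (the sum does not depend on the way the products are associated, the same way being used in all terms; e.g. take $(\cdots((z_{i_1}z_{i_2})z_{i_3})\cdots)z_{i_k}$); $\mathcal{P}_{\mathbf{0}}=1$. The Cauchy kernel is $E(\boldsymbol{x})=\frac{1}{\sigma_{p+1}}\frac{\overline{\boldsymbol{x}}}{|\boldsymbol{x}|^{p+2}}$,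 $\boldsymbol{x}\ne0$, with $\sigma_{p+1}=2\,\Gamma(\tfrac12)^{p+2}/\Gamma(\tfrac{p+2}{2})$, and $\mathcal{Q}_{\mathrm{k}}(\boldsymbol{x})=(-1)^{|\mathrm{k}|}\partial_{\mathrm{k}}E(\boldsymbol{x})$. *)

theory Defs
  imports "HOL-Analysis.Analysis" "HOL-Combinatorics.Multiset_Permutations"
begin

section \<open>Octonions\<close>

text \<open>Octonions are vectors in \<open>real ^ 8\<close>, so that the norm, topology and inner product are the
  Euclidean ones. Coordinates and basis elements are indexed by the naturals \<open>0, \<dots>, 7\<close>.
  The operations \<open>*\<close> and \<open>1\<close> which the library provides on vectors are componentwise and are not
  used: the octonion product is \<open>\<odot>\<close> and its unit is \<open>oct_e 0\<close>.\<close>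

type_synonym oct = "real ^ 8"

definition oct_coord :: "oct \<Rightarrow> nat \<Rightarrow> real" where
  "oct_coord x i = x $ (of_nat i)"

definition oct_e :: "nat \<Rightarrow> oct" where
  "oct_e i = axis (of_nat i) 1"

definition oct_triples :: "(nat \<times> nat \<times> nat) set" where
  "oct_triples = {(1,2,3), (1,4,5), (2,4,6), (3,4,7), (5,3,6), (6,1,7), (7,2,5)}"

definition oct_eps :: "nat \<Rightarrow> nat \<Rightarrow> nat \<Rightarrow> real" where
  "oct_eps i j k =
    (if {(i,j,k), (j,k,i), (k,i,j)} \<inter> oct_triples \<noteq> {} then 1
     else if {(j,i,k), (i,k,j), (k,j,i)} \<inter> oct_triples \<noteq> {} then -1
     else 0)"

definition oct_basis_mult :: "nat \<Rightarrow> nat \<Rightarrow> oct" where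
  "oct_basis_mult i j =
    (if i = 0 then oct_e j
     else if j = 0 then oct_e i
     else (if i = j then - oct_e 0 else 0) + (\<Sum>k=1..7. oct_eps i j k *\<^sub>R oct_e k))"

definition oct_mult :: "oct \<Rightarrow> oct \<Rightarrow> oct"  (infixl "\<odot>" 70) where
  "x \<odot> y = (\<Sum>i\<le>7. \<Sum>j\<le>7. (oct_coord x i * oct_coord y j) *\<^sub>R oct_basis_mult i j)"

definition oct_cnj :: "oct \<Rightarrow> oct" where
  "oct_cnj x = oct_coord x 0 *\<^sub>R oct_e 0 - (\<Sum>i=1..7. oct_coord x i *\<^sub>R oct_e i)"

definition oct_associator :: "oct \<Rightarrow> oct \<Rightarrow> oct \<Rightarrow> oct" where
  "oct_associator a b c = (a \<odot> b) \<odot> c - a \<odot> (b \<odot> c)"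


section \<open>Slices and generalized partial-slice monogenic functions\<close>

definition imag_sphere :: "nat \<Rightarrow> oct set" where
  "imag_sphere p = {\<Sum>i=Suc p..7. a i *\<^sub>R oct_e i | a. (\<Sum>i=Suc p..7. (a i)\<^sup>2) = 1}"

definition slice :: "nat \<Rightarrow> oct \<Rightarrow> oct set \<Rightarrow> oct set" where
  "slice p \<omega> \<Omega> = \<Omega> \<inter> span (insert \<omega> (oct_e ` {..p}))"

text \<open>The slice of an open set is open in the span of \<open>oct_e 0, \<dots>, oct_e p, \<omega>\<close>. In the coordinates
  \<open>(x\<^sub>0, \<dots>, x\<^sub>p, r)\<close> of this span the partial derivatives of the restriction of a function
  are its directional derivatives along \<open>oct_e i\<close> (for \<open>x\<^sub>i\<close>) and along \<open>\<omega>\<close> (for \<open>r\<close>).\<close>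

definition dir_deriv :: "oct \<Rightarrow> (oct \<Rightarrow> oct) \<Rightarrow> oct \<Rightarrow> oct" where
  "dir_deriv v f x = vector_derivative (\<lambda>t. f (x + t *\<^sub>R v)) (at 0)"

definition C1_on_slice :: "nat \<Rightarrow> oct \<Rightarrow> oct set \<Rightarrow> (oct \<Rightarrow> oct) \<Rightarrow> bool" where
  "C1_on_slice p \<omega> \<Omega> f \<longleftrightarrow>
    (\<forall>v \<in> insert \<omega> (oct_e ` {..p}).
      (\<forall>x \<in> slice p \<omega> \<Omega>. (\<lambda>t::real. f (x + t *\<^sub>R v)) differentiable (at 0)) \<and>
      continuous_on (slice p \<omega> \<Omega>) (dir_deriv v f))"

definition gps_monogenic :: "nat \<Rightarrow> oct set \<Rightarrow> (oct \<Rightarrow> oct) \<Rightarrow> bool" where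
  "gps_monogenic p \<Omega> f \<longleftrightarrow>
    open \<Omega> \<and> connected \<Omega> \<and>
    (\<forall>\<omega> \<in> imag_sphere p.
      C1_on_slice p \<omega> \<Omega> f \<and>
      (\<forall>x \<in> slice p \<omega> \<Omega>.
        (\<Sum>i\<le>p. oct_e i \<odot> dir_deriv (oct_e i) f x) + \<omega> \<odot> dir_deriv \<omega> f x = 0))"


section \<open>Multi-indices and Fueter polynomials\<close>

text \<open>Multi-indices in \<open>\<nat>\<^sup>p\<^sup>+\<^sup>1\<close> are functions on the naturals that vanish beyond \<open>p\<close>.\<close>

definition multi_indices :: "nat \<Rightarrow> nat \<Rightarrow> (nat \<Rightarrow> nat) set" where
  "multi_indices p n = {k. (\<forall>i>p. k i = 0) \<and> (\<Sum>i\<le>p. k i) = n}"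

definition multi_deriv :: "nat \<Rightarrow> (nat \<Rightarrow> nat) \<Rightarrow> (oct \<Rightarrow> oct) \<Rightarrow> oct \<Rightarrow> oct" where
  "multi_deriv p k f = foldr (\<lambda>i. dir_deriv (oct_e i) ^^ k i) [0..<Suc p] f"

text \<open>If \<open>x = x\<^sub>p + r \<omega>\<close> with \<open>\<omega>\<close> in \<open>imag_sphere p\<close>, then \<open>r \<omega>\<close> is the
  sum of the \<open>oct_coord x i *\<^sub>R oct_e i\<close> over \<open>i > p\<close>; hence the Fueter variables do not depend on the choice of
  \<open>r\<close> and \<open>\<omega>\<close>.\<close>

definition fueter_var :: "nat \<Rightarrow> nat \<Rightarrow> oct \<Rightarrow> oct" where
  "fueter_var p l x =
    oct_coord x l *\<^sub>R oct_e 0 + (\<Sum>i=Suc p..7. oct_coord x i *\<^sub>R oct_e i) \<odot> oct_e l"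

definition index_list :: "nat \<Rightarrow> (nat \<Rightarrow> nat) \<Rightarrow> nat list" where
  "index_list p k = concat (map (\<lambda>l. replicate (k l) l) [0..<Suc p])"

text \<open>Products are associated to the left. For \<open>k = 0\<close> the only permutation is the empty list, which
  contributes the unit.\<close>

definition fueter_poly :: "nat \<Rightarrow> (nat \<Rightarrow> nat) \<Rightarrow> oct \<Rightarrow> oct" where
  "fueter_poly p k x =
    (1 / fact (\<Sum>i\<le>p. k i)) *\<^sub>R
    (\<Sum>is \<in> permutations_of_multiset (mset (index_list p k)).
      foldl (\<odot>) (oct_e 0) (map (\<lambda>i. fueter_var p i x) is))"


section \<open>Cauchy kernel and surface integrals\<close>

definition sphere_area :: "nat \<Rightarrow> real" where
  "sphere_area p = 2 * Gamma (1/2) ^ (p + 2) / Gamma (real (p + 2) / 2)"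

definition cauchy_kernel :: "nat \<Rightarrow> oct \<Rightarrow> oct" where
  "cauchy_kernel p x = (1 / (sphere_area p * norm x ^ (p + 2))) *\<^sub>R oct_cnj x"

definition cauchy_kernel_deriv :: "nat \<Rightarrow> (nat \<Rightarrow> nat) \<Rightarrow> oct \<Rightarrow> oct" where
  "cauchy_kernel_deriv p k x = (- 1) ^ (\<Sum>i\<le>p. k i) *\<^sub>R multi_deriv p k (cauchy_kernel p) x"

text \<open>Surface integral over the sphere of radius \<open>R\<close> about \<open>0\<close> in the span of
  \<open>oct_e 0, \<dots>, oct_e p, \<eta>\<close>. Up to its equator, a null set, this sphere is the union of the graphs
  \<open>r = h u\<close> and \<open>r = - h u\<close> over the open ball of radius \<open>R\<close> in the coordinates
  \<open>u = (x\<^sub>0, \<dots>, x\<^sub>p)\<close>, where \<open>h u = sqrt (R\<^sup>2 - \<bar>u\<bar>\<^sup>2)\<close>. The surface element of a graph is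
  \<open>dS = sqrt (1 + \<bar>grad h\<bar>\<^sup>2) du\<close>, here \<open>(R / h u) du\<close>.\<close>

definition slice_sphere_integral :: "nat \<Rightarrow> oct \<Rightarrow> real \<Rightarrow> (oct \<Rightarrow> oct) \<Rightarrow> oct" where
  "slice_sphere_integral p \<eta> R g =
    (let h = (\<lambda>u. sqrt (R\<^sup>2 - (\<Sum>i\<le>p. (u i)\<^sup>2))) in
     \<Sum>s\<in>{1, -1}.
       LINT u : {u. (\<Sum>i\<le>p. (u i)\<^sup>2) < R\<^sup>2} | Pi\<^sub>M {..p} (\<lambda>_. lborel).
         (R / h u) *\<^sub>R g ((\<Sum>i\<le>p. u i *\<^sub>R oct_e i) + (s * h u) *\<^sub>R \<eta>))"

end

theory Submission
  imports Defs
begin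

text \<open>Fix \<open>\<eta>\<close> and let \<open>V\<close> be the span of \<open>e\<^sub>0, \<dots>, e\<^sub>p, \<eta>\<close>. As for holomorphic functions, the expansion comes from
a Cauchy integral over the sphere of radius \<open>R\<close> in \<open>V\<close>: the kernel \<open>E(y - x)\<close> is expanded in polynomials
homogeneous in \<open>x\<close>, the series is integrated term by term, and the coefficients are recognised as derivatives
at \<open>0\<close> by differentiating the Cauchy integral under the integral sign. The products that occur have three
octonion factors, so each step has to respect the position of the brackets.

\<^emph>\<open>Cauchy's formula\<close> (\<open>cauchy_formula\<close>) has the bracketing \<open>f(x) = \<integral> E(y - x) (n(y) f(y)) dS\<close>. The kernel is replaced
by the smooth \<open>E\<^sub>\<epsilon>(z) = cnj z / (\<sigma> (|z|\<^sup>2 + \<epsilon>\<^sup>2)\<^bsup>(p+2)/2\<^esup>)\<close>, and the divergence theorem is applied to the fields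
\<open>E\<^sub>\<epsilon>(y - x) (b\<^sub>i f(y))\<close>, where \<open>b\<^sub>i\<close> runs through the orthonormal basis of \<open>V\<close>. The terms with a derivative of \<open>f\<close> add
up to \<open>E\<^sub>\<epsilon> (D f) = 0\<close>; those with a derivative of \<open>E\<^sub>\<epsilon>\<close> only need \<open>cnj a (a v) = |a|\<^sup>2 v\<close>, a form
of the alternative law, and give \<open>\<psi>\<^sub>\<epsilon> f\<close> with a positive bump \<open>\<psi>\<^sub>\<epsilon>\<close> that concentrates at \<open>x\<close>. Its total mass tends to
\<open>1\<close>: for \<open>x = 0\<close> this is the relation between the area of the sphere and the volume of the ball, and a translation
moves the bump to any other \<open>x\<close>. The divergence theorem itself (\<open>divergence_theorem\<close>) follows from the fundamental
theorem of calculus along each coordinate line, since the surface integral is defined through graphs.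

\<^emph>\<open>The expansion of the kernel\<close> (\<open>cauchy_kernel_series\<close>, \<open>cauchy_kernel_coefficients\<close>). Along a ray,
\<open>|y - t x|\<^sup>2 = R\<^sup>2 |1 - \<alpha> t|\<^sup>2\<close> with a complex number \<open>\<alpha>\<close> of modulus \<open>|x|/R < 1\<close>, so that two binomial series
give a power series in \<open>t\<close> whose coefficients are dominated uniformly in \<open>y\<close>. Its \<open>n\<close>-th coefficient is
\<open>(-1)\<^sup>n/n!\<close> times the \<open>n\<close>-th derivative of \<open>E\<close> in direction \<open>x\<close>, at \<open>y\<close>.

\<^emph>\<open>Fueter polynomials\<close> (\<open>fueter_sum\<close>). That coefficient is the sum of \<open>P\<^sub>k(x) Q\<^sub>k(y)\<close> over \<open>|k| = n\<close>. Put \<open>J\<^sub>l = \<eta> e\<^sub>l\<close>;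
the \<open>J\<^sub>l\<close> are orthonormal and imaginary, \<open>z\<^sub>l = x\<^sub>l + r J\<^sub>l\<close>, and a sum of words in the \<open>z\<^sub>l\<close> with real
coefficients symmetric in the letters lies in the span of \<open>1\<close> and the \<open>J\<^sub>l\<close>. The kernel satisfies
\<open>\<partial>\<^sub>\<eta> E = \<Sum>\<^sub>l J\<^sub>l \<partial>\<^sub>l E\<close> with this bracketing, and so do all its derivatives; by this relation \<open>r J\<^sub>l \<partial>\<^sub>l\<close>, summed over \<open>l\<close>,
acts as \<open>r \<partial>\<^sub>\<eta>\<close>, and words in the \<open>z\<^sub>l \<partial>\<^sub>l\<close> become powers of the derivative in direction \<open>x\<close>.

\<^emph>\<open>The extra term.\<close> Integration yields \<open>\<integral> (P\<^sub>k(x) Q\<^sub>k(y)) (n f) dS\<close>, whereas \<open>\<partial>\<^sub>k f(0) = \<integral> Q\<^sub>k(y) (n f) dS\<close>. Moving the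
bracket so that \<open>P\<^sub>k(x)\<close> leaves the integral costs exactly the associator integrated in \<open>T\<^sub>k\<close>.\<close>

section \<open>The octonion product in coordinates\<close>

lemma UNIV_8: "(UNIV :: 8 set) = {0,1,2,3,4,5,6,7}"
proof -
  have "card {0::8,1,2,3,4,5,6,7} = CARD(8)" by (simp)
  then show ?thesis by (metis card_subset_eq finite_class.finite_UNIV subset_UNIV)
qed

lemma sum_8: "(\<Sum>i\<in>(UNIV::8 set). g i) = g 0 + g 1 + g 2 + g 3 + g 4 + g 5 + g 6 + (g 7 :: 'a::comm_monoid_add)"
  by (subst UNIV_8) (simp add: ac_simps)

lemma forall_8: "(\<forall>i::8. P i) \<longleftrightarrow> P 0 \<and> P 1 \<and> P 2 \<and> P 3 \<and> P 4 \<and> P 5 \<and> P 6 \<and> P 7"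
  using UNIV_8 by (metis (no_types, lifting) UNIV_I insertE singletonD)

lemma atMost_7: "{..7::nat} = {0,1,2,3,4,5,6,7}" by auto
lemma sum_1_7: "(\<Sum>k=1..7::nat. g k) = g 1 + g 2 + g 3 + g 4 + g 5 + g 6 + (g 7 :: 'a::comm_monoid_add)"
proof -
  have "{1..7::nat} = {1,2,3,4,5,6,7}" by auto
  then show ?thesis by (simp add: ac_simps)
qed
lemma sum_atMost_7: "(\<Sum>k\<le>7::nat. g k) = g 0 + g 1 + g 2 + g 3 + g 4 + g 5 + g 6 + (g 7 :: 'a::comm_monoid_add)"
  by (simp add: atMost_7 ac_simps)

lemma oct_e_nth:
  "oct_e 0 = axis 0 1" "oct_e 1 = axis 1 1" "oct_e 2 = axis 2 1" "oct_e 3 = axis 3 1"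
  "oct_e 4 = axis 4 1" "oct_e 5 = axis 5 1" "oct_e 6 = axis 6 1" "oct_e 7 = axis 7 1"
  by (simp_all add: oct_e_def)

lemma oct_coord_nth:
  "oct_coord x 0 = x $ 0" "oct_coord x 1 = x $ 1" "oct_coord x 2 = x $ 2" "oct_coord x 3 = x $ 3"
  "oct_coord x 4 = x $ 4" "oct_coord x 5 = x $ 5" "oct_coord x 6 = x $ 6" "oct_coord x 7 = x $ 7"
  by (simp_all add: oct_coord_def)

lemma oct_basis_mult_table:
  "oct_basis_mult 1 1 = - oct_e 0" "oct_basis_mult 1 2 = oct_e 3" "oct_basis_mult 1 3 = - oct_e 2" "oct_basis_mult 1 4 = oct_e 5" "oct_basis_mult 1 5 = - oct_e 4" "oct_basis_mult 1 6 = - oct_e 7" "oct_basis_mult 1 7 = oct_e 6"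
  "oct_basis_mult 2 1 = - oct_e 3" "oct_basis_mult 2 2 = - oct_e 0" "oct_basis_mult 2 3 = oct_e 1" "oct_basis_mult 2 4 = oct_e 6" "oct_basis_mult 2 5 = oct_e 7" "oct_basis_mult 2 6 = - oct_e 4" "oct_basis_mult 2 7 = - oct_e 5"
  "oct_basis_mult 3 1 = oct_e 2" "oct_basis_mult 3 2 = - oct_e 1" "oct_basis_mult 3 3 = - oct_e 0" "oct_basis_mult 3 4 = oct_e 7" "oct_basis_mult 3 5 = - oct_e 6" "oct_basis_mult 3 6 = oct_e 5" "oct_basis_mult 3 7 = - oct_e 4"
  "oct_basis_mult 4 1 = - oct_e 5" "oct_basis_mult 4 2 = - oct_e 6" "oct_basis_mult 4 3 = - oct_e 7" "oct_basis_mult 4 4 = - oct_e 0" "oct_basis_mult 4 5 = oct_e 1" "oct_basis_mult 4 6 = oct_e 2" "oct_basis_mult 4 7 = oct_e 3"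
  "oct_basis_mult 5 1 = oct_e 4" "oct_basis_mult 5 2 = - oct_e 7" "oct_basis_mult 5 3 = oct_e 6" "oct_basis_mult 5 4 = - oct_e 1" "oct_basis_mult 5 5 = - oct_e 0" "oct_basis_mult 5 6 = - oct_e 3" "oct_basis_mult 5 7 = oct_e 2"
  "oct_basis_mult 6 1 = oct_e 7" "oct_basis_mult 6 2 = oct_e 4" "oct_basis_mult 6 3 = - oct_e 5" "oct_basis_mult 6 4 = - oct_e 2" "oct_basis_mult 6 5 = oct_e 3" "oct_basis_mult 6 6 = - oct_e 0" "oct_basis_mult 6 7 = - oct_e 1"
  "oct_basis_mult 7 1 = - oct_e 6" "oct_basis_mult 7 2 = oct_e 5" "oct_basis_mult 7 3 = oct_e 4" "oct_basis_mult 7 4 = - oct_e 3" "oct_basis_mult 7 5 = - oct_e 2" "oct_basis_mult 7 6 = oct_e 1" "oct_basis_mult 7 7 = - oct_e 0"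
  unfolding oct_basis_mult_def sum_1_7 oct_eps_def oct_triples_def by (simp_all del: One_nat_def)

lemma oct_basis_mult_zero: "oct_basis_mult 0 j = oct_e j" "oct_basis_mult i 0 = oct_e i"
  by (simp_all add: oct_basis_mult_def)

lemma oct_mult_nth:
  "(x \<odot> y) $ 0 = x$0*y$0 - x$1*y$1 - x$2*y$2 - x$3*y$3 - x$4*y$4 - x$5*y$5 - x$6*y$6 - x$7*y$7"
  "(x \<odot> y) $ 1 = x$0*y$1 + x$1*y$0 + x$2*y$3 - x$3*y$2 + x$4*y$5 - x$5*y$4 - x$6*y$7 + x$7*y$6"
  "(x \<odot> y) $ 2 = x$0*y$2 - x$1*y$3 + x$2*y$0 + x$3*y$1 + x$4*y$6 + x$5*y$7 - x$6*y$4 - x$7*y$5"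
  "(x \<odot> y) $ 3 = x$0*y$3 + x$1*y$2 - x$2*y$1 + x$3*y$0 + x$4*y$7 - x$5*y$6 + x$6*y$5 - x$7*y$4"
  "(x \<odot> y) $ 4 = x$0*y$4 - x$1*y$5 - x$2*y$6 - x$3*y$7 + x$4*y$0 + x$5*y$1 + x$6*y$2 + x$7*y$3"
  "(x \<odot> y) $ 5 = x$0*y$5 + x$1*y$4 - x$2*y$7 + x$3*y$6 - x$4*y$1 + x$5*y$0 - x$6*y$3 + x$7*y$2"
  "(x \<odot> y) $ 6 = x$0*y$6 + x$1*y$7 + x$2*y$4 - x$3*y$5 - x$4*y$2 + x$5*y$3 + x$6*y$0 - x$7*y$1"
  "(x \<odot> y) $ 7 = x$0*y$7 - x$1*y$6 + x$2*y$5 + x$3*y$4 - x$4*y$3 - x$5*y$2 + x$6*y$1 + x$7*y$0"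
  unfolding oct_mult_def sum_atMost_7 oct_basis_mult_table oct_basis_mult_zero oct_coord_nth oct_e_nth
  by (simp_all del: One_nat_def add: axis_def)

lemma oct_eq_iff: "x = (y::oct) \<longleftrightarrow> x$0 = y$0 \<and> x$1 = y$1 \<and> x$2 = y$2 \<and> x$3 = y$3 \<and> x$4 = y$4 \<and> x$5 = y$5
    \<and> x$6 = y$6 \<and> x$7 = y$7"
  unfolding vec_eq_iff forall_8 by simp

lemma oct_inner: "(x::oct) \<bullet> y = x$0*y$0 + x$1*y$1 + x$2*y$2 + x$3*y$3 + x$4*y$4 + x$5*y$5 + x$6*y$6 + x$7*y$7"
  unfolding inner_vec_def sum_8 by simp

interpretation oct: bounded_bilinear "(\<odot>)"
proof -
  have "bilinear (\<odot>)"
    unfolding bilinear_def by (auto intro!: linearI simp: oct_eq_iff oct_mult_nth algebra_simps)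
  then show "bounded_bilinear (\<odot>)"
    by (simp add: bilinear_conv_bounded_bilinear)
qed

lemma oct_cnj_nth:
  "oct_cnj x $ 0 = x$0" "oct_cnj x $ 1 = - x$1" "oct_cnj x $ 2 = - x$2" "oct_cnj x $ 3 = - x$3"
  "oct_cnj x $ 4 = - x$4" "oct_cnj x $ 5 = - x$5" "oct_cnj x $ 6 = - x$6" "oct_cnj x $ 7 = - x$7"
  unfolding oct_cnj_def sum_1_7 oct_coord_nth oct_e_nth
  by (simp_all add: axis_def)

lemma oct_cnj_eq: "oct_cnj x = (2 * (x \<bullet> oct_e 0)) *\<^sub>R oct_e 0 - x"
  by (simp add: oct_eq_iff oct_cnj_nth oct_inner oct_e_def axis_def)

lemma oct_one_left [simp]: "oct_e 0 \<odot> x = x"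
  and oct_one_right [simp]: "x \<odot> oct_e 0 = x"
  by (simp_all add: oct_eq_iff oct_mult_nth oct_e_def axis_def)

text \<open>Two octonions and their conjugates generate an associative algebra. This identity and its mirror image are the form in which
the alternative laws enter the integral formulas.\<close>

lemma oct_cnj_mult_mult: "oct_cnj a \<odot> (a \<odot> c) = (a \<bullet> a) *\<^sub>R c"
  unfolding oct_eq_iff oct_mult_nth oct_cnj_nth oct_inner vector_scaleR_component
  by (intro conjI; simp add: algebra_simps)

lemma oct_mult_mult_cnj: "(c \<odot> a) \<odot> oct_cnj a = (a \<bullet> a) *\<^sub>R c"
  unfolding oct_eq_iff oct_mult_nth oct_cnj_nth oct_inner vector_scaleR_component
  by (intro conjI; simp add: algebra_simps)

lemma oct_inner_mult_left: "(a \<odot> b) \<bullet> c = b \<bullet> (oct_cnj a \<odot> c)"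
  unfolding oct_mult_nth oct_cnj_nth oct_inner
  by (simp add: algebra_simps)

section \<open>Orthonormal coordinates on a slice\<close>

text \<open>Sums over \<open>{..Suc p}\<close> are kept intact: the index \<open>Suc p\<close> of the direction \<open>\<eta>\<close> is treated like the others.\<close>

lemmas [simp del] = sum.atMost_Suc

lemma oct_e_inner: "i \<le> 7 \<Longrightarrow> j \<le> 7 \<Longrightarrow> oct_e i \<bullet> oct_e j = (if i = j then 1 else 0)"
proof -
  assume "i \<le> 7" "j \<le> 7"
  then have "i \<in> {..7}" "j \<in> {..7}" by auto
  then show ?thesis
    unfolding atMost_7 by (elim insertE emptyE; simp add: oct_e_def inner_axis_axis)
qed

lemma oct_coord_inner: "oct_coord x i = x \<bullet> oct_e i"
  by (simp add: oct_coord_def oct_e_def inner_axis)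

locale oct_slice =
  fixes p :: nat and \<eta> :: oct
  assumes p_le: "p \<le> 6" and eta: "\<eta> \<in> imag_sphere p"
begin

text \<open>The direction \<open>\<eta>\<close> gets the index \<open>Suc p\<close>, so that the coordinates on the slice are numbered by \<open>{..Suc p}\<close>.\<close>

definition bas :: "nat \<Rightarrow> oct" where "bas i = (if i \<le> p then oct_e i else \<eta>)"

definition Y :: "(nat \<Rightarrow> real) \<Rightarrow> oct" where "Y w = (\<Sum>i\<le>Suc p. w i *\<^sub>R bas i)"

definition V :: "oct set" where "V = span (insert \<eta> (oct_e ` {..p}))"

lemma eta_inner_e: "i \<le> p \<Longrightarrow> \<eta> \<bullet> oct_e i = 0"
  and eta_inner_eta: "\<eta> \<bullet> \<eta> = 1"
proof -
  obtain a where a: "\<eta> = (\<Sum>i=Suc p..7. a i *\<^sub>R oct_e i)" "(\<Sum>i=Suc p..7. (a i)\<^sup>2) = 1"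
    using eta by (auto simp: imag_sphere_def)
  have *: "\<eta> \<bullet> oct_e i = (if i \<in> {Suc p..7} then a i else 0)" if "i \<le> 7" for i
    unfolding a inner_sum_left using that
    by (simp add: oct_e_inner if_distrib sum.delta cong: if_cong) 
  show "i \<le> p \<Longrightarrow> \<eta> \<bullet> oct_e i = 0" using *[of i] p_le by simp
  have "\<eta> \<bullet> \<eta> = (\<Sum>i=Suc p..7. a i * (\<eta> \<bullet> oct_e i))"
    by (subst (2) a(1)) (simp add: inner_sum_right)
  also have "\<dots> = (\<Sum>i=Suc p..7. (a i)\<^sup>2)"
    by (rule sum.cong) (auto simp: * power2_eq_square)
  finally show "\<eta> \<bullet> \<eta> = 1" using a by simp
qed

lemma bas_inner: "i \<le> Suc p \<Longrightarrow> j \<le> Suc p \<Longrightarrow> bas i \<bullet> bas j = (if i = j then 1 else 0)"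
  using p_le by (auto simp: bas_def oct_e_inner eta_inner_e eta_inner_eta inner_commute)

lemma bas_simps [simp]: "i \<le> p \<Longrightarrow> bas i = oct_e i" "bas (Suc p) = \<eta>"
  by (auto simp: bas_def)

lemma norm_bas: "i \<le> Suc p \<Longrightarrow> norm (bas i) = 1"
  by (simp add: norm_eq_sqrt_inner bas_inner)

lemma Y_inner_bas: "i \<le> Suc p \<Longrightarrow> Y w \<bullet> bas i = w i"
  by (simp add: Y_def inner_sum_left bas_inner if_distrib sum.delta cong: if_cong)

lemma Y_inner_Y: "Y w \<bullet> Y w' = (\<Sum>i\<le>Suc p. w i * w' i)"
  by (subst (2) Y_def) (simp add: inner_sum_right Y_inner_bas mult.commute)

lemma norm_Y_sq: "(norm (Y w))\<^sup>2 = (\<Sum>i\<le>Suc p. (w i)\<^sup>2)"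
  by (simp only: power2_norm_eq_inner Y_inner_Y) (simp add: power2_eq_square)

lemma subspace_V [simp]: "subspace V" by (simp add: V_def)

lemma closed_V [simp]: "closed V" by (simp add: V_def closed_subspace)

lemma bas_in_V: "bas i \<in> V"
  by (auto simp: V_def bas_def intro: span_base)

lemma V_add: "x \<in> V \<Longrightarrow> y \<in> V \<Longrightarrow> x + y \<in> V"
  and V_diff: "x \<in> V \<Longrightarrow> y \<in> V \<Longrightarrow> x - y \<in> V"
  and V_scale: "x \<in> V \<Longrightarrow> c *\<^sub>R x \<in> V"
  and V_0: "0 \<in> V"
  by (simp_all add: subspace_add subspace_diff subspace_scale subspace_0)

lemma Y_in_V: "Y w \<in> V"
  unfolding Y_def by (intro subspace_sum V_scale bas_in_V) simp

lemma Y_coords: "x \<in> V \<Longrightarrow> Y (\<lambda>i. x \<bullet> bas i) = x"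
proof -
  assume "x \<in> V"
  then have "x \<in> span (insert \<eta> (oct_e ` {..p}))" by (simp add: V_def)
  moreover have "subspace {x. Y (\<lambda>i. x \<bullet> bas i) = x}"
  proof -
    have Y0: "Y (\<lambda>i. 0 \<bullet> bas i) = 0" by (simp add: Y_def)
    have Ya: "Y (\<lambda>i. (x + y) \<bullet> bas i) = Y (\<lambda>i. x \<bullet> bas i) + Y (\<lambda>i. y \<bullet> bas i)" for x y
      by (simp add: Y_def inner_add_left scaleR_add_left sum.distrib)
    have Ys: "Y (\<lambda>i. (c *\<^sub>R x) \<bullet> bas i) = c *\<^sub>R Y (\<lambda>i. x \<bullet> bas i)" for x c
      by (simp add: Y_def scaleR_sum_right)
    show ?thesis using Y0 Ya Ys unfolding subspace_def by auto
  qed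
  moreover have "insert \<eta> (oct_e ` {..p}) \<subseteq> {x. Y (\<lambda>i. x \<bullet> bas i) = x}"
  proof
    fix y assume y: "y \<in> insert \<eta> (oct_e ` {..p})"
    have "Y (\<lambda>i. bas j \<bullet> bas i) = bas j" if "j \<le> Suc p" for j
    proof -
      have "Y (\<lambda>i. bas j \<bullet> bas i) = (\<Sum>i\<le>Suc p. if i = j then bas i else 0)"
        unfolding Y_def by (rule sum.cong) (auto simp: bas_inner that)
      also have "\<dots> = bas j" using that by (simp add: sum.delta)
      finally show ?thesis .
    qed
    moreover have "\<exists>j\<le>Suc p. y = bas j"
    proof (cases "y = \<eta>")
      case True
      then show ?thesis by (intro exI[of _ "Suc p"]) simp
    next
      case False
      then obtain j where "j \<le> p" "y = oct_e j" using y by auto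
      then show ?thesis by (intro exI[of _ j]) simp
    qed
    ultimately show "y \<in> {x. Y (\<lambda>i. x \<bullet> bas i) = x}" by auto
  qed
  ultimately have "x \<in> {x. Y (\<lambda>i. x \<bullet> bas i) = x}"
    by (metis (no_types, lifting) span_minimal subsetD)
  then show ?thesis by simp
qed

lemma V_expand: "x \<in> V \<Longrightarrow> x = (\<Sum>i\<le>Suc p. (x \<bullet> bas i) *\<^sub>R bas i)"
  using Y_coords[of x] by (simp add: Y_def)

lemma norm_V_sq: "x \<in> V \<Longrightarrow> (norm x)\<^sup>2 = (\<Sum>i\<le>Suc p. (x \<bullet> bas i)\<^sup>2)"
  using norm_Y_sq[of "\<lambda>i. x \<bullet> bas i"] by (simp add: Y_coords)

lemma Y_cong: "(\<And>i. i \<le> Suc p \<Longrightarrow> w i = w' i) \<Longrightarrow> Y w = Y w'"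
  unfolding Y_def by (rule sum.cong) auto

lemma Y_upd: "i \<le> Suc p \<Longrightarrow> Y (w(i := t)) = Y (w(i := 0)) + t *\<^sub>R bas i"
  unfolding Y_def by (subst (1 2) sum.remove[of _ i]) auto

lemma norm_Y_upd: "i \<le> Suc p \<Longrightarrow> (norm (Y (w(i := t))))\<^sup>2 = (\<Sum>j\<in>{..Suc p}-{i}. (w j)\<^sup>2) + t\<^sup>2"
  unfolding norm_Y_sq by (subst sum.remove[of _ i]) auto

lemma Y_measurable [measurable]: "Y \<in> borel_measurable (Pi\<^sub>M {..Suc p} (\<lambda>_. lborel))"
  unfolding Y_def by measurable

lemma Y_slice: "(\<Sum>i\<le>p. u i *\<^sub>R oct_e i) + r *\<^sub>R \<eta> = Y (u(Suc p := r))"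
  unfolding Y_def by (simp add: sum.atMost_Suc)

end

section \<open>The components of the normal on a circle\<close>

text \<open>Directional derivatives are taken at parameter \<open>0\<close> with moving base point; the calculus of one variable needs them at
an arbitrary parameter of a fixed line.\<close>

lemma has_vector_derivative_shift_line:
  fixes F :: "'a::real_normed_vector \<Rightarrow> 'b::real_normed_vector"
  assumes "((\<lambda>t. F ((z + s *\<^sub>R v) + t *\<^sub>R v)) has_vector_derivative D) (at 0)"
  shows "((\<lambda>t. F (z + t *\<^sub>R v)) has_vector_derivative D) (at s)"
proof -
  have "((\<lambda>t. t - s) has_vector_derivative 1) (at s)"
    by (auto intro!: derivative_eq_intros)
  from vector_diff_chain_at[OF this, of "\<lambda>t. F ((z + s *\<^sub>R v) + t *\<^sub>R v)" D] assms
  have "((\<lambda>t. F ((z + s *\<^sub>R v) + (t - s) *\<^sub>R v)) has_vector_derivative D) (at s)"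
    by (simp add: o_def)
  then show ?thesis by (simp add: algebra_simps)
qed

lemma has_integral_inverse_sqrt:
  fixes a :: real
  assumes "a > 0"
  shows "((\<lambda>x. 1 / sqrt (a\<^sup>2 - x\<^sup>2)) has_integral pi) {-a..a}"
proof -
  have "((\<lambda>x. 1 / sqrt (a\<^sup>2 - x\<^sup>2)) has_integral (arcsin (a/a) - arcsin (-a/a))) {-a..a}"
  proof (rule fundamental_theorem_of_calculus_interior)
    show "-a \<le> a" using assms by simp
    show "continuous_on {-a..a} (\<lambda>x. arcsin (x/a))"
      using assms by (intro continuous_on_arcsin continuous_intros) (auto simp: field_simps)
    fix x assume x: "x \<in> {-a<..<a}"
    then have "a\<^sup>2 - x\<^sup>2 > 0" using abs_square_less_1[of "x/a"] assms
      by (auto simp: field_simps power_divide abs_less_iff)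
    then have "sqrt (1 - (x/a)\<^sup>2) = sqrt (a\<^sup>2 - x\<^sup>2) / a"
      using assms by (simp add: field_simps power_divide real_sqrt_divide)
    then show "((\<lambda>x. arcsin (x/a)) has_vector_derivative 1 / sqrt (a\<^sup>2 - x\<^sup>2)) (at x)"
      unfolding has_real_derivative_iff_has_vector_derivative[symmetric]
      using assms x by (auto intro!: derivative_eq_intros simp: field_simps)
  qed
  then show ?thesis using assms by simp
qed

lemma nn_integral_inverse_sqrt:
  fixes a :: real
  assumes "a > 0"
  shows "(\<integral>\<^sup>+x. ennreal (indicator {-a..a} x / sqrt (a\<^sup>2 - x\<^sup>2)) \<partial>lborel) = ennreal pi"
proof (rule nn_integral_has_integral_lborel)
  show "(\<lambda>x. indicator {-a..a} x / sqrt (a\<^sup>2 - x\<^sup>2)) \<in> borel_measurable borel"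
    by measurable
  show "0 \<le> indicator {-a..a} x / sqrt (a\<^sup>2 - x\<^sup>2)" for x
    by (auto simp: indicator_def abs_le_square_iff[symmetric])
  have "((\<lambda>x. if x \<in> {-a..a} then 1 / sqrt (a\<^sup>2 - x\<^sup>2) else 0) has_integral pi) UNIV"
    using has_integral_inverse_sqrt[OF assms] by (subst has_integral_restrict_UNIV)
  moreover have "(\<lambda>x. if x \<in> {-a..a} then 1 / sqrt (a\<^sup>2 - x\<^sup>2) else 0) = (\<lambda>x. indicator {-a..a} x / sqrt (a\<^sup>2 - x\<^sup>2))"
    by (auto simp: indicator_def)
  ultimately show "((\<lambda>x. indicator {-a..a} x / sqrt (a\<^sup>2 - x\<^sup>2)) has_integral pi) UNIV" by simp
qed

lemma continuous_on_disc_compose: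
  assumes "continuous_on {z. (fst z)\<^sup>2 + (snd z)\<^sup>2 \<le> a\<^sup>2} (\<lambda>z. \<Phi> (fst z) (snd z))"
    and "continuous_on A u" "continuous_on A v" "\<And>x. x \<in> A \<Longrightarrow> (u x)\<^sup>2 + (v x)\<^sup>2 \<le> (a::real)\<^sup>2"
  shows "continuous_on A (\<lambda>x. \<Phi> (u x) (v x))"
proof -
  have "(\<lambda>x. (u x, v x)) ` A \<subseteq> {z. (fst z)\<^sup>2 + (snd z)\<^sup>2 \<le> a\<^sup>2}" using assms(4) by auto
  from continuous_on_compose2[OF assms(1) continuous_on_Pair[OF assms(2,3)] this] show ?thesis by simp
qed

lemma square_le_of_abs_le: "\<bar>x\<bar> \<le> a \<Longrightarrow> x\<^sup>2 \<le> (a::real)\<^sup>2"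
  using abs_le_square_iff[of x a] by simp

text \<open>The substitution \<open>r = sqrt (a\<^sup>2 - y\<^sup>2)\<close> turns an integral over one quarter of the circle parametrised by \<open>y\<close> into the same
integral parametrised by \<open>r\<close>. The signs \<open>\<sigma>\<close> and \<open>\<tau>\<close> of \<open>y\<close> and \<open>r\<close> select the quarter.\<close>

lemma quarter_circle_substitution:
  fixes \<Phi> :: "real \<Rightarrow> real \<Rightarrow> 'b::euclidean_space"
  assumes a: "a > 0" and sg: "\<sigma> \<in> {1,-1::real}" and tau: "\<tau> \<in> {1,-1::real}"
    and cont: "continuous_on {z. (fst z)\<^sup>2 + (snd z)\<^sup>2 \<le> a\<^sup>2} (\<lambda>z. \<Phi> (fst z) (snd z))"
  defines "I \<equiv> (if \<sigma> = 1 then {0..a} else {-a..0})"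
  shows "((\<lambda>y. (y / sqrt (a\<^sup>2 - y\<^sup>2)) *\<^sub>R \<Phi> y (\<tau> * sqrt (a\<^sup>2 - y\<^sup>2))) has_integral
          \<sigma> *\<^sub>R integral {0..a} (\<lambda>r. \<Phi> (\<sigma> * sqrt (a\<^sup>2 - r\<^sup>2)) (\<tau> * r))) I"
proof -
  let ?s = "\<lambda>x. sqrt (a\<^sup>2 - x\<^sup>2)"
  let ?f = "\<lambda>r. \<Phi> (\<sigma> * ?s r) (\<tau> * r)"
  note le = square_le_of_abs_le[of _ a]
  have lt: "x\<^sup>2 < a\<^sup>2" if "\<bar>x\<bar> < a" for x using that a using abs_le_square_iff[of a x] by linarith
  have ss: "?s (?s y) = \<bar>y\<bar>" if "\<bar>y\<bar> \<le> a" for y using le[OF that] by simp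
  have contf: "continuous_on {0..a} ?f"
    by (rule continuous_on_disc_compose[OF cont]) (use sg tau le in \<open>auto intro!: continuous_intros simp: power_mult_distrib\<close>)
  define c d where "c = (if \<sigma> = 1 then 0 else -a)" and "d = (if \<sigma> = 1 then a else 0)"
  have I: "I = {c..d}" and cd: "c \<le> d" using a by (auto simp: I_def c_def d_def)
  have abs: "\<bar>x\<bar> \<le> a" if "x \<in> I" for x using that a by (auto simp: I_def split: if_splits)
  have "((\<lambda>x. (- x / ?s x) *\<^sub>R ?f (?s x)) has_integral (integral {?s c..?s d} ?f - integral {?s d..?s c} ?f)) {c..d}"
  \<comment> \<open>The substitution is not differentiable at the ends of the diameter, which the rule tolerates.\<close>
  proof (rule has_integral_substitution_general[where s="{a,-a}" and c=0 and d=a])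
    show "?s ` {c..d} \<subseteq> {0..a}"
    proof safe
      fix x assume "x \<in> {c..d}"
      then have "\<bar>x\<bar> \<le> a" using abs I by auto
      then have "0 \<le> ?s x" using le by simp
      moreover have "?s x \<le> sqrt (a\<^sup>2)" by (rule real_sqrt_le_mono) simp
      ultimately show "?s x \<in> {0..a}" using a by simp
    qed
    show "continuous_on {c..d} ?s" by (intro continuous_intros)
    fix x assume "x \<in> {c..d} - {a,-a}"
    then have "\<bar>x\<bar> < a" using abs[of x] I by auto
    then have "x\<^sup>2 < a\<^sup>2" by (rule lt)
    then show "(?s has_field_derivative - x / ?s x) (at x within {c..d})"
      by (auto intro!: derivative_eq_intros simp: field_simps)
  qed (use cd contf in auto)
  also have "integral {?s c..?s d} ?f - integral {?s d..?s c} ?f = (- \<sigma>) *\<^sub>R integral {0..a} ?f"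
    using sg a by (auto simp: c_def d_def)
  finally have "((\<lambda>x. -((- x / ?s x) *\<^sub>R ?f (?s x))) has_integral -((- \<sigma>) *\<^sub>R integral {0..a} ?f)) {c..d}"
    by (rule has_integral_neg)
  then show ?thesis
    unfolding I
  proof (rule has_integral_eq_rhs[OF has_integral_eq, rotated])
    fix x assume "x \<in> {c..d}"
    then have "x \<in> I" by (simp add: I)
    then have "\<bar>x\<bar> \<le> a" "\<sigma> * \<bar>x\<bar> = x" using abs sg by (auto simp: I_def split: if_splits)
    then show "- ((- x / ?s x) *\<^sub>R ?f (?s x)) = (x / ?s x) *\<^sub>R \<Phi> x (\<tau> * ?s x)"
      using ss[of x] by simp
  qed simp
qed

text \<open>With \<open>y = a cos \<theta>\<close> and \<open>r = a sin \<theta>\<close>, both integrals are \<open>\<integral> \<Phi> a cos \<theta> d\<theta>\<close> over the full circle: on the left the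
upper and lower half are graphs over \<open>y\<close>, on the right the right and left half are graphs over \<open>r\<close>.\<close>

lemma circle_integral_eq_HK:
  fixes \<Phi> :: "real \<Rightarrow> real \<Rightarrow> 'b::euclidean_space"
  assumes a: "a > 0"
    and cont: "continuous_on {z. (fst z)\<^sup>2 + (snd z)\<^sup>2 \<le> a\<^sup>2} (\<lambda>z. \<Phi> (fst z) (snd z))"
  shows "((\<lambda>y. (y / sqrt (a\<^sup>2 - y\<^sup>2)) *\<^sub>R (\<Phi> y (sqrt (a\<^sup>2 - y\<^sup>2)) + \<Phi> y (- sqrt (a\<^sup>2 - y\<^sup>2)))) has_integral
          integral {-a..a} (\<lambda>r. \<Phi> (sqrt (a\<^sup>2 - r\<^sup>2)) r - \<Phi> (- sqrt (a\<^sup>2 - r\<^sup>2)) r)) {-a..a}"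
proof -
  let ?s = "\<lambda>x. sqrt (a\<^sup>2 - x\<^sup>2)"
  note le = square_le_of_abs_le[of _ a]
  have contf: "continuous_on {-a..a} (\<lambda>r. \<Phi> (\<sigma> * ?s r) (\<tau> * r))" if sg: "\<sigma> \<in> {1,-1}" "\<tau> \<in> {1,-1::real}" for \<sigma> \<tau>
    by (rule continuous_on_disc_compose[OF cont]) (use sg le in \<open>auto intro!: continuous_intros simp: power_mult_distrib\<close>)
  let ?J = "\<lambda>\<sigma> \<tau>. integral {0..a} (\<lambda>r. \<Phi> (\<sigma> * ?s r) (\<tau> * r))"
  have int: "(\<lambda>r. \<Phi> (\<sigma> * ?s r) (\<tau> * r)) integrable_on {c..d}" 
    if sg: "\<sigma> \<in> {1,-1}" "\<tau> \<in> {1,-1::real}" "{c..d} \<subseteq> {-a..a}" for \<sigma> \<tau> c d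
    using contf[OF sg(1,2)] sg(3) by (intro integrable_continuous_interval) (rule continuous_on_subset)
  have half: "((\<lambda>y. (y / ?s y) *\<^sub>R \<Phi> y (\<tau> * ?s y)) has_integral (?J 1 \<tau> - ?J (-1) \<tau>)) {-a..a}"
    if "\<tau> \<in> {1,-1}" for \<tau> 
    using has_integral_combine[of "-a" 0 a, OF _ _ 
        quarter_circle_substitution[OF a _ that cont, of "-1", simplified]
        quarter_circle_substitution[OF a _ that cont, of 1, simplified]] a
    by simp
  have "((\<lambda>y. (y / ?s y) *\<^sub>R \<Phi> y (?s y) + (y / ?s y) *\<^sub>R \<Phi> y (- ?s y)) has_integral
     (?J 1 1 - ?J (-1) 1 + (?J 1 (-1) - ?J (-1) (-1)))) {-a..a}"
    using has_integral_add[OF half[of 1] half[of "-1"]] by simp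
  also have "?J 1 1 - ?J (-1) 1 + (?J 1 (-1) - ?J (-1) (-1)) = 
     integral {-a..a} (\<lambda>r. \<Phi> (?s r) r - \<Phi> (- ?s r) r)"
  proof -
    let ?g = "\<lambda>r. \<Phi> (?s r) r - \<Phi> (- ?s r) r"
    have gi: "?g integrable_on {c..d}" if "{c..d} \<subseteq> {-a..a}" for c d
      using int[of 1 1 c d] int[of "-1" 1 c d] that by (auto intro: integrable_diff)
    have "integral {-a..a} ?g = integral {-a..0} ?g + integral {0..a} ?g"
      using a gi by (intro Henstock_Kurzweil_Integration.integral_combine[symmetric]) auto
    also have "integral {-a..0} ?g = integral {0..a} (\<lambda>r. ?g (-r))"
      using Henstock_Kurzweil_Integration.integral_reflect_real[of a 0 "\<lambda>r. ?g (-r)"] by simp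
    also have "\<dots> = ?J 1 (-1) - ?J (-1) (-1)"
      using int[of 1 "-1" 0 a] int[of "-1" "-1" 0 a] a by (simp add: integral_diff)
    also have "integral {0..a} ?g = ?J 1 1 - ?J (-1) 1"
      using int[of 1 1 0 a] int[of "-1" 1 0 a] a by (simp add: integral_diff)
    finally show ?thesis by simp
  qed
  finally show ?thesis by (simp add: scaleR_add_right)
qed

lemma continuous_compact_bound:
  fixes g :: "'a::topological_space \<Rightarrow> 'b::real_normed_vector"
  assumes "compact A" "continuous_on A g"
  shows "\<exists>C. \<forall>y\<in>A. norm (g y) \<le> C"
  using compact_imp_bounded[OF compact_continuous_image[OF assms(2,1)]] unfolding bounded_iff by blast

text \<open>The Lebesgue version of the preceding lemma. The left integrand has an inverse square root singularity at \<open>\<plusminus> a\<close>, of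
which \<open>1 / sqrt (a\<^sup>2 - y\<^sup>2)\<close> is an integrable majorant.\<close>

lemma circle_integral_eq:
  fixes \<Phi> :: "real \<Rightarrow> real \<Rightarrow> 'b::euclidean_space"
  assumes a: "a > 0"
    and cont: "continuous_on {z. (fst z)\<^sup>2 + (snd z)\<^sup>2 \<le> a\<^sup>2} (\<lambda>z. \<Phi> (fst z) (snd z))"
  shows "(LINT y|lborel. indicator {-a..a} y *\<^sub>R
            ((y / sqrt (a\<^sup>2 - y\<^sup>2)) *\<^sub>R (\<Phi> y (sqrt (a\<^sup>2 - y\<^sup>2)) + \<Phi> y (- sqrt (a\<^sup>2 - y\<^sup>2))))) =
         (LINT r|lborel. indicator {-a..a} r *\<^sub>R
            (\<Phi> (sqrt (a\<^sup>2 - r\<^sup>2)) r - \<Phi> (- sqrt (a\<^sup>2 - r\<^sup>2)) r))"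
proof -
  let ?s = "\<lambda>x. sqrt (a\<^sup>2 - x\<^sup>2)"
  note le = square_le_of_abs_le[of _ a]
  have cont1: "continuous_on {-a..a} (\<lambda>y. \<Phi> y (\<tau> * ?s y))"
    and cont2: "continuous_on {-a..a} (\<lambda>r. \<Phi> (\<tau> * ?s r) r)" if "\<tau> \<in> {1,-1}" for \<tau>
    by (rule continuous_on_disc_compose[OF cont]; use that le in \<open>auto intro!: continuous_intros simp: power_mult_distrib\<close>)+
  let ?A = "\<lambda>y. \<Phi> y (?s y) + \<Phi> y (- ?s y)"
  let ?B = "\<lambda>r. \<Phi> (?s r) r - \<Phi> (- ?s r) r"
  let ?L = "\<lambda>y. indicator {-a..a} y *\<^sub>R ((y / ?s y) *\<^sub>R ?A y)"
  let ?Rr = "\<lambda>r. indicator {-a..a} r *\<^sub>R ?B r"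
  have contA: "continuous_on {-a..a} ?A"
    using continuous_on_add[OF cont1[of 1] cont1[of "-1"]] by simp
  have contB: "continuous_on {-a..a} ?B"
    using continuous_on_diff[OF cont2[of 1] cont2[of "-1"]] by simp
  have intB: "integrable lborel ?Rr"
    by (rule borel_integrable_compact[OF compact_Icc contB])
  obtain C where C: "\<And>y. y \<in> {-a..a} \<Longrightarrow> norm (?A y) \<le> C"
    using continuous_compact_bound[OF compact_Icc contA] by blast
  have intA: "integrable lborel ?L"
  proof (rule Bochner_Integration.integrable_bound)
    show "integrable lborel (\<lambda>y. (a * C) * (indicator {-a..a} y / ?s y))"
    proof (rule integrable_mult_right)
      show "integrable lborel (\<lambda>y. indicator {-a..a} y / ?s y)"
      proof (rule integrableI_nonneg)
        show "AE y in lborel. 0 \<le> indicator {-a..a} y / ?s y"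
          by (auto simp: indicator_def le abs_le_iff)
      qed (simp_all add: nn_integral_inverse_sqrt[OF a])
    qed
    have "?L = (\<lambda>y. (y / ?s y) *\<^sub>R (indicator {-a..a} y *\<^sub>R ?A y))" by (auto simp: mult.commute)
    also have "\<dots> \<in> borel_measurable lborel"
      using borel_measurable_continuous_on_indicator[OF _ contA] by measurable
    finally show "?L \<in> borel_measurable lborel" .
    show "AE y in lborel. norm (?L y) \<le> norm ((a * C) * (indicator {-a..a} y / ?s y))"
    proof (rule AE_I2)
      fix y
      show "norm (?L y) \<le> norm ((a * C) * (indicator {-a..a} y / ?s y))"
      proof (cases "y \<in> {-a..a}")
        case True
        then have "norm (?L y) = (\<bar>y\<bar> / ?s y) * norm (?A y)" using le[of y] by (simp add: abs_le_iff)
        also have "\<dots> \<le> (a / ?s y) * C"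
          using C[OF True] True le[of y] by (intro mult_mono divide_right_mono) auto
        also have "\<dots> \<le> norm ((a * C) * (indicator {-a..a} y / ?s y))" using True
          by simp (metis abs_ge_self abs_mult abs_divide times_divide_eq_left mult.commute)
        finally show ?thesis .
      qed simp
    qed
  qed
  have "(?L has_integral integral\<^sup>L lborel ?L) UNIV" by (rule has_integral_integral_lborel[OF intA])
  moreover have "?L = (\<lambda>y. if y \<in> {-a..a} then (y / ?s y) *\<^sub>R ?A y else 0)" by (auto simp: indicator_def)
  ultimately have "((\<lambda>y. (y / ?s y) *\<^sub>R ?A y) has_integral integral\<^sup>L lborel ?L) {-a..a}"
    by (simp add: has_integral_restrict_UNIV del: atLeastAtMost_iff)
  then have 1: "integral\<^sup>L lborel ?L = integral {-a..a} ?B"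
    using circle_integral_eq_HK[OF a cont] by (rule has_integral_unique)
  have "(?Rr has_integral integral\<^sup>L lborel ?Rr) UNIV" by (rule has_integral_integral_lborel[OF intB])
  moreover have "?Rr = (\<lambda>y. if y \<in> {-a..a} then ?B y else 0)" by (auto simp: indicator_def)
  ultimately have "(?B has_integral integral\<^sup>L lborel ?Rr) {-a..a}"
    by (simp add: has_integral_restrict_UNIV del: atLeastAtMost_iff)
  then show ?thesis using 1 by (simp add: integral_unique)
qed

interpretation lb: product_sigma_finite "\<lambda>_::nat. lborel::real measure"
  by standard

lemma emeasure_coord_ball_finite:
  assumes "finite I"
  shows "emeasure (Pi\<^sub>M I (\<lambda>_. lborel)) {w \<in> space (Pi\<^sub>M I (\<lambda>_. lborel::real measure)). (\<Sum>i\<in>I. (w i)\<^sup>2) \<le> R\<^sup>2} < \<infinity>"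
proof -
  let ?P = "Pi\<^sub>M I (\<lambda>_. lborel::real measure)"
  have "emeasure ?P {w \<in> space ?P. (\<Sum>i\<in>I. (w i)\<^sup>2) \<le> R\<^sup>2} \<le>
     emeasure ?P ({f. sqrt (\<Sum>i\<in>I. (f i)\<^sup>2) \<le> \<bar>R\<bar> + 1} \<inter> space ?P)"
  proof (rule emeasure_mono)
    show "{w \<in> space ?P. (\<Sum>i\<in>I. (w i)\<^sup>2) \<le> R\<^sup>2} \<subseteq> {f. sqrt (\<Sum>i\<in>I. (f i)\<^sup>2) \<le> \<bar>R\<bar> + 1} \<inter> space ?P"
    proof safe
      fix w assume "(\<Sum>i\<in>I. (w i)\<^sup>2) \<le> R\<^sup>2"
      then have "sqrt (\<Sum>i\<in>I. (w i)\<^sup>2) \<le> sqrt (R\<^sup>2)" by (rule real_sqrt_le_mono)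
      then show "sqrt (\<Sum>i\<in>I. (w i)\<^sup>2) \<le> \<bar>R\<bar> + 1" by simp
    qed
    have "{f. sqrt (\<Sum>i\<in>I. (f i)\<^sup>2) \<le> \<bar>R\<bar> + 1} \<inter> space ?P = {f \<in> space ?P. sqrt (\<Sum>i\<in>I. (f i)\<^sup>2) \<le> \<bar>R\<bar> + 1}" by auto
    also have "\<dots> \<in> sets ?P" by measurable
    finally show "{f. sqrt (\<Sum>i\<in>I. (f i)\<^sup>2) \<le> \<bar>R\<bar> + 1} \<inter> space ?P \<in> sets ?P" .
  qed
  also have "\<dots> = ennreal (unit_ball_vol (real (card I)) * (\<bar>R\<bar> + 1) ^ card I)"
    by (rule emeasure_cball_aux[OF assms]) simp
  also have "\<dots> < \<infinity>" by simp
  finally show ?thesis .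
qed

text \<open>Integrating over the coordinate \<open>u 0\<close> alone gives \<open>\<pi>\<close> on every line that meets the ball, since the antiderivative is an
arcsine; what remains is the volume of a ball of one dimension less.\<close>

lemma integrable_inverse_height:
  fixes R :: real and p :: nat
  shows "integrable (Pi\<^sub>M {..p} (\<lambda>_. lborel))
      (\<lambda>u. indicator {u. (\<Sum>i\<le>p. (u i)\<^sup>2) < R\<^sup>2} u * (1 / sqrt (R\<^sup>2 - (\<Sum>i\<le>p. (u i)\<^sup>2))))"
    (is "integrable _ ?W")
proof (rule integrableI_nonneg)
  let ?I = "{1..p}"
  have ins: "{..p} = insert 0 ?I" by auto
  have [measurable]: "?W \<in> borel_measurable (Pi\<^sub>M {..p} (\<lambda>_. lborel))"
    unfolding indicator_def by measurable
  show "?W \<in> borel_measurable (Pi\<^sub>M {..p} (\<lambda>_. lborel))" by measurable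
  show "AE u in Pi\<^sub>M {..p} (\<lambda>_. lborel). 0 \<le> ?W u" by (auto simp: indicator_def)
  have "(\<integral>\<^sup>+u. ennreal (?W u) \<partial>Pi\<^sub>M {..p} (\<lambda>_. lborel)) = 
    (\<integral>\<^sup>+x. (\<integral>\<^sup>+y. ennreal (?W (x(0:=y))) \<partial>lborel) \<partial>Pi\<^sub>M ?I (\<lambda>_. lborel))"
    using lb.product_nn_integral_insert[of ?I 0 "\<lambda>u. ennreal (?W u)", folded ins] by simp
  also have "\<dots> \<le> (\<integral>\<^sup>+x. ennreal pi * indicator {x \<in> space (Pi\<^sub>M ?I (\<lambda>_. lborel)). (\<Sum>i\<in>?I. (x i)\<^sup>2) \<le> R\<^sup>2} x \<partial>Pi\<^sub>M ?I (\<lambda>_. lborel))"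
  proof (rule nn_integral_mono)
    fix x :: "nat \<Rightarrow> real" assume x: "x \<in> space (Pi\<^sub>M ?I (\<lambda>_. lborel))"
    define P where "P = (\<Sum>i\<in>?I. (x i)\<^sup>2)"
    have sum: "(\<Sum>i\<le>p. ((x(0:=y)) i)\<^sup>2) = P + y\<^sup>2" for y
      unfolding ins P_def by (subst sum.insert) auto
    show "(\<integral>\<^sup>+y. ennreal (?W (x(0:=y))) \<partial>lborel) \<le> ennreal pi * indicator {x \<in> space (Pi\<^sub>M ?I (\<lambda>_. lborel)). (\<Sum>i\<in>?I. (x i)\<^sup>2) \<le> R\<^sup>2} x"
    proof (cases "P < R\<^sup>2")
      case True
      define a where "a = sqrt (R\<^sup>2 - P)"
      have a: "a > 0" "a\<^sup>2 = R\<^sup>2 - P" using True by (auto simp: a_def)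
      have "(\<integral>\<^sup>+y. ennreal (?W (x(0:=y))) \<partial>lborel) \<le> (\<integral>\<^sup>+y. ennreal (indicator {-a..a} y / sqrt (a\<^sup>2 - y\<^sup>2)) \<partial>lborel)"
      proof (rule nn_integral_mono)
        fix y :: real
        have "y \<in> {-a..a}" if "P + y\<^sup>2 < R\<^sup>2"
          using that a abs_le_square_iff[of y a] by auto
        then show "ennreal (?W (x(0:=y))) \<le> ennreal (indicator {-a..a} y / sqrt (a\<^sup>2 - y\<^sup>2))"
          using abs_le_square_iff[of y a] a unfolding indicator_def mem_Collect_eq sum a(2)
          by (auto simp: algebra_simps)
      qed
      also have "\<dots> = ennreal pi" by (rule nn_integral_inverse_sqrt[OF a(1)])
      finally show ?thesis using True x by (simp add: P_def)
    next
      case False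
      then have "\<not> P + y\<^sup>2 < R\<^sup>2" for y using zero_le_power2[of y] by linarith
      then have W0: "?W (x(0:=y)) = 0" for y unfolding indicator_def mem_Collect_eq sum by auto
      show ?thesis unfolding W0 by simp
    qed
  qed
  also have "\<dots> = ennreal pi * emeasure (Pi\<^sub>M ?I (\<lambda>_. lborel)) {x \<in> space (Pi\<^sub>M ?I (\<lambda>_. lborel)). (\<Sum>i\<in>?I. (x i)\<^sup>2) \<le> R\<^sup>2}"
    by (rule nn_integral_cmult_indicator) measurable
  also have "\<dots> < \<infinity>" using emeasure_coord_ball_finite[of ?I R] by (simp add: ennreal_mult_less_top)
  finally show "(\<integral>\<^sup>+u. ennreal (?W u) \<partial>Pi\<^sub>M {..p} (\<lambda>_. lborel)) < \<infinity>" .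
qed

section \<open>The surface integral and the divergence theorem\<close>

text \<open>The surface integral is used below only through two properties: it is a bounded linear functional on continuous functions
on the sphere \<open>K\<close>, and it satisfies the divergence theorem.\<close>

locale slice_ball = oct_slice +
  fixes R :: real
  assumes R_pos: "R > 0"
begin

definition K :: "oct set" where "K = {y \<in> V. norm y = R}"
definition KB :: "oct set" where "KB = {y \<in> V. norm y \<le> R}"
text \<open>Up to its equator, the sphere \<open>K\<close> is the union of the graphs \<open>pt 1\<close> and \<open>pt (- 1)\<close> of \<open>h\<close> and \<open>- h\<close> over \<open>D\<close>.\<close>

definition D :: "(nat \<Rightarrow> real) set" where "D = {u. (\<Sum>i\<le>p. (u i)\<^sup>2) < R\<^sup>2}"
definition h :: "(nat \<Rightarrow> real) \<Rightarrow> real" where "h u = sqrt (R\<^sup>2 - (\<Sum>i\<le>p. (u i)\<^sup>2))"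
definition pt :: "real \<Rightarrow> (nat \<Rightarrow> real) \<Rightarrow> oct" where "pt s u = Y (u(Suc p := s * h u))"
abbreviation M where "M \<equiv> Pi\<^sub>M {..p} (\<lambda>_. lborel :: real measure)"
abbreviation N where "N \<equiv> Pi\<^sub>M {..Suc p} (\<lambda>_. lborel :: real measure)"
abbreviation S where "S \<equiv> slice_sphere_integral p \<eta> R"

lemma S_eq: "S g = (\<Sum>s\<in>{1,-1}. LINT u:D|M. (R / h u) *\<^sub>R g (pt s u))"
  unfolding slice_sphere_integral_def Let_def Y_slice D_def h_def pt_def ..

lemma K_closed: "closed K" and KB_closed: "closed KB" and K_compact: "compact K" and KB_compact: "compact KB"
proof -
  have K: "K = V \<inter> sphere 0 R" and KB: "KB = V \<inter> cball 0 R" by (auto simp: K_def KB_def)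
  show "closed K" "closed KB" unfolding K KB by (auto intro: closed_Int)
  show "compact K" "compact KB" unfolding K KB by (auto intro: closed_Int_compact)
qed

lemma K_subset_KB: "K \<subseteq> KB" by (auto simp: K_def KB_def)

lemma h_pos: "u \<in> D \<Longrightarrow> h u > 0" by (auto simp: D_def h_def)

lemma pt_in_K: "u \<in> D \<Longrightarrow> s \<in> {1,-1} \<Longrightarrow> pt s u \<in> K"
proof -
  assume u: "u \<in> D" "s \<in> {1,-1}"
  have "(norm (pt s u))\<^sup>2 = (\<Sum>i\<le>p. (u i)\<^sup>2) + (s * h u)\<^sup>2"
  proof -
    have "{..Suc p} - {Suc p} = {..p}" by auto
    then show ?thesis unfolding pt_def by (subst norm_Y_upd) auto
  qed
  also have "\<dots> = R\<^sup>2" using u by (auto simp: D_def h_def power_mult_distrib)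
  finally show ?thesis using R_pos by (simp add: K_def pt_def Y_in_V)
qed

lemma h_measurable [measurable]: "h \<in> borel_measurable M"
  unfolding h_def by measurable

lemma D_measurable [measurable]: "Measurable.pred M (\<lambda>u. u \<in> D)"
  unfolding D_def mem_Collect_eq by measurable

lemma pt_measurable [measurable]: "pt s \<in> borel_measurable M"
  unfolding pt_def Y_slice[symmetric] by measurable

lemma S_integrable:
  fixes g :: "oct \<Rightarrow> oct"
  assumes g: "continuous_on K g" and s: "s \<in> {1,-1}"
  shows "set_integrable M D (\<lambda>u. (R / h u) *\<^sub>R g (pt s u))"
proof -
  obtain C where C: "\<And>y. y \<in> K \<Longrightarrow> norm (g y) \<le> C"
    using continuous_compact_bound[OF K_compact g] by blast
  have gm: "(\<lambda>y. indicator K y *\<^sub>R g y) \<in> borel_measurable borel"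
    by (rule borel_measurable_continuous_on_indicator[OF _ g]) (use K_closed in auto)
  have eq: "indicator D u *\<^sub>R (R / h u) *\<^sub>R g (pt s u) = 
     (indicator D u * (R / h u)) *\<^sub>R (indicator K (pt s u) *\<^sub>R g (pt s u))" for u
    using pt_in_K[OF _ s, of u] by (cases "u \<in> D") auto
  have [measurable]: "(\<lambda>u. indicator K (pt s u) *\<^sub>R g (pt s u)) \<in> borel_measurable M"
    by (rule measurable_compose[OF pt_measurable gm])
  show ?thesis
    unfolding set_integrable_def
  proof (rule Bochner_Integration.integrable_bound)
    show "integrable M (\<lambda>u. (C * R) * (indicator {u. (\<Sum>i\<le>p. (u i)\<^sup>2) < R\<^sup>2} u * (1 / sqrt (R\<^sup>2 - (\<Sum>i\<le>p. (u i)\<^sup>2)))))"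
      by (intro integrable_mult_right integrable_inverse_height)
    show "(\<lambda>u. indicator D u *\<^sub>R (R / h u) *\<^sub>R g (pt s u)) \<in> borel_measurable M"
      unfolding eq by (measurable) 
    show "AE u in M. norm (indicator D u *\<^sub>R (R / h u) *\<^sub>R g (pt s u))
            \<le> norm ((C * R) * (indicator {u. (\<Sum>i\<le>p. (u i)\<^sup>2) < R\<^sup>2} u * (1 / sqrt (R\<^sup>2 - (\<Sum>i\<le>p. (u i)\<^sup>2)))))"
    proof (rule AE_I2)
      fix u
      show "norm (indicator D u *\<^sub>R (R / h u) *\<^sub>R g (pt s u))
            \<le> norm ((C * R) * (indicator {u. (\<Sum>i\<le>p. (u i)\<^sup>2) < R\<^sup>2} u * (1 / sqrt (R\<^sup>2 - (\<Sum>i\<le>p. (u i)\<^sup>2)))))"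
        unfolding D_def[symmetric] h_def[symmetric]
      proof (cases "u \<in> D")
        case True
        have "norm (g (pt s u)) \<le> \<bar>C\<bar>" using C[OF pt_in_K[OF True s]] by linarith
        then show "norm (indicator D u *\<^sub>R (R / h u) *\<^sub>R g (pt s u)) \<le> norm ((C * R) * (indicator D u * (1 / h u)))"
          using True h_pos[OF True] R_pos by (simp add: abs_mult field_simps)
      qed simp
    qed
  qed
qed

lemma S_cong: "(\<And>y. y \<in> K \<Longrightarrow> g y = g' y) \<Longrightarrow> S g = S g'"
  unfolding S_eq set_lebesgue_integral_def
  by (intro sum.cong refl Bochner_Integration.integral_cong) (auto simp: indicator_def pt_in_K)

lemma S_add: "continuous_on K f \<Longrightarrow> continuous_on K g \<Longrightarrow> S (\<lambda>y. f y + g y) = S f + S g"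
  unfolding S_eq sum.distrib[symmetric]
  by (rule sum.cong[OF refl]) (simp add: scaleR_add_right set_integral_add(2) S_integrable)

text \<open>In particular octonion factors on the left of the whole integrand may be moved out of the integral.\<close>

lemma S_linear:
  assumes "bounded_linear A" "continuous_on K g" shows "S (\<lambda>y. A (g y)) = A (S g)"
proof -
  interpret A: bounded_linear A by fact
  have "(LINT u:D|M. (R / h u) *\<^sub>R A (g (pt s u))) = A (LINT u:D|M. (R / h u) *\<^sub>R g (pt s u))" if "s \<in> {1,-1}" for s
    using integral_bounded_linear[OF assms(1) S_integrable[OF assms(2) that, unfolded set_integrable_def]]
    by (simp add: set_lebesgue_integral_def A.scaleR)
  then show ?thesis unfolding S_eq A.sum by (intro sum.cong) auto
qed

lemma S_scaleR: "continuous_on K g \<Longrightarrow> S (\<lambda>y. c *\<^sub>R g y) = c *\<^sub>R S g"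
  by (rule S_linear[OF bounded_linear_scaleR_right])

lemma S_minus: "continuous_on K g \<Longrightarrow> S (\<lambda>y. - g y) = - S g"
  using S_scaleR[of g "-1"] by simp

lemma S_diff: "continuous_on K f \<Longrightarrow> continuous_on K g \<Longrightarrow> S (\<lambda>y. f y - g y) = S f - S g"
  using S_add[of f "\<lambda>y. - g y"] S_minus[of g] by (simp add: continuous_on_minus)

lemma S_zero: "S (\<lambda>y. 0) = 0"
  by (simp add: S_eq set_lebesgue_integral_def)

lemma S_sum: "(\<And>i. i \<in> I \<Longrightarrow> continuous_on K (g i)) \<Longrightarrow> S (\<lambda>y. \<Sum>i\<in>I. g i y) = (\<Sum>i\<in>I. S (g i))"
proof (induction I rule: infinite_finite_induct)
  case (insert i I)
  then show ?case by (simp add: S_add continuous_on_sum)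
qed (auto simp: S_zero)

definition area :: real where "area = 2 * (LINT u:D|M. R / h u)"

lemma S_bound:
  assumes g: "continuous_on K g" and C: "\<And>y. y \<in> K \<Longrightarrow> norm (g y) \<le> C"
  shows "norm (S g) \<le> C * area"
proof -
  have i: "integrable M (\<lambda>u. C * (indicator D u *\<^sub>R (R / h u)))"
  proof -
    have "integrable M (\<lambda>u. (C * R) * (indicator D u * (1 / h u)))"
      using integrable_inverse_height[of p R, folded h_def D_def] by (rule integrable_mult_right)
    then show ?thesis by (simp add: ac_simps)
  qed
  have "norm (LINT u:D|M. (R / h u) *\<^sub>R g (pt s u)) \<le> C * (LINT u:D|M. R / h u)" if s: "s \<in> {1,-1}" for s
  proof -
    have "norm (LINT u:D|M. (R / h u) *\<^sub>R g (pt s u)) \<le> (LINT u|M. C * (indicator D u *\<^sub>R (R / h u)))"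
      unfolding set_lebesgue_integral_def
    proof (rule order_trans[OF integral_norm_bound], rule integral_mono)
      show "integrable M (\<lambda>u. norm (indicator D u *\<^sub>R (R / h u) *\<^sub>R g (pt s u)))"
        using integrable_norm[OF S_integrable[OF g s, unfolded set_integrable_def]] .
      show "integrable M (\<lambda>u. C * (indicator D u *\<^sub>R (R / h u)))" by (rule i)
      fix u
      show "norm (indicator D u *\<^sub>R (R / h u) *\<^sub>R g (pt s u)) \<le> C * (indicator D u *\<^sub>R (R / h u))"
      proof (cases "u \<in> D")
        case True
        then show ?thesis using C[OF pt_in_K[OF True s]] h_pos[OF True] R_pos
          by (simp add: field_simps)
      qed simp
    qed
    then show ?thesis unfolding set_lebesgue_integral_def by (simp only: integral_mult_right_zero)
  qed
  from this[of 1] this[of "-1"] show ?thesis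
    unfolding S_eq area_def
    by (simp add: norm_triangle_le algebra_simps)
qed

lemma area_nonneg: "area \<ge> 0"
  unfolding area_def set_lebesgue_integral_def 
  by (auto intro!: mult_nonneg_nonneg Bochner_Integration.integral_nonneg simp: indicator_def)
     (use h_pos R_pos in \<open>auto intro: less_imp_le\<close>)

lemma KB_iff: "i \<le> Suc p \<Longrightarrow> Y (w(i := t)) \<in> KB \<longleftrightarrow> t\<^sup>2 \<le> R\<^sup>2 - (\<Sum>j\<in>{..Suc p}-{i}. (w j)\<^sup>2)"
proof -
  assume i: "i \<le> Suc p"
  have "norm (Y (w(i := t))) \<le> R \<longleftrightarrow> (norm (Y (w(i := t))))\<^sup>2 \<le> R\<^sup>2"
    using R_pos abs_le_square_iff[of "norm (Y (w(i := t)))" R] by simp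
  then show ?thesis unfolding norm_Y_upd[OF i] by (auto simp: KB_def Y_in_V)
qed

lemma KB_integrable:
  fixes G :: "oct \<Rightarrow> 'b::{banach, second_countable_topology}"
  assumes "continuous_on KB G"
  shows "integrable N (\<lambda>w. indicator KB (Y w) *\<^sub>R G (Y w))"
proof -
  obtain C where C: "\<And>y. y \<in> KB \<Longrightarrow> norm (G y) \<le> C"
    using continuous_compact_bound[OF KB_compact assms] by blast
  have Gm: "(\<lambda>y. indicator KB y *\<^sub>R G y) \<in> borel_measurable borel"
    by (rule borel_measurable_continuous_on_indicator[OF _ assms]) (use KB_closed in auto)
  let ?A = "{w \<in> space N. (\<Sum>i\<in>{..Suc p}. (w i)\<^sup>2) \<le> R\<^sup>2}"
  show ?thesis
  proof (rule integrableI_bounded_set)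
    show "?A \<in> sets N" by measurable
    show "(\<lambda>w. indicator KB (Y w) *\<^sub>R G (Y w)) \<in> borel_measurable N"
      by (rule measurable_compose[OF Y_measurable Gm])
    show "emeasure N ?A < \<infinity>" by (rule emeasure_coord_ball_finite) simp
    show "AE w in N. w \<in> ?A \<longrightarrow> norm (indicator KB (Y w) *\<^sub>R G (Y w)) \<le> \<bar>C\<bar>"
      using C by (intro AE_I2) (force simp: indicator_def)
    show "AE w in N. w \<notin> ?A \<longrightarrow> indicator KB (Y w) *\<^sub>R G (Y w) = 0"
    proof (rule AE_I2, rule impI)
      fix w assume "w \<in> space N" "w \<notin> ?A"
      then have "\<not> (norm (Y w))\<^sup>2 \<le> R\<^sup>2" unfolding norm_Y_sq by auto
      then have "Y w \<notin> KB" using R_pos abs_le_square_iff[of "norm (Y w)" R] by (auto simp: KB_def)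
      then show "indicator KB (Y w) *\<^sub>R G (Y w) = 0" by simp
    qed
  qed
qed

definition ball_integral :: "(oct \<Rightarrow> 'b::{banach, second_countable_topology}) \<Rightarrow> 'b" where
  "ball_integral G = (LINT w|N. indicator KB (Y w) *\<^sub>R G (Y w))"

lemma ball_integral_cong: "(\<And>y. y \<in> KB \<Longrightarrow> G y = H y) \<Longrightarrow> ball_integral G = ball_integral H"
  unfolding ball_integral_def by (rule Bochner_Integration.integral_cong) (auto simp: indicator_def)

lemma ball_integral_add:
  "continuous_on KB G \<Longrightarrow> continuous_on KB H \<Longrightarrow> ball_integral (\<lambda>y. G y + H y) = ball_integral G + ball_integral H"
  and ball_integral_diff:
  "continuous_on KB G \<Longrightarrow> continuous_on KB H \<Longrightarrow> ball_integral (\<lambda>y. G y - H y) = ball_integral G - ball_integral H"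
  unfolding ball_integral_def using KB_integrable[of G] KB_integrable[of H]
  by (simp_all add: scaleR_add_right scaleR_diff_right)

lemma ball_integral_linear:
  "bounded_linear A \<Longrightarrow> continuous_on KB G \<Longrightarrow> ball_integral (\<lambda>y. A (G y)) = A (ball_integral G)"
  unfolding ball_integral_def using integral_bounded_linear[of A N, OF _ KB_integrable[of G]]
  by (simp add: linear_cmul[OF bounded_linear.linear])

lemma ball_integral_sum:
  "(\<And>i. i \<in> I \<Longrightarrow> continuous_on KB (G i)) \<Longrightarrow> ball_integral (\<lambda>y. \<Sum>i\<in>I. G i y) = (\<Sum>i\<in>I. ball_integral (G i))"
  unfolding ball_integral_def scaleR_sum_right by (rule Bochner_Integration.integral_sum) (rule KB_integrable)

lemma ball_integral_norm_le:
  fixes G :: "oct \<Rightarrow> oct"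
  assumes "continuous_on KB G" "continuous_on KB g" "\<And>y. y \<in> KB \<Longrightarrow> norm (G y) \<le> g y"
  shows "norm (ball_integral G) \<le> ball_integral g"
  unfolding ball_integral_def
proof (rule order_trans[OF integral_norm_bound], rule integral_mono)
  show "integrable N (\<lambda>w. norm (indicator KB (Y w) *\<^sub>R G (Y w)))" by (rule integrable_norm[OF KB_integrable[OF assms(1)]])
qed (use KB_integrable[OF assms(2)] assms(3) in \<open>auto simp: indicator_def\<close>)

lemma Y_line: "i \<le> Suc p \<Longrightarrow> Y (w(i := s)) + t *\<^sub>R bas i = Y (w(i := s + t))"
  using Y_upd[of i w s] Y_upd[of i w "s+t"] by (simp add: scaleR_add_left)

text \<open>The line through \<open>Y w\<close> in direction \<open>bas i\<close> meets the ball of radius \<open>R\<close> in a chord; this is the square of half its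
length, and it is negative if the line misses the ball.\<close>

definition half_chord_sq :: "nat \<Rightarrow> (nat \<Rightarrow> real) \<Rightarrow> real" where
  "half_chord_sq i w = R\<^sup>2 - (\<Sum>j\<in>{..Suc p}-{i}. (w j)\<^sup>2)"

text \<open>By the fundamental theorem of calculus, this is the integral along the chord of the derivative of \<open>F\<close> in direction \<open>bas i\<close>.\<close>

definition chord_jump :: "nat \<Rightarrow> (oct \<Rightarrow> oct) \<Rightarrow> (nat \<Rightarrow> real) \<Rightarrow> oct" where
  "chord_jump i F w = (if half_chord_sq i w > 0
     then F (Y (w(i := sqrt (half_chord_sq i w)))) - F (Y (w(i := - sqrt (half_chord_sq i w)))) else 0)"

lemma chord_FTC:
  fixes F F' :: "oct \<Rightarrow> oct"
  assumes i: "i \<le> Suc p" and F': "continuous_on KB F'"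
    and deriv: "\<And>y. y \<in> KB \<Longrightarrow> ((\<lambda>t. F (y + t *\<^sub>R bas i)) has_vector_derivative F' y) (at 0)"
  shows "(LINT t|lborel. indicator KB (Y (w(i:=t))) *\<^sub>R F' (Y (w(i:=t)))) = chord_jump i F w"
proof -
  define q where "q = half_chord_sq i w"
  have KBi: "Y (w(i:=t)) \<in> KB \<longleftrightarrow> t\<^sup>2 \<le> q" for t using KB_iff[OF i, of w t] by (simp add: q_def half_chord_sq_def)
  have cj: "chord_jump i F w = (if q > 0 then F (Y (w(i := sqrt q))) - F (Y (w(i := - sqrt q))) else 0)"
    by (simp add: chord_jump_def q_def)
  show ?thesis
  proof (cases "q < 0")
    case True
    have "\<not> t\<^sup>2 \<le> q" for t using True zero_le_power2[of t] by linarith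
    then show ?thesis using True KBi cj by simp
  next
    case False
    define a where "a = sqrt (q)"
    have a: "a \<ge> 0" "a\<^sup>2 = q" using False by (auto simp: a_def)
    have KBa: "Y (w(i:=t)) \<in> KB \<longleftrightarrow> t \<in> {-a..a}" for t
      unfolding KBi a(2)[symmetric] using abs_le_square_iff[of t a] a(1) by auto
    have "(LINT t|lborel. indicator {-a..a} t *\<^sub>R F' (Y (w(i:=t)))) = F (Y (w(i := a))) - F (Y (w(i := - a)))"
    proof (rule integral_FTC_Icc[where F="\<lambda>s. F (Y (w(i:=s)))"])
      show "-a \<le> a" using a by simp
      fix t assume t: "-a \<le> t" "t \<le> a"
      have "((\<lambda>s. F (Y (w(i:=0)) + s *\<^sub>R bas i)) has_vector_derivative F' (Y (w(i:=t)))) (at t)"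
      proof (rule has_vector_derivative_shift_line[of F "Y (w(i:=0))" t "bas i"])
        have "Y (w(i:=0)) + t *\<^sub>R bas i = Y (w(i:=t))" by (simp add: Y_line i)
        then show "((\<lambda>s. F ((Y (w(i:=0)) + t *\<^sub>R bas i) + s *\<^sub>R bas i)) has_vector_derivative F' (Y (w(i:=t)))) (at 0)"
          using deriv[of "Y (w(i:=t))"] KBa t by simp
      qed
      then have "((\<lambda>s. F (Y (w(i:=s)))) has_vector_derivative F' (Y (w(i:=t)))) (at t)"
        by (simp add: Y_line i)
      then show "((\<lambda>s. F (Y (w(i:=s)))) has_vector_derivative F' (Y (w(i:=t)))) (at t within {-a..a})"
        by (rule has_vector_derivative_at_within)
    next
      show "continuous_on {-a..a} (\<lambda>t. F' (Y (w(i:=t))))"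
      proof (rule continuous_on_compose2[OF F'])
        have "continuous_on {-a..a} (\<lambda>t. Y (w(i := 0)) + t *\<^sub>R bas i)" by (intro continuous_intros)
        then show "continuous_on {-a..a} (\<lambda>t. Y (w(i := t)))" unfolding Y_upd[OF i, symmetric] .
        show "(\<lambda>t. Y (w(i := t))) ` {-a..a} \<subseteq> KB" by (rule image_subsetI) (simp only: KBa)
      qed
    qed
    moreover have "indicator KB (Y (w(i:=t))) = (indicator {-a..a} t :: real)" for t
      using KBa[of t] by (simp add: indicator_def)
    ultimately have "(LINT t|lborel. indicator KB (Y (w(i:=t))) *\<^sub>R F' (Y (w(i:=t)))) = F (Y (w(i := a))) - F (Y (w(i := - a)))"
      by simp
    moreover have "a = 0" if "\<not> q > 0" using that False by (simp add: a_def)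
    ultimately show ?thesis unfolding cj a_def[symmetric] by (cases "q > 0") auto
  qed
qed

lemma chord_jump_integrable:
  assumes i: "i \<le> Suc p" and F: "continuous_on KB F"
  shows "integrable (Pi\<^sub>M ({..Suc p} - {i}) (\<lambda>_. lborel)) (chord_jump i F)"
proof -
  define I where "I = {..Suc p} - {i}"
  define q where "q = half_chord_sq i"
  define G where G_raw: "G = chord_jump i F"
  have G_def: "G w = (if q w > 0 then F (Y (w(i := sqrt (q w)))) - F (Y (w(i := - sqrt (q w)))) else 0)" for w
    by (simp add: G_raw chord_jump_def q_def)
  have ins: "{..Suc p} = insert i I" and finI: "finite I" "i \<notin> I" using i by (auto simp: I_def)
  have "integrable (Pi\<^sub>M I (\<lambda>_. lborel)) G"
  proof -
    have Yexp: "Y (w(i := t)) = (\<Sum>j\<in>I. w j *\<^sub>R bas j) + t *\<^sub>R bas i" for w t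
      unfolding Y_def ins by (subst sum.insert[OF finI]) (use finI in \<open>auto intro!: sum.cong\<close>)
    have q [measurable]: "q \<in> borel_measurable (Pi\<^sub>M I (\<lambda>_. lborel))" unfolding q_def half_chord_sq_def I_def by measurable
    have Fm: "(\<lambda>y. indicator KB y *\<^sub>R F y) \<in> borel_measurable borel"
      by (rule borel_measurable_continuous_on_indicator[OF _ F]) (use KB_closed in auto)
    have Ym: "(\<lambda>w. Y (w(i := \<sigma> * sqrt (q w)))) \<in> borel_measurable (Pi\<^sub>M I (\<lambda>_. lborel))" for \<sigma>
      unfolding Yexp by measurable
    have Hm [measurable]: "(\<lambda>w. indicator KB (Y (w(i := \<sigma> * sqrt (q w)))) *\<^sub>R F (Y (w(i := \<sigma> * sqrt (q w))))) \<in> borel_measurable (Pi\<^sub>M I (\<lambda>_. lborel))" for \<sigma>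
      by (rule measurable_compose[OF Ym Fm])
    have inKB: "Y (w(i := \<sigma> * sqrt (q w))) \<in> KB" if "q w > 0" "\<sigma> \<in> {1,-1}" for w \<sigma>
      using that unfolding KB_iff[OF i] half_chord_sq_def[symmetric] q_def[symmetric] by (auto simp: power_mult_distrib)
    have Geq: "G w = (if q w > 0 then indicator KB (Y (w(i := 1 * sqrt (q w)))) *\<^sub>R F (Y (w(i := 1 * sqrt (q w)))) 
          - indicator KB (Y (w(i := (-1) * sqrt (q w)))) *\<^sub>R F (Y (w(i := (-1) * sqrt (q w)))) else 0)" for w
      using inKB[of w 1] inKB[of w "-1"] by (auto simp: G_def)
    obtain C where C: "\<And>y. y \<in> KB \<Longrightarrow> norm (F y) \<le> C"
      using continuous_compact_bound[OF KB_compact F] by blast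
    let ?A = "{w \<in> space (Pi\<^sub>M I (\<lambda>_. lborel)). (\<Sum>j\<in>I. (w j)\<^sup>2) \<le> R\<^sup>2}"
    show ?thesis
    proof (rule integrableI_bounded_set)
      show "?A \<in> sets (Pi\<^sub>M I (\<lambda>_. lborel))" by measurable
      show "G \<in> borel_measurable (Pi\<^sub>M I (\<lambda>_. lborel))" unfolding Geq by measurable
      show "emeasure (Pi\<^sub>M I (\<lambda>_. lborel)) ?A < \<infinity>" by (rule emeasure_coord_ball_finite[OF finI(1)])
      show "AE w in Pi\<^sub>M I (\<lambda>_. lborel). w \<in> ?A \<longrightarrow> norm (G w) \<le> 2 * \<bar>C\<bar>"
      proof (rule AE_I2, rule impI)
        fix w
        show "norm (G w) \<le> 2 * \<bar>C\<bar>"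
        proof (cases "q w > 0")
          case True
          then have "norm (G w) \<le> norm (F (Y (w(i := sqrt (q w))))) + norm (F (Y (w(i := - sqrt (q w)))))"
            by (simp add: G_def norm_triangle_ineq4)
          also have "\<dots> \<le> C + C" using inKB[OF True, of 1] inKB[OF True, of "-1"]
            by (intro add_mono C) auto
          finally show ?thesis by linarith
        qed (simp add: G_def)
      qed
      show "AE w in Pi\<^sub>M I (\<lambda>_. lborel). w \<notin> ?A \<longrightarrow> G w = 0"
        by (rule AE_I2) (auto simp: G_def q_def half_chord_sq_def I_def)
    qed
  qed
  then show ?thesis by (simp add: G_raw I_def)
qed

text \<open>The integrand of the surface integral after the two graphs have been combined, as a function of \<open>p + 1\<close> coordinates.\<close>

definition graph_density :: "(oct \<Rightarrow> oct) \<Rightarrow> (nat \<Rightarrow> real) \<Rightarrow> oct" where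
  "graph_density g u = (\<Sum>s\<in>{1,-1}. indicator D u *\<^sub>R (R / h u) *\<^sub>R g (pt s u))"

lemma graph_density_integrable: "continuous_on K g \<Longrightarrow> integrable M (graph_density g)"
  and S_graph_density: "continuous_on K g \<Longrightarrow> S g = (LINT u|M. graph_density g u)"
proof -
  assume g: "continuous_on K g"
  show "integrable M (graph_density g)"
    unfolding graph_density_def[abs_def]
    using S_integrable[OF g] by (intro Bochner_Integration.integrable_sum) (auto simp: set_integrable_def)
  show "S g = (LINT u|M. graph_density g u)"
    unfolding S_eq set_lebesgue_integral_def graph_density_def
    using S_integrable[OF g] by (intro Bochner_Integration.integral_sum[symmetric]) (auto simp: set_integrable_def)
qed

text \<open>For chords in direction \<open>\<eta>\<close>, the ends lie on the two graphs and the factor \<open>R / h u\<close> cancels against the component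
\<open>\<plusminus> h u / R\<close> of the normal.\<close>

lemma chord_jump_vertical: "chord_jump (Suc p) F u = graph_density (\<lambda>y. (y \<bullet> \<eta> / R) *\<^sub>R F y) u"
proof -
  have "{..Suc p} - {Suc p} = {..p}" by auto
  then have q: "half_chord_sq (Suc p) u = R\<^sup>2 - (\<Sum>i\<le>p. (u i)\<^sup>2)" by (simp add: half_chord_sq_def)
  show ?thesis
  proof (cases "u \<in> D")
    case uD: True
    have "pt s u \<bullet> \<eta> = s * h u" for s
      using Y_inner_bas[of "Suc p" "u(Suc p := s * h u)"] by (simp add: pt_def)
    then have e: "(R / h u) *\<^sub>R ((pt s u \<bullet> \<eta> / R) *\<^sub>R F (pt s u)) = s *\<^sub>R F (pt s u)" for s
      using h_pos[OF uD] R_pos by simp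
    have "graph_density g u = (R / h u) *\<^sub>R g (pt 1 u) + (R / h u) *\<^sub>R g (pt (- 1) u)" for g
      using uD by (simp add: graph_density_def)
    then have "graph_density (\<lambda>y. (y \<bullet> \<eta> / R) *\<^sub>R F y) u = 1 *\<^sub>R F (pt 1 u) + (- 1) *\<^sub>R F (pt (- 1) u)"
      by (simp only: e)
    moreover have "half_chord_sq (Suc p) u > 0" "h u = sqrt (half_chord_sq (Suc p) u)" using uD by (auto simp: q D_def h_def)
    ultimately show ?thesis by (simp add: chord_jump_def pt_def)
  qed (auto simp: chord_jump_def graph_density_def q D_def)
qed

text \<open>For the other directions the chords are parallel to the base of the graphs. With all coordinates except the \<open>i\<close>-th and
the one along \<open>\<eta>\<close> fixed, the sphere becomes a circle, on which the two sides are the two parametrisations of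
\<open>circle_integral_eq\<close>.\<close>

lemma chord_jump_fibre:
  assumes i: "i \<le> p" and F: "continuous_on KB F"
  shows "(LINT r|lborel. chord_jump i F (x(Suc p := r))) = (LINT t|lborel. graph_density (\<lambda>y. (y \<bullet> bas i / R) *\<^sub>R F y) (x(i := t)))"
proof -
  define I I' where "I = {..Suc p} - {i}" and "I' = {..p} - {i}"
  define q where q_raw: "q = half_chord_sq i"
  define G where G_raw: "G = chord_jump i F"
  define g where "g y = (y \<bullet> bas i / R) *\<^sub>R F y" for y
  have G_def: "G w = (if q w > 0 then F (Y (w(i := sqrt (q w)))) - F (Y (w(i := - sqrt (q w)))) else 0)" for w
    by (simp add: G_raw chord_jump_def q_raw)
  have q_def: "q w = R\<^sup>2 - (\<Sum>j\<in>I. (w j)\<^sup>2)" for w by (simp add: q_raw half_chord_sq_def I_def)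
  have ne: "i \<noteq> Suc p" and i: "i \<le> Suc p" using i by auto
  have I: "I = insert (Suc p) I'" and insM: "{..p} = insert i I'" using assms(1) by (auto simp: I_def I'_def)
  have fin': "finite I'" "i \<notin> I'" "Suc p \<notin> I'" by (auto simp: I'_def)
  let ?H = "\<lambda>u. \<Sum>s\<in>{1,-1}. indicator D u *\<^sub>R (R / h u) *\<^sub>R g (pt s u)"
  \<comment> \<open>The squared norm of the fixed coordinates; the circle has radius \<open>a = sqrt (R\<^sup>2 - P)\<close>.\<close>
  define P where "P = (\<Sum>j\<in>I'. (x j)\<^sup>2)"
  have qx: "q (x(Suc p := r)) = R\<^sup>2 - P - r\<^sup>2" for r
  proof -
    have "(\<Sum>j\<in>I. ((x(Suc p := r)) j)\<^sup>2) = r\<^sup>2 + P"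
      unfolding I P_def by (subst sum.insert) (use fin' in \<open>auto intro!: sum.cong\<close>)
    then show ?thesis by (simp add: q_def)
  qed
  have sx: "(\<Sum>j\<le>p. ((x(i := t)) j)\<^sup>2) = t\<^sup>2 + P" for t
    unfolding insM P_def by (subst sum.insert) (use fin' in \<open>auto intro!: sum.cong\<close>)
  have hx: "h (x(i := t)) = sqrt (R\<^sup>2 - P - t\<^sup>2)" for t
    unfolding h_def sx by (simp add: algebra_simps)
  have Dx: "x(i := t) \<in> D \<longleftrightarrow> t\<^sup>2 < R\<^sup>2 - P" for t
    unfolding D_def mem_Collect_eq sx by auto
  have "(LINT r|lborel. G (x(Suc p := r))) = (LINT t|lborel. ?H (x(i := t)))"
  proof (cases "P < R\<^sup>2")
    case P: False
    have nt: "\<not> t\<^sup>2 < R\<^sup>2 - P" "\<not> R\<^sup>2 - P - t\<^sup>2 > 0" for t using P zero_le_power2[of t] by linarith+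
    have "G (x(Suc p := r)) = 0" for r unfolding G_def qx using nt(2) by simp
    moreover have "?H (x(i := r)) = 0" for r using Dx nt(1) by simp
    ultimately show ?thesis by simp
  next
    case P: True
    define a where "a = sqrt (R\<^sup>2 - P)"
    have a: "a > 0" "a\<^sup>2 = R\<^sup>2 - P" using P by (auto simp: a_def)
    define \<Phi> where "\<Phi> t r = F (Y (x(i := t, Suc p := r)))" for t r
    have lt: "\<bar>t\<bar> < a \<longleftrightarrow> t\<^sup>2 < a\<^sup>2" for t using abs_le_square_iff[of a t] a(1) by auto
    have tw: "x(Suc p := r, i := t) = x(i := t, Suc p := r)" for r t using ne by (auto simp: fun_upd_twist)
    have cont: "continuous_on {z. (fst z)\<^sup>2 + (snd z)\<^sup>2 \<le> a\<^sup>2} (\<lambda>z. \<Phi> (fst z) (snd z))"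
      unfolding \<Phi>_def
    proof (rule continuous_on_compose2[OF F])
      define c where "c = Y (x(i := 0, Suc p := 0))"
      have "Y (x(i := t, Suc p := r)) = c + t *\<^sub>R bas i + r *\<^sub>R \<eta>" for t r
        unfolding c_def
        using Y_upd[of "Suc p" "x(i:=t)" r] Y_upd[of i "x(Suc p := 0)" t] i
        by (simp add: tw)
      then show "continuous_on {z. (fst z)\<^sup>2 + (snd z)\<^sup>2 \<le> a\<^sup>2} (\<lambda>z. Y (x(i := fst z, Suc p := snd z)))"
        by (simp only:) (intro continuous_intros)
      show "(\<lambda>z. Y (x(i := fst z, Suc p := snd z))) ` {z. (fst z)\<^sup>2 + (snd z)\<^sup>2 \<le> a\<^sup>2} \<subseteq> KB"
      proof safe
        fix t r :: real assume "(fst (t, r))\<^sup>2 + (snd (t, r))\<^sup>2 \<le> a\<^sup>2"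
        then have "t\<^sup>2 \<le> q (x(Suc p := r))" unfolding qx using a by simp
        then show "Y (x(i := fst (t, r), Suc p := snd (t, r))) \<in> KB"
          unfolding fst_conv snd_conv tw[symmetric] KB_iff[OF i] q_def I_def .
      qed
    qed
    have "G (x(Suc p := r)) = indicator {-a..a} r *\<^sub>R (\<Phi> (sqrt (a\<^sup>2 - r\<^sup>2)) r - \<Phi> (- sqrt (a\<^sup>2 - r\<^sup>2)) r)" for r
    proof (cases "\<bar>r\<bar> < a")
      case True
      then show ?thesis using lt[of r] a(2) unfolding G_def qx \<Phi>_def by (auto simp: tw indicator_def)
    next
      case nr: False
      then have "\<not> r\<^sup>2 < a\<^sup>2" using lt by simp
      then have "G (x(Suc p := r)) = 0" unfolding G_def qx a(2)[symmetric] by auto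
      moreover have "r \<in> {-a..a} \<Longrightarrow> r\<^sup>2 = a\<^sup>2" using nr a(1) by (auto simp: abs_less_iff not_less power2_eq_iff)
      ultimately show ?thesis by (auto simp: indicator_def)
    qed
    moreover have "?H (x(i := t)) = indicator {-a..a} t *\<^sub>R ((t / sqrt (a\<^sup>2 - t\<^sup>2)) *\<^sub>R (\<Phi> t (sqrt (a\<^sup>2 - t\<^sup>2)) + \<Phi> t (- sqrt (a\<^sup>2 - t\<^sup>2))))" for t
    proof (cases "\<bar>t\<bar> < a")
      case True
      have inD: "x(i := t) \<in> D" using True lt[of t] a(2) Dx by simp
      have "pt s (x(i := t)) \<bullet> bas i = t" for s
        unfolding pt_def using Y_inner_bas[OF i] ne by simp
      then have *: "(R / h (x(i := t))) *\<^sub>R g (pt s (x(i := t))) = (t / sqrt (a\<^sup>2 - t\<^sup>2)) *\<^sub>R \<Phi> t (s * sqrt (a\<^sup>2 - t\<^sup>2))" for s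
        using R_pos unfolding g_def hx a(2)[symmetric] by (simp add: \<Phi>_def pt_def hx a(2))
      show ?thesis using inD True unfolding * by (simp add: scaleR_add_right indicator_def abs_less_iff)
    next
      case nt: False
      then have "\<not> t\<^sup>2 < a\<^sup>2" using lt by simp
      then have "x(i := t) \<notin> D" using Dx a(2) by simp
      moreover have "t \<in> {-a..a} \<Longrightarrow> t\<^sup>2 = a\<^sup>2" using nt a(1) by (auto simp: abs_less_iff not_less power2_eq_iff)
      ultimately show ?thesis by (auto simp: indicator_def)
    qed
    ultimately show ?thesis using circle_integral_eq[OF a(1) cont] by simp
  qed
  then show ?thesis unfolding graph_density_def g_def G_raw .
qed

text \<open>Fubini's theorem reduces the left side to an integral of \<open>chord_jump i F\<close> over the remaining coordinates. If these are not
the coordinates of the graphs, one more application of Fubini on both sides leaves an integral over circles.\<close>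

theorem divergence_theorem:
  fixes F F' :: "oct \<Rightarrow> oct"
  assumes i: "i \<le> Suc p" and F: "continuous_on KB F" and F': "continuous_on KB F'"
    and deriv: "\<And>y. y \<in> KB \<Longrightarrow> ((\<lambda>t. F (y + t *\<^sub>R bas i)) has_vector_derivative F' y) (at 0)"
  shows "ball_integral F' = S (\<lambda>y. (y \<bullet> bas i / R) *\<^sub>R F y)"
proof -
  define I where "I = {..Suc p} - {i}"
  let ?g = "\<lambda>y. (y \<bullet> bas i / R) *\<^sub>R F y"
  have ins: "{..Suc p} = insert i I" and finI: "finite I" "i \<notin> I" using i by (auto simp: I_def)
  have g: "continuous_on K ?g"
    using R_pos by (intro continuous_intros continuous_on_subset[OF F K_subset_KB]) auto
  have "ball_integral F' = (LINT w|Pi\<^sub>M I (\<lambda>_. lborel). (LINT t|lborel. indicator KB (Y (w(i:=t))) *\<^sub>R F' (Y (w(i:=t)))))"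
    unfolding ball_integral_def ins
    by (rule lb.product_integral_insert[OF finI]) (use KB_integrable[OF F'] in \<open>simp flip: ins\<close>)
  also have "\<dots> = (LINT w|Pi\<^sub>M I (\<lambda>_. lborel). chord_jump i F w)"
    by (simp only: chord_FTC[OF i F' deriv])
  also have "\<dots> = S ?g"
  proof (cases "i = Suc p")
    case True
    then have "I = {..p}" by (auto simp: I_def)
    then show ?thesis using True S_graph_density[OF g] by (simp add: chord_jump_vertical)
  next
    case False
    then have ip: "i \<le> p" using i by simp
    define I' where "I' = {..p} - {i}"
    have I: "I = insert (Suc p) I'" and insM: "{..p} = insert i I'" using ip by (auto simp: I_def I'_def)
    have fin': "finite I'" "i \<notin> I'" "Suc p \<notin> I'" by (auto simp: I'_def)
    have "(LINT w|Pi\<^sub>M I (\<lambda>_. lborel). chord_jump i F w) = (LINT x|Pi\<^sub>M I' (\<lambda>_. lborel). (LINT r|lborel. chord_jump i F (x(Suc p := r))))"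
      unfolding I by (rule lb.product_integral_insert[OF fin'(1,3)])
        (use chord_jump_integrable[OF i F] in \<open>simp add: I_def[symmetric] flip: I\<close>)
    also have "\<dots> = (LINT x|Pi\<^sub>M I' (\<lambda>_. lborel). (LINT t|lborel. graph_density ?g (x(i := t))))"
      by (simp only: chord_jump_fibre[OF ip F])
    also have "\<dots> = (LINT u|M. graph_density ?g u)"
      unfolding insM by (rule lb.product_integral_insert[OF fin'(1,2), symmetric])
        (use graph_density_integrable[OF g] in \<open>simp flip: insM\<close>)
    finally show ?thesis by (simp add: S_graph_density[OF g])
  qed
  finally show ?thesis .
qed

end

section \<open>The Cauchy integral formula\<close>

text \<open>The Cauchy kernel with \<open>|z|\<^sup>2\<close> replaced by \<open>|z|\<^sup>2 + e\<^sup>2\<close>: smooth everywhere, and equal to the Cauchy kernel for \<open>e = 0\<close>.\<close>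

definition cauchy_reg :: "nat \<Rightarrow> real \<Rightarrow> oct \<Rightarrow> oct" where
  "cauchy_reg p e z = (1 / (sphere_area p * sqrt (z \<bullet> z + e\<^sup>2) ^ (p + 2))) *\<^sub>R oct_cnj z"

text \<open>The image of the regularised kernel under the Cauchy-Riemann operator acting from the right, see \<open>cauchy_reg_divergence\<close>.
For \<open>e \<rightarrow> 0\<close> these functions approach the delta distribution.\<close>

definition cauchy_bump :: "nat \<Rightarrow> real \<Rightarrow> oct \<Rightarrow> real" where
  "cauchy_bump p e z = (real (p + 2) / sphere_area p) * (e\<^sup>2 / sqrt (z \<bullet> z + e\<^sup>2) ^ (p + 4))"

text \<open>The derivative of \<open>cauchy_reg\<close> in direction \<open>b\<close>.\<close>

definition cauchy_reg_deriv :: "nat \<Rightarrow> real \<Rightarrow> oct \<Rightarrow> oct \<Rightarrow> oct" where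
  "cauchy_reg_deriv p e b z = (1 / sphere_area p) *\<^sub>R
     ((1 / sqrt (z \<bullet> z + e\<^sup>2) ^ (p + 2)) *\<^sub>R oct_cnj b
       - (real (p + 2) * (z \<bullet> b) / sqrt (z \<bullet> z + e\<^sup>2) ^ (p + 4)) *\<^sub>R oct_cnj z)"

lemma sphere_area_pos: "sphere_area p > 0"
  unfolding sphere_area_def by (auto intro!: divide_pos_pos mult_pos_pos zero_less_power Gamma_real_pos)

lemma bounded_linear_oct_cnj: "bounded_linear oct_cnj"
proof -
  have "bounded_linear (\<lambda>x. (2 * (x \<bullet> oct_e 0)) *\<^sub>R oct_e 0 - x)"
    by (intro bounded_linear_intros)
  moreover have "oct_cnj = (\<lambda>x. (2 * (x \<bullet> oct_e 0)) *\<^sub>R oct_e 0 - x)" by (rule ext) (rule oct_cnj_eq)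
  ultimately show ?thesis by simp
qed

lemma cauchy_reg_zero: "cauchy_reg p 0 z = cauchy_kernel p z"
  by (simp add: cauchy_reg_def cauchy_kernel_def norm_eq_sqrt_inner[symmetric])

lemma radius_pos: "e \<noteq> 0 \<or> z \<noteq> 0 \<Longrightarrow> (z::oct) \<bullet> z + e\<^sup>2 > 0"
  by (metis add.commute add_nonneg_pos inner_ge_zero inner_gt_zero_iff zero_le_power2 zero_less_power2)

lemma radius_has_derivative:
  fixes z b :: oct
  assumes "e \<noteq> 0 \<or> z \<noteq> 0"
  shows "((\<lambda>t. sqrt ((z + t *\<^sub>R b) \<bullet> (z + t *\<^sub>R b) + e\<^sup>2)) has_real_derivative ((z \<bullet> b) / sqrt (z \<bullet> z + e\<^sup>2))) (at 0)"
proof -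
  have "((\<lambda>t. (z + t *\<^sub>R b) \<bullet> (z + t *\<^sub>R b) + e\<^sup>2) has_real_derivative (2 * (z \<bullet> b))) (at 0)"
  proof -
    have "(\<lambda>t. (z + t *\<^sub>R b) \<bullet> (z + t *\<^sub>R b) + e\<^sup>2) = (\<lambda>t. z \<bullet> z + 2 * t * (z \<bullet> b) + t\<^sup>2 * (b \<bullet> b) + e\<^sup>2)"
      by (rule ext) (simp add: inner_add_left inner_add_right inner_commute power2_eq_square algebra_simps)
    then show ?thesis by (auto intro!: derivative_eq_intros)
  qed
  from DERIV_chain2[OF DERIV_real_sqrt this] radius_pos[OF assms]
  show ?thesis by (simp add: field_simps)
qed

lemma inverse_power_has_derivative:
  fixes g :: "real \<Rightarrow> real"
  assumes "(g has_real_derivative D) (at t)" "g t > 0"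
  shows "((\<lambda>t. 1 / g t ^ n) has_real_derivative - (real n * D / g t ^ (n + 1))) (at t)"
proof -
  have "((\<lambda>t. 1 / g t ^ n) has_real_derivative - (real n * (g t ^ (n - 1) * D)) / (g t ^ n * g t ^ n)) (at t)"
    using assms by (auto intro!: derivative_eq_intros)
  moreover have "- (real n * (g t ^ (n - 1) * D)) / (g t ^ n * g t ^ n) = - (real n * D / g t ^ (n + 1))"
    using assms(2) by (cases n) (auto simp: field_simps)
  ultimately show ?thesis by simp
qed

lemma inverse_radius_power_has_derivative:
  fixes z b :: oct
  assumes "e \<noteq> 0 \<or> z \<noteq> 0"
  shows "((\<lambda>t. 1 / sqrt ((z + t *\<^sub>R b) \<bullet> (z + t *\<^sub>R b) + e\<^sup>2) ^ n) has_real_derivative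
     - (real n * (z \<bullet> b) / sqrt (z \<bullet> z + e\<^sup>2) ^ (n + 2))) (at 0)"
proof -
  have "0 < sqrt ((z + 0 *\<^sub>R b) \<bullet> (z + 0 *\<^sub>R b) + e\<^sup>2)" using radius_pos[OF assms] by simp
  from inverse_power_has_derivative[OF radius_has_derivative[OF assms, of b] this, of n]
  show ?thesis by (simp add: field_simps)
qed

lemma cauchy_reg_has_derivative:
  assumes "e \<noteq> 0 \<or> z \<noteq> 0"
  shows "((\<lambda>t. cauchy_reg p e (z + t *\<^sub>R b)) has_vector_derivative cauchy_reg_deriv p e b z) (at 0)"
proof -
  let ?r = "\<lambda>z. sqrt (z \<bullet> z + e\<^sup>2)"
  have "p + 2 + 2 = p + 4" by simp
  note d = inverse_radius_power_has_derivative[OF assms, of b "p+2", unfolded this]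
  have c: "((\<lambda>t. oct_cnj (z + t *\<^sub>R b)) has_vector_derivative oct_cnj b) (at 0)"
    by (rule bounded_linear.has_vector_derivative[OF bounded_linear_oct_cnj]) (auto intro!: derivative_eq_intros)
  have "((\<lambda>t. (1 / sphere_area p) *\<^sub>R ((1 / ?r (z + t *\<^sub>R b) ^ (p+2)) *\<^sub>R oct_cnj (z + t *\<^sub>R b)))
     has_vector_derivative (1 / sphere_area p) *\<^sub>R ((1 / ?r (z + 0 *\<^sub>R b) ^ (p+2)) *\<^sub>R oct_cnj b
        + (- (real (p+2) * (z \<bullet> b) / ?r z ^ (p+4))) *\<^sub>R oct_cnj (z + 0 *\<^sub>R b))) (at 0)"
    by (intro bounded_linear.has_vector_derivative[OF bounded_linear_scaleR_right]
        has_vector_derivative_scaleR[OF d c])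
  then show ?thesis by (simp add: cauchy_reg_def cauchy_reg_deriv_def)
qed

lemma cauchy_reg_continuous: "e \<noteq> 0 \<Longrightarrow> continuous_on A (cauchy_reg p e)"
  and cauchy_reg_deriv_continuous: "e \<noteq> 0 \<Longrightarrow> continuous_on A (cauchy_reg_deriv p e b)"
  and cauchy_bump_continuous: "e \<noteq> 0 \<Longrightarrow> continuous_on A (cauchy_bump p e)"
  unfolding cauchy_reg_def cauchy_reg_deriv_def cauchy_bump_def
  using sphere_area_pos[of p] radius_pos[of e]
  by (auto intro!: continuous_intros bounded_linear.continuous_on[OF bounded_linear_oct_cnj] simp: less_imp_neq[symmetric] order_less_imp_not_eq2)

lemma cauchy_bump_nonneg: "cauchy_bump p e z \<ge> 0"
  unfolding cauchy_bump_def using sphere_area_pos[of p] by (auto intro!: mult_nonneg_nonneg divide_nonneg_nonneg)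

text \<open>Away from the origin the bump is of order \<open>e\<^sup>2\<close>; all error terms below come from this estimate.\<close>

lemma cauchy_bump_away_from_zero:
  assumes "norm z \<ge> d" "d > 0"
  shows "cauchy_bump p e z \<le> (real (p + 2) / sphere_area p) * (e\<^sup>2 / d ^ (p + 4))"
proof -
  have "d \<le> sqrt (z \<bullet> z)" using assms by (simp add: norm_eq_sqrt_inner)
  also have "\<dots> \<le> sqrt (z \<bullet> z + e\<^sup>2)" by (rule real_sqrt_le_mono) simp
  finally have "d ^ (p + 4) \<le> sqrt (z \<bullet> z + e\<^sup>2) ^ (p + 4)" using assms by (intro power_mono) auto
  moreover have "z \<noteq> 0" using assms by auto
  then have "0 < sqrt (z \<bullet> z + e\<^sup>2)" using radius_pos[of e z] by auto
  ultimately show ?thesis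
    unfolding cauchy_bump_def using sphere_area_pos[of p] assms
    by (intro mult_left_mono divide_left_mono mult_pos_pos zero_less_power) (auto intro: order_less_le_trans[of 0 "d ^ (p+4)"])
qed

text \<open>Lebesgue measure on boxes is invariant under translation, and boxes determine the product measure.\<close>

lemma PiM_lborel_translate:
  fixes a :: "nat \<Rightarrow> real"
  assumes "finite I"
  shows "distr (Pi\<^sub>M I (\<lambda>_. lborel)) (Pi\<^sub>M I (\<lambda>_. lborel)) (\<lambda>w. \<lambda>i\<in>I. a i + w i) = Pi\<^sub>M I (\<lambda>_. lborel)"
proof (rule lb.PiM_eqI[OF assms])
  let ?P = "Pi\<^sub>M I (\<lambda>_. lborel::real measure)"
  have [measurable]: "(\<lambda>w. \<lambda>i\<in>I. a i + w i) \<in> measurable ?P ?P"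
    by measurable
  show "sets (distr ?P ?P (\<lambda>w. \<lambda>i\<in>I. a i + w i)) = sets ?P" by simp
  fix A assume A: "\<And>i. i \<in> I \<Longrightarrow> A i \<in> sets (lborel::real measure)"
  have "emeasure (distr ?P ?P (\<lambda>w. \<lambda>i\<in>I. a i + w i)) (Pi\<^sub>E I A) = 
    emeasure ?P ((\<lambda>w. \<lambda>i\<in>I. a i + w i) -` Pi\<^sub>E I A \<inter> space ?P)"
    by (rule emeasure_distr) (use A assms in \<open>auto intro!: sets_PiM_I_finite\<close>)
  also have "(\<lambda>w. \<lambda>i\<in>I. a i + w i) -` Pi\<^sub>E I A \<inter> space ?P = Pi\<^sub>E I (\<lambda>i. (+) (a i) -` A i)"
    by (auto simp: space_PiM PiE_iff)
  also have "emeasure ?P \<dots> = (\<Prod>i\<in>I. emeasure lborel ((+) (a i) -` A i))"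
  proof (rule lb.emeasure_PiM[OF assms])
    fix i assume "i \<in> I"
    then show "(+) (a i) -` A i \<in> sets lborel"
      using A measurable_sets[of "(+) (a i)" lborel lborel "A i"] by simp
  qed
  also have "\<dots> = (\<Prod>i\<in>I. emeasure lborel (A i))"
  proof (rule prod.cong[OF refl])
    fix i assume "i \<in> I"
    then have "emeasure (distr lborel borel ((+) (a i))) (A i) = emeasure lborel ((+) (a i) -` A i)"
      using A by (subst emeasure_distr) auto
    then show "emeasure lborel ((+) (a i) -` A i) = emeasure lborel (A i)"
      by (simp add: lborel_distr_plus)
  qed
  finally show "emeasure (distr ?P ?P (\<lambda>w. \<lambda>i\<in>I. a i + w i)) (Pi\<^sub>E I A) = (\<Prod>i\<in>I. emeasure lborel (A i))" .
qed

context slice_ball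
begin

text \<open>The integrand is uniformly continuous on the compact set \<open>K \<times> T\<close>, so it depends on the parameter continuously in the
sup norm, with respect to which \<open>S\<close> is bounded.\<close>

lemma S_continuous_param:
  fixes G :: "oct \<Rightarrow> 'c::metric_space \<Rightarrow> oct"
  assumes G: "continuous_on (K \<times> T) (\<lambda>z. G (fst z) (snd z))" and T: "compact T"
  shows "continuous_on T (\<lambda>t. S (\<lambda>y. G y t))"
proof -
  have Gt: "continuous_on K (\<lambda>y. G y t)" if "t \<in> T" for t
  proof -
    have "continuous_on K ((\<lambda>z. G (fst z) (snd z)) \<circ> (\<lambda>y. (y, t)))"
      by (intro continuous_on_compose continuous_intros continuous_on_subset[OF G]) (use that in auto)
    then show ?thesis by (simp add: o_def)
  qed
  have uc: "uniformly_continuous_on (K \<times> T) (\<lambda>z. G (fst z) (snd z))"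
    by (rule compact_uniformly_continuous[OF G compact_Times[OF K_compact T]])
  show ?thesis
    unfolding continuous_on_iff
  proof (intro ballI allI impI)
    fix t e assume t: "t \<in> T" and e: "(e::real) > 0"
    define e' where "e' = e / (area + 1)"
    have e': "e' > 0" "e' * area < e" using e area_nonneg by (auto simp: e'_def field_simps)
    then obtain d where d: "d > 0" "\<And>z z'. z \<in> K \<times> T \<Longrightarrow> z' \<in> K \<times> T \<Longrightarrow> dist z' z < d \<Longrightarrow> dist (G (fst z') (snd z')) (G (fst z) (snd z)) < e'"
      using uc[unfolded uniformly_continuous_on_def, rule_format, OF e'(1)] by metis
    show "\<exists>d>0. \<forall>t'\<in>T. dist t' t < d \<longrightarrow> dist (S (\<lambda>y. G y t')) (S (\<lambda>y. G y t)) < e"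
    proof (intro exI[of _ d] conjI ballI impI d)
      fix t' assume t': "t' \<in> T" "dist t' t < d"
      have "norm (S (\<lambda>y. G y t' - G y t)) \<le> e' * area"
      proof (rule S_bound)
        show "continuous_on K (\<lambda>y. G y t' - G y t)" using Gt t t' by (intro continuous_intros)
        fix y assume "y \<in> K"
        then have "dist (G y t') (G y t) < e'" using d(2)[of "(y,t)" "(y,t')"] t t' by (simp add: dist_Pair_Pair)
        then show "norm (G y t' - G y t) \<le> e'" by (simp add: dist_norm)
      qed
      then show "dist (S (\<lambda>y. G y t')) (S (\<lambda>y. G y t)) < e"
        using e' Gt t t' by (simp add: dist_norm S_diff)
    qed
  qed
qed

text \<open>What the integral formulas need of \<open>f\<close> on one closed slice ball: continuous partial derivatives \<open>df i\<close> along \<open>bas i\<close> that are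
annihilated by the Cauchy-Riemann operator.\<close>

definition monogenic :: "(oct \<Rightarrow> oct) \<Rightarrow> (nat \<Rightarrow> oct \<Rightarrow> oct) \<Rightarrow> bool" where
  "monogenic f df \<longleftrightarrow> continuous_on KB f \<and> (\<forall>i\<le>Suc p. continuous_on KB (df i)) \<and>
     (\<forall>i\<le>Suc p. \<forall>y\<in>KB. ((\<lambda>t. f (y + t *\<^sub>R bas i)) has_vector_derivative df i y) (at 0)) \<and>
     (\<forall>y\<in>KB. (\<Sum>i\<le>Suc p. bas i \<odot> df i y) = 0)"

lemma sum_bas_mult: "z \<in> V \<Longrightarrow> (\<Sum>i\<le>Suc p. (z \<bullet> bas i) *\<^sub>R (bas i \<odot> v)) = z \<odot> v"
  by (subst (2) V_expand) (simp_all add: oct.sum_left oct.scaleR_left)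

text \<open>The derivative of \<open>cauchy_reg\<close> in direction \<open>bas i\<close> is a combination of the conjugates of \<open>bas i\<close> and of \<open>z\<close>. The former
contribute \<open>cnj (bas i) (bas i v) = v\<close> each; the latter add up to \<open>cnj z (z v) = |z|\<^sup>2 v\<close> because
\<open>\<Sum> (z \<bullet> bas i) bas i = z\<close>. With the exponent \<open>p + 2\<close> the two cancel up to a multiple of \<open>e\<^sup>2\<close>.\<close>

lemma cauchy_reg_divergence:
  assumes z: "z \<in> V" and e: "e \<noteq> 0"
  shows "(\<Sum>i\<le>Suc p. cauchy_reg_deriv p e (bas i) z \<odot> (bas i \<odot> v)) = cauchy_bump p e z *\<^sub>R v"
proof -
  let ?r = "sqrt (z \<bullet> z + e\<^sup>2)"
  have r: "?r > 0" using radius_pos[of e z] e by simp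
  have zz: "z \<bullet> z = ?r\<^sup>2 - e\<^sup>2" using radius_pos[of e z] e by simp
  have 1: "oct_cnj (bas i) \<odot> (bas i \<odot> v) = v" if "i \<le> Suc p" for i
    using that by (simp add: oct_cnj_mult_mult bas_inner)
  have "(\<Sum>i\<le>Suc p. cauchy_reg_deriv p e (bas i) z \<odot> (bas i \<odot> v)) = 
    (\<Sum>i\<le>Suc p. (1 / sphere_area p) *\<^sub>R ((1 / ?r ^ (p + 2)) *\<^sub>R v - (real (p + 2) / ?r ^ (p + 4)) *\<^sub>R (oct_cnj z \<odot> ((z \<bullet> bas i) *\<^sub>R (bas i \<odot> v)))))"
    by (rule sum.cong) (simp_all add: cauchy_reg_deriv_def oct.scaleR_left oct.scaleR_right oct.diff_left 1)
  also have "\<dots> = (1 / sphere_area p) *\<^sub>R ((real (p + 2) / ?r ^ (p + 2)) *\<^sub>R v - 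
     (real (p + 2) / ?r ^ (p + 4)) *\<^sub>R (oct_cnj z \<odot> (\<Sum>i\<le>Suc p. (z \<bullet> bas i) *\<^sub>R (bas i \<odot> v))))"
    by (simp add: scaleR_sum_right[symmetric] sum_subtractf oct.sum_right sum_constant_scaleR del: sum_constant)
  also have "oct_cnj z \<odot> (\<Sum>i\<le>Suc p. (z \<bullet> bas i) *\<^sub>R (bas i \<odot> v)) = (?r\<^sup>2 - e\<^sup>2) *\<^sub>R v"
    unfolding sum_bas_mult[OF z] oct_cnj_mult_mult by (subst zz) simp
  also have "(1 / sphere_area p) *\<^sub>R ((real (p + 2) / ?r ^ (p + 2)) *\<^sub>R v - (real (p + 2) / ?r ^ (p + 4)) *\<^sub>R ((?r\<^sup>2 - e\<^sup>2) *\<^sub>R v))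
     = ((1 / sphere_area p) * (real (p + 2) / ?r ^ (p + 2) - (real (p + 2) / ?r ^ (p + 4)) * (?r\<^sup>2 - e\<^sup>2))) *\<^sub>R v"
    by (simp add: scaleR_diff_left scaleR_diff_right right_diff_distrib)
  also have "(1 / sphere_area p) * (real (p + 2) / ?r ^ (p + 2) - (real (p + 2) / ?r ^ (p + 4)) * (?r\<^sup>2 - e\<^sup>2)) = cauchy_bump p e z"
  proof -
    have "a / r ^ (p + 2) - (a / r ^ (p + 4)) * (r\<^sup>2 - e\<^sup>2) = a * (e\<^sup>2 / r ^ (p + 4))" if "r > 0" for a r :: real
    proof -
      have "r ^ (p + 4) = r ^ (p + 2) * r\<^sup>2"
        unfolding power_add[symmetric] by (rule arg_cong[where f="\<lambda>n. r ^ n"]) simp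
      then show ?thesis using that by (simp add: field_simps)
    qed
    from this[OF r, of "real (p + 2)"] show ?thesis unfolding cauchy_bump_def by simp
  qed
  finally show ?thesis .
qed

text \<open>The divergence theorem for the fields \<open>cauchy_reg p e (y - x) \<odot> (bas i \<odot> f y)\<close>, summed over \<open>i\<close>.\<close>

lemma cauchy_regularised:
  assumes f: "monogenic f df" and x: "x \<in> V" and e: "e \<noteq> 0"
  shows "S (\<lambda>y. cauchy_reg p e (y - x) \<odot> ((y /\<^sub>R R) \<odot> f y)) =
     ball_integral (\<lambda>y. cauchy_bump p e (y - x) *\<^sub>R f y)"
proof -
  note fc = f[unfolded monogenic_def]
  let ?F = "\<lambda>i y. cauchy_reg p e (y - x) \<odot> (bas i \<odot> f y)"
  let ?F' = "\<lambda>i y. cauchy_reg p e (y - x) \<odot> (bas i \<odot> df i y) + cauchy_reg_deriv p e (bas i) (y - x) \<odot> (bas i \<odot> f y)"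
  have cr1: "continuous_on KB (\<lambda>y. cauchy_reg p e (y - x))"
    by (rule continuous_on_compose2[OF cauchy_reg_continuous[OF e, of UNIV]]) (auto intro: continuous_intros)
  have cr2: "continuous_on KB (\<lambda>y. cauchy_reg_deriv p e (bas i) (y - x))" for i
    by (rule continuous_on_compose2[OF cauchy_reg_deriv_continuous[OF e, of UNIV]]) (auto intro: continuous_intros)
  note cr = cr1 cr2
  have Fc: "continuous_on KB (?F i)" if "i \<le> Suc p" for i
    using fc that by (intro oct.continuous_on cr continuous_intros) auto
  have F'c: "continuous_on KB (?F' i)" if "i \<le> Suc p" for i
    using fc that by (intro oct.continuous_on cr continuous_intros) auto
  have div: "ball_integral (?F' i) = S (\<lambda>y. (y \<bullet> bas i / R) *\<^sub>R ?F i y)" if i: "i \<le> Suc p" for i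
  proof (rule divergence_theorem[OF i Fc[OF i] F'c[OF i]])
    fix y assume y: "y \<in> KB"
    have 1: "((\<lambda>t. cauchy_reg p e ((y - x) + t *\<^sub>R bas i)) has_vector_derivative cauchy_reg_deriv p e (bas i) (y - x)) (at 0)"
      by (rule cauchy_reg_has_derivative) (use e in simp)
    have 2: "((\<lambda>t. bas i \<odot> f (y + t *\<^sub>R bas i)) has_vector_derivative bas i \<odot> df i y) (at 0)"
      using fc i y by (intro bounded_linear.has_vector_derivative[OF oct.bounded_linear_right]) auto
    have "((\<lambda>t. cauchy_reg p e ((y - x) + t *\<^sub>R bas i) \<odot> (bas i \<odot> f (y + t *\<^sub>R bas i))) has_vector_derivative
       (cauchy_reg p e ((y - x) + 0 *\<^sub>R bas i) \<odot> (bas i \<odot> df i y) + cauchy_reg_deriv p e (bas i) (y - x) \<odot> (bas i \<odot> f (y + 0 *\<^sub>R bas i)))) (at 0)"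
      by (rule oct.has_vector_derivative[OF 1 2])
    then show "((\<lambda>t. ?F i (y + t *\<^sub>R bas i)) has_vector_derivative ?F' i y) (at 0)" by (simp add: algebra_simps)
  qed
  have "S (\<lambda>y. cauchy_reg p e (y - x) \<odot> ((y /\<^sub>R R) \<odot> f y)) = S (\<lambda>y. \<Sum>i\<le>Suc p. (y \<bullet> bas i / R) *\<^sub>R ?F i y)"
  proof (rule S_cong)
    fix y assume "y \<in> K"
    then have y: "y \<in> V" by (simp add: K_def)
    have "(\<Sum>i\<le>Suc p. (y \<bullet> bas i / R) *\<^sub>R ?F i y) = cauchy_reg p e (y - x) \<odot> (\<Sum>i\<le>Suc p. ((y /\<^sub>R R) \<bullet> bas i) *\<^sub>R (bas i \<odot> f y))"
      by (simp add: oct.sum_right oct.scaleR_right divide_inverse mult.commute)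
    then show "cauchy_reg p e (y - x) \<odot> ((y /\<^sub>R R) \<odot> f y) = (\<Sum>i\<le>Suc p. (y \<bullet> bas i / R) *\<^sub>R ?F i y)"
      using sum_bas_mult[OF V_scale[OF y]] by simp
  qed
  also have "\<dots> = (\<Sum>i\<le>Suc p. S (\<lambda>y. (y \<bullet> bas i / R) *\<^sub>R ?F i y))"
    using R_pos by (intro S_sum continuous_intros continuous_on_subset[OF Fc K_subset_KB]) auto
  also have "\<dots> = (\<Sum>i\<le>Suc p. ball_integral (?F' i))"
    by (rule sum.cong) (simp_all add: div)
  also have "\<dots> = ball_integral (\<lambda>y. \<Sum>i\<le>Suc p. ?F' i y)"
    by (rule ball_integral_sum[symmetric]) (use F'c in simp)
  also have "\<dots> = ball_integral (\<lambda>y. cauchy_bump p e (y - x) *\<^sub>R f y)"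
  proof (rule ball_integral_cong)
    fix y assume y: "y \<in> KB"
    then have "y \<in> V" by (simp add: KB_def)
    then have "(\<Sum>i\<le>Suc p. ?F' i y) = cauchy_reg p e (y - x) \<odot> (\<Sum>i\<le>Suc p. bas i \<odot> df i y) + cauchy_bump p e (y - x) *\<^sub>R f y"
      using cauchy_reg_divergence[OF V_diff[OF _ x] e, of y "f y"] by (simp add: sum.distrib oct.sum_right)
    then show "(\<Sum>i\<le>Suc p. ?F' i y) = cauchy_bump p e (y - x) *\<^sub>R f y"
      using fc y by (simp add: oct.zero_right)
  qed
  finally show ?thesis .
qed

lemma ball_integral_const:
  fixes v :: "'b::{banach, second_countable_topology}"
  shows "ball_integral (\<lambda>_. v) = (unit_ball_vol (real (p + 2)) * R ^ (p + 2)) *\<^sub>R v"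
proof -
  let ?B = "{w \<in> space N. Y w \<in> KB}"
  have "?B = {f. sqrt (\<Sum>i\<in>{..Suc p}. (f i)\<^sup>2) \<le> R} \<inter> space N"
    using R_pos by (auto simp: KB_def Y_in_V norm_Y_sq[symmetric])
  then have e: "emeasure N ?B = ennreal (unit_ball_vol (real (card {..Suc p})) * R ^ card {..Suc p})"
    using emeasure_cball_aux[of "{..Suc p}" R] R_pos by simp
  have "?B = Y -` KB \<inter> space N" by auto
  also have "\<dots> \<in> sets N" by (rule measurable_sets[OF Y_measurable]) (use KB_closed in auto)
  finally have s: "?B \<in> sets N" .
  have i: "integrable N (\<lambda>w. indicat_real ?B w)" by (rule integrable_real_indicator[OF s]) (simp add: e)
  have "ball_integral (\<lambda>_. v) = (LINT w|N. indicat_real ?B w *\<^sub>R v)"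
    unfolding ball_integral_def by (rule Bochner_Integration.integral_cong) (auto simp: indicator_def)
  also have "\<dots> = measure N ?B *\<^sub>R v" using i s by simp
  finally show ?thesis using R_pos by (simp add: measure_def e unit_ball_vol_nonneg)
qed

text \<open>The area of the sphere. The field \<open>y\<close> has divergence \<open>p + 2\<close> and normal component \<open>R\<close>, so \<open>R\<close> times the area is \<open>p + 2\<close> times the
volume of the ball; the Gamma function then gives the constant \<open>sphere_area\<close>.\<close>

lemma S_one: "S (\<lambda>_. oct_e 0) = (sphere_area p * R ^ (p + 1)) *\<^sub>R oct_e 0"
proof -
  let ?v = "oct_e 0"
  have "(\<Sum>i\<le>Suc p. ball_integral (\<lambda>_. ?v)) = (\<Sum>i\<le>Suc p. S (\<lambda>y. (y \<bullet> bas i / R) *\<^sub>R ((y \<bullet> bas i) *\<^sub>R ?v)))"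
  proof (rule sum.cong[OF refl])
    fix i assume "i \<in> {..Suc p}"
    then have i: "i \<le> Suc p" by simp
    show "ball_integral (\<lambda>_. ?v) = S (\<lambda>y. (y \<bullet> bas i / R) *\<^sub>R ((y \<bullet> bas i) *\<^sub>R ?v))"
    proof (rule divergence_theorem[OF i, where F'="\<lambda>_. ?v"])
      show "((\<lambda>t. ((y + t *\<^sub>R bas i) \<bullet> bas i) *\<^sub>R ?v) has_vector_derivative ?v) (at 0)" for y
        using bas_inner[OF i i] by (auto intro!: derivative_eq_intros simp: inner_add_left)
    qed (intro continuous_intros)+
  qed
  also have "\<dots> = S (\<lambda>y. \<Sum>i\<le>Suc p. (y \<bullet> bas i / R) *\<^sub>R ((y \<bullet> bas i) *\<^sub>R ?v))"
    using R_pos by (intro S_sum[symmetric] continuous_intros) auto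
  also have "\<dots> = S (\<lambda>y. R *\<^sub>R ?v)"
  proof (rule S_cong)
    fix y assume y: "y \<in> K"
    then have "(\<Sum>i\<le>Suc p. (y \<bullet> bas i)\<^sup>2) = R\<^sup>2" using norm_V_sq[of y] by (simp add: K_def)
    then have "(\<Sum>i\<le>Suc p. (y \<bullet> bas i / R) * (y \<bullet> bas i)) = R"
      using R_pos by (simp add: sum_divide_distrib[symmetric] power2_eq_square)
    then show "(\<Sum>i\<le>Suc p. (y \<bullet> bas i / R) *\<^sub>R ((y \<bullet> bas i) *\<^sub>R ?v)) = R *\<^sub>R ?v"
      by (simp add: scaleR_sum_left[symmetric])
  qed
  also have "\<dots> = R *\<^sub>R S (\<lambda>_. ?v)" by (rule S_scaleR) simp
  finally have "R *\<^sub>R S (\<lambda>_. ?v) = (real (p + 2) * (unit_ball_vol (real (p + 2)) * R ^ (p + 2))) *\<^sub>R ?v"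
    by (simp add: ball_integral_const sum_constant_scaleR del: sum_constant)
  then have "S (\<lambda>_. ?v) = ((real (p + 2) * (unit_ball_vol (real (p + 2)) * R ^ (p + 2))) / R) *\<^sub>R ?v"
    using scaleR_scaleR[of "1 / R" R "S (\<lambda>_. ?v)"] R_pos by simp
  also have "(real (p + 2) * (unit_ball_vol (real (p + 2)) * R ^ (p + 2))) / R = sphere_area p * R ^ (p + 1)"
  proof -
    have G: "Gamma (real (p + 2) / 2 + 1) = (real (p + 2) / 2) * Gamma (real (p + 2) / 2)"
      by (rule Gamma_plus1) (auto simp: add_eq_0_iff2 elim!: nonpos_Ints_cases)
    have "pi powr (real (p + 2) / 2) = sqrt pi ^ (p + 2)"
    proof -
      have "pi powr (real (p + 2) / 2) = (pi powr (1/2)) powr real (p + 2)" by (simp add: powr_powr)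
      also have "\<dots> = sqrt pi ^ (p + 2)" by (subst powr_realpow) (auto simp: powr_half_sqrt)
      finally show ?thesis .
    qed
    moreover have "Gamma (real (p + 2) / 2) > 0" by (rule Gamma_real_pos) simp
    moreover have gen: "a * (P / ((a / 2) * g)) = 2 * P / g" if "a > 0" "g > 0" for a P g :: real
      using that by (simp add: field_simps)
    ultimately have "real (p + 2) * unit_ball_vol (real (p + 2)) = sphere_area p"
      unfolding unit_ball_vol_def sphere_area_def G Gamma_one_half_real
      using gen[of "real (p + 2)"] by simp
    moreover have "R ^ (p + 2) = R ^ (p + 1) * R" by simp
    ultimately show ?thesis using R_pos by (simp add: mult.assoc[symmetric])
  qed
  finally show ?thesis .
qed

text \<open>A null sequence of regularisation parameters; it avoids \<open>0\<close> and stays in the compact interval \<open>{0..1}\<close>.\<close>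

definition eps :: "nat \<Rightarrow> real" where "eps n = inverse (real (Suc n))"

lemma eps: "eps n \<noteq> 0" "eps n \<in> {0..1}" "eps \<longlonglongrightarrow> 0"
  using LIMSEQ_inverse_real_of_nat by (auto simp: eps_def[abs_def] field_simps)

text \<open>For \<open>|x| < R\<close> the regularised kernel is jointly continuous in \<open>y\<close> and \<open>e\<close> on the sphere, including \<open>e = 0\<close>.\<close>

lemma S_reg_tendsto:
  assumes f: "continuous_on K f" and x: "norm x < R"
  shows "(\<lambda>n. S (\<lambda>y. cauchy_reg p (eps n) (y - x) \<odot> ((y /\<^sub>R R) \<odot> f y))) \<longlonglongrightarrow>
     S (\<lambda>y. cauchy_kernel p (y - x) \<odot> ((y /\<^sub>R R) \<odot> f y))"
proof -
  let ?G = "\<lambda>y e. cauchy_reg p e (y - x) \<odot> ((y /\<^sub>R R) \<odot> f y)"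
  have "continuous_on {0..1} (\<lambda>e. S (\<lambda>y. ?G y e))"
  proof (rule S_continuous_param[OF _ compact_Icc])
    have "continuous_on (K \<times> {0..1}) (\<lambda>z. cauchy_reg p (snd z) (fst z - x))"
    proof -
      have "(fst z - x) \<bullet> (fst z - x) + (snd z)\<^sup>2 > 0" if "z \<in> K \<times> {0..1}" for z
        using that x by (intro radius_pos) (auto simp: K_def)
      then have "sphere_area p * sqrt ((fst z - x) \<bullet> (fst z - x) + (snd z)\<^sup>2) ^ (p + 2) \<noteq> 0" if "z \<in> K \<times> {0..1}" for z
        using that sphere_area_pos[of p] by (metis mult_eq_0_iff less_irrefl power_eq_0_iff real_sqrt_eq_0_iff)
      then show ?thesis
        unfolding cauchy_reg_def
        by (intro continuous_intros bounded_linear.continuous_on[OF bounded_linear_oct_cnj]) auto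
    qed
    moreover have "continuous_on (K \<times> {0..1}) (\<lambda>z. (fst z /\<^sub>R R) \<odot> f (fst z))"
      by (intro oct.continuous_on continuous_intros continuous_on_compose2[OF f]) auto
    ultimately show "continuous_on (K \<times> {0..1}) (\<lambda>z. ?G (fst z) (snd z))" by (rule oct.continuous_on)
  qed
  from continuous_on_tendsto_compose[OF this eps(3)] eps(2)
  show ?thesis unfolding cauchy_reg_zero by (simp add: eventually_sequentially)
qed

definition mass :: "real \<Rightarrow> oct \<Rightarrow> real" where
  "mass e x = ball_integral (\<lambda>y. cauchy_bump p e (y - x))"

lemma bump_shift_continuous: "e \<noteq> 0 \<Longrightarrow> continuous_on A (\<lambda>y. cauchy_bump p e (y - x))"
  by (rule continuous_on_compose2[OF cauchy_bump_continuous[of e UNIV]]) (auto intro: continuous_intros)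

text \<open>Cauchy's formula for the constant function at the centre, where \<open>E(y) n(y)\<close> is the constant inverse of the area.\<close>

lemma mass_zero_tendsto: "(\<lambda>n. mass (eps n) 0) \<longlonglongrightarrow> 1"
proof -
  have m: "monogenic (\<lambda>_. oct_e 0) (\<lambda>_ _. 0)" by (auto simp: monogenic_def oct.zero_right)
  have eq: "S (\<lambda>y. cauchy_reg p (eps n) (y - 0) \<odot> ((y /\<^sub>R R) \<odot> oct_e 0)) = mass (eps n) 0 *\<^sub>R oct_e 0" for n
    unfolding cauchy_regularised[OF m V_0 eps(1)] mass_def
    by (rule ball_integral_linear[OF bounded_linear_scaleR_left bump_shift_continuous[OF eps(1)]])
  have lim: "S (\<lambda>y. cauchy_kernel p (y - 0) \<odot> ((y /\<^sub>R R) \<odot> oct_e 0)) = oct_e 0"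
  proof -
    have "S (\<lambda>y. cauchy_kernel p (y - 0) \<odot> ((y /\<^sub>R R) \<odot> oct_e 0)) = S (\<lambda>y. (1 / (sphere_area p * R ^ (p + 1))) *\<^sub>R oct_e 0)"
    proof (rule S_cong)
      fix y assume "y \<in> K"
      then have ny: "norm y = R" by (simp add: K_def)
      have "oct_cnj y \<odot> y = (y \<bullet> y) *\<^sub>R oct_e 0" using oct_cnj_mult_mult[of y "oct_e 0"] by simp
      also have "y \<bullet> y = R\<^sup>2" using ny by (simp add: power2_norm_eq_inner[symmetric])
      finally show "cauchy_kernel p (y - 0) \<odot> ((y /\<^sub>R R) \<odot> oct_e 0) = (1 / (sphere_area p * R ^ (p + 1))) *\<^sub>R oct_e 0"
        using R_pos sphere_area_pos[of p]
        by (simp add: cauchy_kernel_def oct.scaleR_left oct.scaleR_right ny field_simps power2_eq_square)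
    qed
    also have "\<dots> = oct_e 0"
      using R_pos sphere_area_pos[of p] by (subst S_scaleR) (auto simp: S_one)
    finally show ?thesis .
  qed
  have "(\<lambda>n. mass (eps n) 0 *\<^sub>R oct_e 0) \<longlonglongrightarrow> oct_e 0"
    using S_reg_tendsto[of "\<lambda>_. oct_e 0" 0] R_pos unfolding eq lim by simp
  then have "(\<lambda>n. (mass (eps n) 0 *\<^sub>R oct_e 0) \<bullet> oct_e 0) \<longlonglongrightarrow> oct_e 0 \<bullet> oct_e 0"
    by (intro tendsto_intros)
  then show ?thesis by (simp add: oct_e_inner)
qed

lemma mass_translate:
  assumes x: "x \<in> V"
  shows "mass e x = (LINT w|N. indicator KB (Y w + x) *\<^sub>R cauchy_bump p e (Y w))"
proof -
  let ?T = "\<lambda>w. \<lambda>i\<in>{..Suc p}. (x \<bullet> bas i) + w i"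
  have YT: "Y (?T w) = Y w + x" for w
  proof -
    have "Y (?T w) = (\<Sum>i\<le>Suc p. (x \<bullet> bas i) *\<^sub>R bas i + w i *\<^sub>R bas i)"
      unfolding Y_def by (rule sum.cong) (auto simp: scaleR_add_left)
    then show ?thesis using V_expand[OF x] by (simp add: sum.distrib Y_def add.commute)
  qed
  have meas: "(\<lambda>y. indicator KB y *\<^sub>R cauchy_bump p e (y - x)) \<in> borel_measurable borel"
  proof -
    have [measurable]: "KB \<in> sets borel" using KB_closed by auto
    show ?thesis unfolding cauchy_bump_def by measurable
  qed
  have "mass e x = (LINT w|distr N N ?T. indicator KB (Y w) *\<^sub>R cauchy_bump p e (Y w - x))"
    unfolding mass_def ball_integral_def by (subst PiM_lborel_translate) auto
  also have "\<dots> = (LINT w|N. indicator KB (Y (?T w)) *\<^sub>R cauchy_bump p e (Y (?T w) - x))"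
    by (rule integral_distr) (use measurable_compose[OF Y_measurable meas] in measurable)
  finally show ?thesis unfolding YT by simp
qed

text \<open>After a translation both masses integrate the same bump, over the ball and over a shifted ball. The two balls differ only at a
distance of at least \<open>R - |x|\<close> from the origin, where the bump is of order \<open>e\<^sup>2\<close>.\<close>

lemma mass_difference:
  assumes x: "x \<in> V" "norm x < R"
  shows "\<exists>C. \<forall>e. e \<noteq> 0 \<longrightarrow> \<bar>mass e x - mass e 0\<bar> \<le> C * e\<^sup>2"
proof -
  define d where "d = R - norm x"
  have d: "d > 0" using x by (simp add: d_def)
  define B where "B = (real (p + 2) / sphere_area p) / d ^ (p + 4)"
  \<comment> \<open>Both balls are contained in the ball of radius \<open>2 R\<close>.\<close>
  let ?A = "{w \<in> space N. (\<Sum>i\<in>{..Suc p}. (w i)\<^sup>2) \<le> (2 * R)\<^sup>2}"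
  have A: "emeasure N ?A < \<infinity>" by (rule emeasure_coord_ball_finite) simp
  have As: "?A \<in> sets N" by measurable
  have B: "B \<ge> 0" using d sphere_area_pos[of p] by (auto simp: B_def)
  have "\<bar>mass e x - mass e 0\<bar> \<le> (B * measure N ?A) * e\<^sup>2" if e: "e \<noteq> 0" for e
  proof -
    have intA: "integrable N (\<lambda>w. (B * e\<^sup>2) * indicat_real ?A w)"
      by (intro integrable_mult_right integrable_real_indicator As A)
    define g where "g w = indicator KB (Y w + x) *\<^sub>R cauchy_bump p e (Y w) - indicator KB (Y w) *\<^sub>R cauchy_bump p e (Y w)" for w
    have KBm [measurable]: "KB \<in> sets borel" using KB_closed by auto
    have m1: "(\<lambda>y. indicator KB (y + x) *\<^sub>R cauchy_bump p e y) \<in> borel_measurable borel"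
      unfolding cauchy_bump_def by measurable
    have g1: "integrable N (\<lambda>w. indicator KB (Y w) *\<^sub>R cauchy_bump p e (Y w))"
      by (intro KB_integrable cauchy_bump_continuous e)
    have gbound: "\<bar>g w\<bar> \<le> (B * e\<^sup>2) * indicat_real ?A w" if w: "w \<in> space N" for w
    proof (cases "norm (Y w) \<le> d")
      case True
      then have "norm (Y w + x) \<le> R" "norm (Y w) \<le> R"
        using norm_triangle_ineq[of "Y w" x] x norm_ge_zero[of x] by (auto simp: d_def simp del: norm_ge_zero)
      then have "Y w + x \<in> KB" "Y w \<in> KB" using x by (auto simp: KB_def Y_in_V V_add)
      then have "g w = 0" by (simp add: g_def)
      then show ?thesis using B by (auto intro!: mult_nonneg_nonneg)
    next
      case False
      show ?thesis
      proof (cases "w \<in> ?A")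
        case True
        have "\<bar>g w\<bar> \<le> cauchy_bump p e (Y w)"
          using cauchy_bump_nonneg[of p e "Y w"] by (auto simp: g_def indicator_def)
        also have "\<dots> \<le> B * e\<^sup>2"
          using cauchy_bump_away_from_zero[of d "Y w" p e] False d by (simp add: B_def)
        finally show ?thesis using True by simp
      next
        case nA: False
        then have "\<not> (norm (Y w))\<^sup>2 \<le> (2 * R)\<^sup>2" using w unfolding norm_Y_sq by simp
        then have n: "norm (Y w) > 2 * R" using R_pos abs_le_square_iff[of "norm (Y w)" "2 * R"] by simp
        have "norm (Y w + x) > R" "norm (Y w) > R"
          using n norm_triangle_ineq4[of "Y w + x" x] x R_pos by auto
        then show ?thesis using B by (simp add: g_def KB_def)
      qed
    qed
    have g2: "integrable N g"
    proof (rule Bochner_Integration.integrable_bound[OF intA])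
      show "g \<in> borel_measurable N"
        unfolding g_def using measurable_compose[OF Y_measurable m1] borel_measurable_integrable[OF g1]
        by measurable
      show "AE w in N. norm (g w) \<le> norm ((B * e\<^sup>2) * indicat_real ?A w)"
        using gbound B by (intro AE_I2) (fastforce simp: abs_mult)
    qed
    have "(LINT w|N. g w + indicator KB (Y w) *\<^sub>R cauchy_bump p e (Y w)) = (LINT w|N. g w) + (LINT w|N. indicator KB (Y w) *\<^sub>R cauchy_bump p e (Y w))"
      by (rule Bochner_Integration.integral_add[OF g2 g1])
    then have "mass e x - mass e 0 = (LINT w|N. g w)"
      unfolding mass_translate[OF x(1)] mass_def[of e 0] ball_integral_def by (simp add: g_def)
    also have "\<bar>\<dots>\<bar> \<le> (LINT w|N. \<bar>g w\<bar>)" by (rule integral_abs_bound)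
    also have "\<dots> \<le> (LINT w|N. (B * e\<^sup>2) * indicat_real ?A w)"
      by (rule integral_mono[OF _ intA]) (use g2 gbound in auto)
    also have "\<dots> = (B * e\<^sup>2) * measure N ?A"
      using As A by simp
    finally show ?thesis by (simp add: ac_simps)
  qed
  then show ?thesis by blast
qed

lemma mass_tendsto:
  assumes x: "x \<in> V" "norm x < R"
  shows "(\<lambda>n. mass (eps n) x) \<longlonglongrightarrow> 1"
proof -
  obtain C where C: "\<And>e. e \<noteq> 0 \<Longrightarrow> \<bar>mass e x - mass e 0\<bar> \<le> C * e\<^sup>2"
    using mass_difference[OF x] by blast
  have "(\<lambda>n. mass (eps n) x - mass (eps n) 0) \<longlonglongrightarrow> 0"
  proof (rule Lim_null_comparison)
    show "\<forall>\<^sub>F n in sequentially. norm (mass (eps n) x - mass (eps n) 0) \<le> C * (eps n)\<^sup>2"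
      using C eps(1) by simp
    have "(\<lambda>n. C * (eps n)\<^sup>2) \<longlonglongrightarrow> C * 0\<^sup>2" by (intro tendsto_intros eps)
    then show "(\<lambda>n. C * (eps n)\<^sup>2) \<longlonglongrightarrow> 0" by simp
  qed
  from tendsto_add[OF this mass_zero_tendsto] show ?thesis by simp
qed

text \<open>The regularised formula expresses its surface integral as a mean of \<open>f\<close> against the bump centred at \<open>x\<close>. Near \<open>x\<close> the values of
\<open>f\<close> are close to \<open>f x\<close>, elsewhere the bump is small, and its total mass tends to \<open>1\<close>.\<close>

theorem cauchy_formula:
  assumes f: "monogenic f df" and x: "x \<in> V" "norm x < R"
  shows "f x = S (\<lambda>y. cauchy_kernel p (y - x) \<odot> ((y /\<^sub>R R) \<odot> f y))"
proof -
  have fc: "continuous_on KB f" using f by (simp add: monogenic_def)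
  have xKB: "x \<in> KB" using x by (simp add: KB_def)
  let ?b = "\<lambda>n y. cauchy_bump p (eps n) (y - x)"
  let ?I = "\<lambda>n. ball_integral (\<lambda>y. ?b n y *\<^sub>R f y)"
  have "(\<lambda>n. ?I n - mass (eps n) x *\<^sub>R f x) \<longlonglongrightarrow> 0"
  proof (rule LIMSEQ_I)
    fix r :: real assume r: "r > 0"
    obtain d where d: "d > 0" "\<And>y. y \<in> KB \<Longrightarrow> dist y x < d \<Longrightarrow> dist (f y) (f x) < r / 4"
      using fc[unfolded continuous_on_iff, rule_format, OF xKB, of "r / 4"] r by auto
    obtain C where C: "\<And>y. y \<in> KB \<Longrightarrow> norm (f y - f x) \<le> C"
      using continuous_compact_bound[OF KB_compact continuous_on_diff[OF fc continuous_on_const[of _ "f x"]]] by blast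
    \<comment> \<open>At distance at least \<open>d\<close> from \<open>x\<close> the integrand is bounded by \<open>B e\<^sup>2\<close>; \<open>W\<close> is the volume of the ball.\<close>
    define B where "B = C * ((real (p + 2) / sphere_area p) / d ^ (p + 4))"
    have C0: "C \<ge> 0" using C[OF xKB] by simp
    define W where "W = unit_ball_vol (real (p + 2)) * R ^ (p + 2)"
    have "(\<lambda>n. (r / 4) * mass (eps n) x + W * (B * (eps n)\<^sup>2)) \<longlonglongrightarrow> (r / 4) * 1 + W * (B * 0\<^sup>2)"
      by (intro tendsto_intros eps mass_tendsto x)
    from order_tendstoD(2)[OF this, of "r / 2"] r
    have "eventually (\<lambda>n. (r / 4) * mass (eps n) x + W * (B * (eps n)\<^sup>2) < r / 2) sequentially"
      by (simp only: power_zero_numeral mult_zero_right mult_zero_left)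
    moreover have bound: "norm (?I n - mass (eps n) x *\<^sub>R f x) \<le> (r / 4) * mass (eps n) x + W * (B * (eps n)\<^sup>2)" for n
    proof -
      have bc: "continuous_on KB (?b n)" by (rule bump_shift_continuous[OF eps(1)])
      have "mass (eps n) x *\<^sub>R f x = ball_integral (\<lambda>y. ?b n y *\<^sub>R f x)"
        unfolding mass_def by (rule ball_integral_linear[OF bounded_linear_scaleR_left bc, symmetric])
      then have "?I n - mass (eps n) x *\<^sub>R f x = ball_integral (\<lambda>y. ?b n y *\<^sub>R (f y - f x))"
        by (simp add: scaleR_diff_right ball_integral_diff continuous_on_scaleR bc fc)
      moreover have "norm (ball_integral (\<lambda>y. ?b n y *\<^sub>R (f y - f x))) \<le> ball_integral (\<lambda>y. (r / 4) * ?b n y + B * (eps n)\<^sup>2)"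
      proof (rule ball_integral_norm_le)
        show "continuous_on KB (\<lambda>y. ?b n y *\<^sub>R (f y - f x))" "continuous_on KB (\<lambda>y. (r / 4) * ?b n y + B * (eps n)\<^sup>2)"
          by (intro continuous_intros bc fc)+
        fix y assume y: "y \<in> KB"
        have b0: "?b n y \<ge> 0" by (rule cauchy_bump_nonneg)
        show "norm (?b n y *\<^sub>R (f y - f x)) \<le> (r / 4) * ?b n y + B * (eps n)\<^sup>2"
        proof (cases "dist y x < d")
          case True
          have "?b n y * norm (f y - f x) \<le> ?b n y * (r / 4)"
            using d(2)[OF y True] b0 by (intro mult_left_mono) (auto simp: dist_norm)
          moreover have "B * (eps n)\<^sup>2 \<ge> 0" using C0 sphere_area_pos[of p] d by (auto simp: B_def)
          ultimately show ?thesis using b0 by (simp add: mult.commute)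
        next
          case False
          have "?b n y * norm (f y - f x) \<le> ((real (p + 2) / sphere_area p) * ((eps n)\<^sup>2 / d ^ (p + 4))) * C"
            using cauchy_bump_away_from_zero[of d "y - x" p "eps n"] False d(1) C[OF y] b0
            by (intro mult_mono) (auto simp: dist_norm)
          also have "\<dots> = B * (eps n)\<^sup>2" by (simp add: B_def)
          finally have "?b n y * norm (f y - f x) \<le> B * (eps n)\<^sup>2" .
          moreover have "(r / 4) * ?b n y \<ge> 0" using b0 r by simp
          ultimately show ?thesis using b0 by simp
        qed
      qed
      moreover have "ball_integral (\<lambda>y. (r / 4) * ?b n y + B * (eps n)\<^sup>2) = (r / 4) * mass (eps n) x + W * (B * (eps n)\<^sup>2)"
      proof -
        have "ball_integral (\<lambda>y. (r / 4) * ?b n y + B * (eps n)\<^sup>2) = ball_integral (\<lambda>y. (r / 4) * ?b n y) + ball_integral (\<lambda>_. B * (eps n)\<^sup>2)"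
          by (rule ball_integral_add) (intro continuous_intros bc)+
        also have "ball_integral (\<lambda>y. (r / 4) * ?b n y) = (r / 4) * mass (eps n) x"
          unfolding mass_def by (rule ball_integral_linear[OF bounded_linear_mult_right bc])
        finally show ?thesis by (simp only: ball_integral_const W_def real_scaleR_def)
      qed
      ultimately show ?thesis by simp
    qed
    ultimately have "eventually (\<lambda>n. norm (?I n - mass (eps n) x *\<^sub>R f x) < r / 2) sequentially"
      by (elim eventually_mono) (rule le_less_trans[OF bound])
    then show "\<exists>no. \<forall>n\<ge>no. norm (?I n - mass (eps n) x *\<^sub>R f x - 0) < r"
      unfolding eventually_sequentially diff_0_right by (elim exE) (use r in fastforce)
  qed
  then have "(\<lambda>n. (?I n - mass (eps n) x *\<^sub>R f x) + mass (eps n) x *\<^sub>R f x) \<longlonglongrightarrow> 0 + 1 *\<^sub>R f x"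
    by (intro tendsto_add tendsto_scaleR tendsto_const mass_tendsto x)
  then have "?I \<longlonglongrightarrow> f x" by simp
  moreover have "?I \<longlonglongrightarrow> S (\<lambda>y. cauchy_kernel p (y - x) \<odot> ((y /\<^sub>R R) \<odot> f y))"
    using S_reg_tendsto[OF continuous_on_subset[OF fc K_subset_KB] x(2)]
    unfolding cauchy_regularised[OF f x(1) eps(1)] .
  ultimately show ?thesis by (rule LIMSEQ_unique)
qed

end

section \<open>Kernels that are smooth away from the origin\<close>

text \<open>A class of scalar functions that contains the coordinates of the Cauchy kernel and is closed under directional derivatives
outside the origin. It replaces a general notion of smooth function: derivatives of all orders and the symmetry of second
derivatives are obtained by structural induction.\<close>

inductive rational_kernel :: "(oct \<Rightarrow> real) \<Rightarrow> bool" where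
  const: "rational_kernel (\<lambda>_. c)"
| inner: "rational_kernel (\<lambda>x. x \<bullet> a)"
| inv: "rational_kernel (\<lambda>x. 1 / norm x ^ n)"
| add: "rational_kernel g \<Longrightarrow> rational_kernel h \<Longrightarrow> rational_kernel (\<lambda>x. g x + h x)"
| mult: "rational_kernel g \<Longrightarrow> rational_kernel h \<Longrightarrow> rational_kernel (\<lambda>x. g x * h x)"

lemma inverse_norm_power_has_derivative:
  fixes x :: oct
  assumes "x \<noteq> 0"
  shows "((\<lambda>x. 1 / norm x ^ n) has_derivative (\<lambda>v. - real n * ((x \<bullet> v) * (1 / norm x ^ (n + 2))))) (at x)"
proof -
  have n: "(norm has_derivative (\<lambda>v. x \<bullet> v / norm x)) (at x)"
  proof -
    have "(norm has_derivative (\<lambda>v. v \<bullet> sgn x)) (at x)" by (rule has_derivative_norm[OF assms])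
    moreover have "(\<lambda>v. v \<bullet> sgn x) = (\<lambda>v. x \<bullet> v / norm x)"
      by (rule ext) (simp add: sgn_div_norm inner_commute[of _ x] divide_inverse)
    ultimately show ?thesis by simp
  qed
  have "((\<lambda>s. 1 / s ^ n) has_real_derivative - (real n * 1 / norm x ^ (n + 1))) (at (norm x))"
    by (rule inverse_power_has_derivative[where g="\<lambda>s. s"]) (use assms in auto)
  then have s: "((\<lambda>s. 1 / s ^ n) has_derivative (\<lambda>h. - (real n * 1 / norm x ^ (n + 1)) * h)) (at (norm x))"
    by (simp only: has_field_derivative_def)
  have eq: "- (real n * 1 / norm x ^ (n + 1)) * (x \<bullet> v / norm x) = - real n * ((x \<bullet> v) * (1 / norm x ^ (n + 2)))" for v
    by simp
  from has_derivative_compose[OF n s] show ?thesis by (simp only: eq)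
qed

text \<open>\<open>D v\<close> is the derivative in direction \<open>v\<close> and \<open>D2 v w\<close> its derivative in direction \<open>w\<close>.\<close>

definition derivative_pair :: "(oct \<Rightarrow> real) \<Rightarrow> (oct \<Rightarrow> oct \<Rightarrow> real) \<Rightarrow> (oct \<Rightarrow> oct \<Rightarrow> oct \<Rightarrow> real) \<Rightarrow> bool" where
  "derivative_pair g D D2 \<longleftrightarrow> (\<forall>v. rational_kernel (D v)) \<and>
     (\<forall>x. x \<noteq> 0 \<longrightarrow> (g has_derivative (\<lambda>v. D v x)) (at x)) \<and>
     (\<forall>x v. x \<noteq> 0 \<longrightarrow> (D v has_derivative (\<lambda>w. D2 v w x)) (at x)) \<and>
     (\<forall>x v w. x \<noteq> 0 \<longrightarrow> D2 v w x = D2 w v x)"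

lemma derivative_pairD:
  assumes "derivative_pair g D D2"
  shows "rational_kernel (D v)" "x \<noteq> 0 \<Longrightarrow> (g has_derivative (\<lambda>v. D v x)) (at x)"
    "x \<noteq> 0 \<Longrightarrow> (D v has_derivative (\<lambda>w. D2 v w x)) (at x)" "x \<noteq> 0 \<Longrightarrow> D2 v w x = D2 w v x"
  using assms unfolding derivative_pair_def by blast+

lemma rational_kernel_derivatives:
  assumes "rational_kernel g"
  shows "\<exists>D D2. derivative_pair g D D2"
  using assms
proof induction
  case (const c)
  show ?case
    by (rule exI[of _ "\<lambda>v x. 0"], rule exI[of _ "\<lambda>v w x. 0"]) (auto simp: derivative_pair_def intro: rational_kernel.const)
next
  case (inner a)
  show ?case
    by (rule exI[of _ "\<lambda>v x. v \<bullet> a"], rule exI[of _ "\<lambda>v w x. 0"])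
       (auto simp: derivative_pair_def intro: rational_kernel.const bounded_linear_imp_has_derivative bounded_linear_inner_left)
next
  case (inv n)
  let ?D = "\<lambda>v x. - real n * ((x \<bullet> v) * (1 / norm x ^ (n + 2)))"
  let ?D2 = "\<lambda>v w x. - real n * ((x \<bullet> v) * (- real (n + 2) * ((x \<bullet> w) * (1 / norm x ^ (n + 2 + 2)))) + (w \<bullet> v) * (1 / norm x ^ (n + 2)))"
  show ?case
  proof (rule exI[of _ ?D], rule exI[of _ ?D2], unfold derivative_pair_def, intro conjI allI impI)
    show "rational_kernel (?D v)" for v by (intro rational_kernel.intros)
    fix x v w :: oct assume x: "x \<noteq> 0"
    show "((\<lambda>x. 1 / norm x ^ n) has_derivative (\<lambda>v. ?D v x)) (at x)"
      by (rule inverse_norm_power_has_derivative[OF x])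
    have i: "((\<lambda>x. x \<bullet> v) has_derivative (\<lambda>w. w \<bullet> v)) (at x)" by (auto intro!: derivative_eq_intros)
    from has_derivative_mult_right[OF has_derivative_mult[OF i inverse_norm_power_has_derivative[OF x, of "n+2"]], of "- real n"]
    show "(?D v has_derivative (\<lambda>w. ?D2 v w x)) (at x)" .
    show "?D2 v w x = ?D2 w v x" by (simp add: inner_commute mult_ac)
  qed
next
  case (add g h)
  then obtain Dg D2g Dh D2h where "derivative_pair g Dg D2g" "derivative_pair h Dh D2h" by blast
  note g = derivative_pairD[OF this(1)] and h = derivative_pairD[OF this(2)]
  let ?D = "\<lambda>v x. Dg v x + Dh v x"
  let ?D2 = "\<lambda>v w x. D2g v w x + D2h v w x"
  show ?case
  proof (rule exI[of _ ?D], rule exI[of _ ?D2], unfold derivative_pair_def, intro conjI allI impI)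
    show "rational_kernel (?D v)" for v by (rule rational_kernel.add[OF g(1) h(1)])
    fix x v w :: oct assume x: "x \<noteq> 0"
    show "((\<lambda>x. g x + h x) has_derivative (\<lambda>v. ?D v x)) (at x)"
      by (rule has_derivative_add[OF g(2)[OF x] h(2)[OF x]])
    show "(?D v has_derivative (\<lambda>w. ?D2 v w x)) (at x)"
      by (rule has_derivative_add[OF g(3)[OF x] h(3)[OF x]])
    show "?D2 v w x = ?D2 w v x" using g(4)[OF x, of v w] h(4)[OF x, of v w] by simp
  qed
next
  case (mult g h)
  then obtain Dg D2g Dh D2h where "derivative_pair g Dg D2g" "derivative_pair h Dh D2h" by blast
  note g = derivative_pairD[OF this(1)] and h = derivative_pairD[OF this(2)]
  let ?D = "\<lambda>v x. g x * Dh v x + Dg v x * h x"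
  let ?D2 = "\<lambda>v w x. (g x * D2h v w x + Dg w x * Dh v x) + (Dg v x * Dh w x + D2g v w x * h x)"
  show ?case
  proof (rule exI[of _ ?D], rule exI[of _ ?D2], unfold derivative_pair_def, intro conjI allI impI)
    show "rational_kernel (?D v)" for v using mult.hyps by (intro rational_kernel.intros g h)
    fix x v w :: oct assume x: "x \<noteq> 0"
    show "((\<lambda>x. g x * h x) has_derivative (\<lambda>v. ?D v x)) (at x)"
      by (rule has_derivative_mult[OF g(2)[OF x] h(2)[OF x]])
    show "(?D v has_derivative (\<lambda>w. ?D2 v w x)) (at x)"
      by (rule has_derivative_add[OF has_derivative_mult[OF g(2)[OF x] h(3)[OF x]] has_derivative_mult[OF g(3)[OF x] h(2)[OF x]]])
    show "?D2 v w x = ?D2 w v x" using g(4)[OF x, of v w] h(4)[OF x, of v w] by simp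
  qed
qed

text \<open>The values at the origin are left open, because \<open>dir_deriv\<close> is unspecified there; so the class is closed under \<open>dir_deriv\<close>.\<close>

definition kernel :: "(oct \<Rightarrow> oct) \<Rightarrow> bool" where
  "kernel G \<longleftrightarrow> (\<exists>H. (\<forall>b\<in>Basis. rational_kernel (\<lambda>x. H x \<bullet> b)) \<and> (\<forall>x. x \<noteq> 0 \<longrightarrow> G x = H x))"

lemma has_derivative_dir_deriv:
  assumes "(G has_derivative D) (at x)"
  shows "((\<lambda>t. G (x + t *\<^sub>R v)) has_vector_derivative D v) (at 0)" "dir_deriv v G x = D v"
proof -
  have "((\<lambda>t. x + t *\<^sub>R v) has_vector_derivative v) (at 0)" by (auto intro!: derivative_eq_intros)
  then have "((\<lambda>t. x + t *\<^sub>R v) has_derivative (\<lambda>t. t *\<^sub>R v)) (at 0)" by (simp add: has_vector_derivative_def)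
  moreover have "(G has_derivative D) (at (x + 0 *\<^sub>R v))" using assms by simp
  ultimately have "((\<lambda>t. G (x + t *\<^sub>R v)) has_derivative (\<lambda>t. D (t *\<^sub>R v))) (at 0)"
    by (rule has_derivative_compose)
  moreover have "D (t *\<^sub>R v) = t *\<^sub>R D v" for t
    by (rule linear_cmul[OF bounded_linear.linear[OF has_derivative_bounded_linear[OF assms]]])
  ultimately show 1: "((\<lambda>t. G (x + t *\<^sub>R v)) has_vector_derivative D v) (at 0)"
    by (simp add: has_vector_derivative_def)
  show "dir_deriv v G x = D v" unfolding dir_deriv_def by (rule vector_derivative_at[OF 1])
qed

lemma kernel_derivatives:
  assumes "kernel G"
  obtains D D2 where "\<And>v. kernel (D v)" "\<And>x. x \<noteq> 0 \<Longrightarrow> (G has_derivative (\<lambda>v. D v x)) (at x)"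
    "\<And>x v. x \<noteq> 0 \<Longrightarrow> (D v has_derivative (\<lambda>w. D2 v w x)) (at x)" "\<And>x v w. x \<noteq> 0 \<Longrightarrow> D2 v w x = D2 w v x"
proof -
  obtain H where H: "\<And>b. b \<in> Basis \<Longrightarrow> rational_kernel (\<lambda>x. H x \<bullet> b)" "\<And>x. x \<noteq> 0 \<Longrightarrow> G x = H x"
    using assms by (auto simp: kernel_def)
  have "\<forall>b\<in>Basis. \<exists>D D2. derivative_pair (\<lambda>x. H x \<bullet> b) D D2"
    using rational_kernel_derivatives[OF H(1)] by blast
  then obtain d d2 where "\<And>b. b \<in> Basis \<Longrightarrow> derivative_pair (\<lambda>x. H x \<bullet> b) (d b) (d2 b)" by metis
  note d = derivative_pairD[OF this]
  define D where "D v x = (\<Sum>b\<in>Basis. d b v x *\<^sub>R b)" for v x :: oct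
  define D2 where "D2 v w x = (\<Sum>b\<in>Basis. d2 b v w x *\<^sub>R b)" for v w x :: oct
  have Db: "D v x \<bullet> b = d b v x" "D2 v w x \<bullet> b = d2 b v w x" if "b \<in> Basis" for v w x b
    using that by (simp_all add: D_def D2_def inner_sum_left inner_Basis if_distrib sum.delta cong: if_cong)
  show thesis
  proof (rule that[of D D2])
    show "kernel (D v)" for v unfolding kernel_def
      by (rule exI[of _ "D v"]) (auto simp: Db d)
    fix x v w :: oct assume x: "x \<noteq> 0"
    have "(H has_derivative (\<lambda>v. D v x)) (at x)"
      by (subst has_derivative_componentwise_within) (use d(2) x in \<open>auto simp: Db\<close>)
    then show "(G has_derivative (\<lambda>v. D v x)) (at x)"
      by (rule has_derivative_transform_within_open[of _ _ _ _ "- {0}"]) (use x H in auto)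
    show "(D v has_derivative (\<lambda>w. D2 v w x)) (at x)"
      by (subst has_derivative_componentwise_within) (use d(3) x in \<open>auto simp: Db\<close>)
    show "D2 v w x = D2 w v x" unfolding D2_def using d(4)[OF _ x] by simp
  qed
qed

lemma kernel_cong: "kernel G \<Longrightarrow> (\<And>x. x \<noteq> 0 \<Longrightarrow> H x = G x) \<Longrightarrow> kernel H"
  unfolding kernel_def by auto

lemma kernel_dir_deriv: "kernel G \<Longrightarrow> kernel (dir_deriv v G)"
  by (erule kernel_derivatives) (rule kernel_cong, assumption, auto dest: has_derivative_dir_deriv(2))

lemma kernel_has_derivative: "kernel G \<Longrightarrow> x \<noteq> 0 \<Longrightarrow> (G has_derivative (\<lambda>v. dir_deriv v G x)) (at x)"
proof (erule kernel_derivatives)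
  fix D :: "oct \<Rightarrow> oct \<Rightarrow> oct"
  assume D: "\<And>x. x \<noteq> 0 \<Longrightarrow> (G has_derivative (\<lambda>v. D v x)) (at x)" and x: "x \<noteq> 0"
  have "dir_deriv v G x = D v x" for v using has_derivative_dir_deriv(2)[OF D[OF x]] .
  then show "(G has_derivative (\<lambda>v. dir_deriv v G x)) (at x)" using D[OF x] by simp
qed

lemma kernel_continuous: "kernel G \<Longrightarrow> continuous_on (- {0}) G"
  by (rule continuous_at_imp_continuous_on) (auto intro: has_derivative_continuous kernel_has_derivative)

lemma kernel_dir_deriv_linear: "kernel G \<Longrightarrow> x \<noteq> 0 \<Longrightarrow> bounded_linear (\<lambda>v. dir_deriv v G x)"
  using kernel_has_derivative has_derivative_bounded_linear by blast

lemma kernel_line_derivative: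
  assumes G: "kernel G" and ne: "z - t *\<^sub>R v \<noteq> 0"
  shows "((\<lambda>t. G (z - t *\<^sub>R v)) has_vector_derivative - dir_deriv v G (z - t *\<^sub>R v)) (at t)"
proof -
  have "((\<lambda>t. z - t *\<^sub>R v) has_vector_derivative (- v)) (at t)" by (auto intro!: derivative_eq_intros)
  from has_derivative_compose[OF this[unfolded has_vector_derivative_def] kernel_has_derivative[OF G ne]]
  have "((\<lambda>t. G (z - t *\<^sub>R v)) has_derivative (\<lambda>h. dir_deriv (h *\<^sub>R (- v)) G (z - t *\<^sub>R v))) (at t)" .
  moreover have "dir_deriv (h *\<^sub>R (- v)) G (z - t *\<^sub>R v) = h *\<^sub>R (- dir_deriv v G (z - t *\<^sub>R v))" for h
    using linear_cmul[OF bounded_linear.linear[OF kernel_dir_deriv_linear[OF G ne]], of h "- v"]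
      linear_neg[OF bounded_linear.linear[OF kernel_dir_deriv_linear[OF G ne]], of v] by simp
  ultimately show ?thesis by (simp add: has_vector_derivative_def)
qed

lemma dir_deriv_cong_off_zero:
  assumes "\<And>x. x \<noteq> 0 \<Longrightarrow> G x = H x" "x \<noteq> 0"
  shows "dir_deriv v G x = dir_deriv v H x"
proof -
  have "((\<lambda>t. x + t *\<^sub>R v) \<longlongrightarrow> x + 0 *\<^sub>R v) (nhds 0)" by (intro tendsto_intros filterlim_ident)
  then have "eventually (\<lambda>t. x + t *\<^sub>R v \<noteq> 0) (nhds (0::real))"
    using assms(2) by (auto intro: tendsto_imp_eventually_ne)
  then have ev: "eventually (\<lambda>t. t \<in> UNIV \<longrightarrow> G (x + t *\<^sub>R v) = H (x + t *\<^sub>R v)) (nhds (0::real))"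
    by eventually_elim (use assms in auto)
  show ?thesis unfolding dir_deriv_def
    by (rule vector_derivative_cong_eq[OF ev]) auto
qed

lemma kernel_dir_deriv_commute:
  assumes "kernel G" "x \<noteq> 0"
  shows "dir_deriv v (dir_deriv w G) x = dir_deriv w (dir_deriv v G) x"
proof -
  obtain D D2 where D: "\<And>x. x \<noteq> 0 \<Longrightarrow> (G has_derivative (\<lambda>v. D v x)) (at x)"
    "\<And>x v. x \<noteq> 0 \<Longrightarrow> (D v has_derivative (\<lambda>w. D2 v w x)) (at x)" "\<And>x v w. x \<noteq> 0 \<Longrightarrow> D2 v w x = D2 w v x"
    using kernel_derivatives[OF assms(1)] by metis
  have "dir_deriv v (dir_deriv w G) x = D2 w v x" for v w
  proof -
    have "dir_deriv v (dir_deriv w G) x = dir_deriv v (D w) x"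
      by (rule dir_deriv_cong_off_zero[OF _ assms(2)]) (rule has_derivative_dir_deriv(2)[OF D(1)])
    also have "\<dots> = D2 w v x" by (rule has_derivative_dir_deriv(2)[OF D(2)[OF assms(2)]])
    finally show ?thesis .
  qed
  then show ?thesis using D(3)[OF assms(2)] by simp
qed

lemma cauchy_kernel_kernel: "kernel (cauchy_kernel p)"
  unfolding kernel_def
proof (intro exI[of _ "cauchy_kernel p"] conjI ballI)
  fix b :: oct assume "b \<in> Basis"
  have "(\<lambda>x. cauchy_kernel p x \<bullet> b) = (\<lambda>x. (1 / sphere_area p) * (1 / norm x ^ (p + 2)) * ((x \<bullet> oct_e 0) * (2 * (oct_e 0 \<bullet> b)) + (-1) * (x \<bullet> b)))"
    by (rule ext) (simp add: cauchy_kernel_def oct_cnj_eq inner_diff_left)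
  then show "rational_kernel (\<lambda>x. cauchy_kernel p x \<bullet> b)"
    by (simp only:) (intro rational_kernel.intros)
qed simp

abbreviation word_deriv :: "oct list \<Rightarrow> (oct \<Rightarrow> oct) \<Rightarrow> oct \<Rightarrow> oct" where
  "word_deriv \<equiv> foldr dir_deriv"

lemma kernel_word_deriv: "kernel G \<Longrightarrow> kernel (word_deriv vs G)"
  by (induction vs) (auto intro: kernel_dir_deriv)

lemma word_deriv_move:
  assumes "kernel G" "v \<in> set vs" "x \<noteq> 0"
  shows "word_deriv vs G x = dir_deriv v (word_deriv (remove1 v vs) G) x"
  using assms(2,3)
proof (induction vs arbitrary: x)
  case (Cons u vs)
  show ?case
  proof (cases "u = v")
    case False
    have "word_deriv (u # vs) G x = dir_deriv u (dir_deriv v (word_deriv (remove1 v vs) G)) x"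
      using Cons False by (auto intro!: dir_deriv_cong_off_zero)
    also have "\<dots> = dir_deriv v (dir_deriv u (word_deriv (remove1 v vs) G)) x"
      by (rule kernel_dir_deriv_commute) (use Cons.prems assms kernel_word_deriv in auto)
    finally show ?thesis using False by simp
  qed simp
qed simp

text \<open>Mixed partial derivatives of a kernel depend only on the multiset of directions.\<close>

lemma word_deriv_mset:
  assumes "kernel G" "mset vs = mset us" "x \<noteq> 0"
  shows "word_deriv vs G x = word_deriv us G x"
  using assms(2,3)
proof (induction vs arbitrary: us x)
  case (Cons v vs)
  then have "v \<in> set us" by (metis list.set_intros(1) set_mset_mset)
  moreover have "mset vs = mset (remove1 v us)" using Cons.prems(1) by (metis mset_remove1 remove1.simps(2))
  ultimately show ?case
    using Cons word_deriv_move[OF assms(1), of v us x] by (auto intro!: dir_deriv_cong_off_zero)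
qed simp

lemma multi_deriv_word: "multi_deriv p k G = word_deriv (map oct_e (index_list p k)) G"
proof -
  have "foldr (\<lambda>i. dir_deriv (oct_e i) ^^ k i) ls G = word_deriv (map oct_e (concat (map (\<lambda>l. replicate (k l) l) ls))) G" for ls
  proof (induction ls)
    case (Cons l ls)
    have "word_deriv (map oct_e (replicate n l @ is)) G = (dir_deriv (oct_e l) ^^ n) (word_deriv (map oct_e is) G)" for n "is"
      by (induction n) auto
    then show ?case using Cons by simp
  qed simp
  then show ?thesis by (simp add: multi_deriv_def index_list_def)
qed

context oct_slice
begin

text \<open>On the slice, the Fueter variable number \<open>l\<close> is \<open>x\<^sub>l + r J l\<close>.\<close>

definition J :: "nat \<Rightarrow> oct" where "J l = \<eta> \<odot> oct_e l"

text \<open>The Cauchy-Riemann equation solved for the derivative along \<open>\<eta>\<close>, with the bracketing \<open>(\<eta> e\<^sub>l) \<partial>\<^sub>l G\<close> in place of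
\<open>\<eta> (e\<^sub>l \<partial>\<^sub>l G)\<close>. For a general monogenic function these differ by associators; for the Cauchy kernel they agree, because it
is a conjugate gradient of a real function.\<close>

definition slice_CR :: "(oct \<Rightarrow> oct) \<Rightarrow> bool" where
  "slice_CR G \<longleftrightarrow> (\<forall>x\<in>V - {0}. (\<Sum>l\<le>p. J l \<odot> dir_deriv (oct_e l) G x) = dir_deriv \<eta> G x)"

text \<open>The equation has constant coefficients and derivatives commute, so it may be differentiated along the slice.\<close>

lemma slice_CR_dir_deriv:
  assumes G: "kernel G" "slice_CR G" and v: "v \<in> V"
  shows "slice_CR (dir_deriv v G)"
  unfolding slice_CR_def
proof
  fix x assume x: "x \<in> V - {0}"
  then have x0: "x \<noteq> 0" by simp
  have "((\<lambda>t. dir_deriv (oct_e l) G (x + t *\<^sub>R v)) has_vector_derivative dir_deriv v (dir_deriv (oct_e l) G) x) (at 0)" for l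
    by (rule has_derivative_dir_deriv(1)[OF kernel_has_derivative[OF kernel_dir_deriv[OF G(1)] x0]])
  then have lhs: "((\<lambda>t. \<Sum>l\<le>p. J l \<odot> dir_deriv (oct_e l) G (x + t *\<^sub>R v)) has_vector_derivative (\<Sum>l\<le>p. J l \<odot> dir_deriv v (dir_deriv (oct_e l) G) x)) (at 0)"
    by (intro has_vector_derivative_sum bounded_linear.has_vector_derivative[OF oct.bounded_linear_right])
  have rhs: "((\<lambda>t. dir_deriv \<eta> G (x + t *\<^sub>R v)) has_vector_derivative dir_deriv v (dir_deriv \<eta> G) x) (at 0)"
    by (rule has_derivative_dir_deriv(1)[OF kernel_has_derivative[OF kernel_dir_deriv[OF G(1)] x0]])
  have ev: "eventually (\<lambda>t. t \<in> UNIV \<longrightarrow> (\<Sum>l\<le>p. J l \<odot> dir_deriv (oct_e l) G (x + t *\<^sub>R v)) = dir_deriv \<eta> G (x + t *\<^sub>R v)) (nhds (0::real))"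
  proof -
    have "((\<lambda>t. x + t *\<^sub>R v) \<longlongrightarrow> x + 0 *\<^sub>R v) (nhds 0)" by (intro tendsto_intros filterlim_ident)
    then have "eventually (\<lambda>t. x + t *\<^sub>R v \<noteq> 0) (nhds (0::real))"
      using x0 by (auto intro: tendsto_imp_eventually_ne)
    then show ?thesis
      by eventually_elim (use G(2) x v in \<open>auto simp: slice_CR_def V_add V_scale\<close>)
  qed
  have "vector_derivative (\<lambda>t. \<Sum>l\<le>p. J l \<odot> dir_deriv (oct_e l) G (x + t *\<^sub>R v)) (at 0) = vector_derivative (\<lambda>t. dir_deriv \<eta> G (x + t *\<^sub>R v)) (at 0)"
    by (rule vector_derivative_cong_eq[OF ev]) auto
  then have "(\<Sum>l\<le>p. J l \<odot> dir_deriv v (dir_deriv (oct_e l) G) x) = dir_deriv v (dir_deriv \<eta> G) x"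
    unfolding vector_derivative_at[OF lhs] vector_derivative_at[OF rhs] .
  then show "(\<Sum>l\<le>p. J l \<odot> dir_deriv (oct_e l) (dir_deriv v G) x) = dir_deriv \<eta> (dir_deriv v G) x"
    by (simp add: kernel_dir_deriv_commute[OF G(1) x0, of _ v])
qed

lemma slice_CR_word_deriv: "kernel G \<Longrightarrow> slice_CR G \<Longrightarrow> set vs \<subseteq> V \<Longrightarrow> slice_CR (word_deriv vs G)"
  by (induction vs) (auto intro: slice_CR_dir_deriv kernel_word_deriv)

lemma cnj_eta: "oct_cnj \<eta> = - \<eta>" by (simp add: oct_cnj_eq eta_inner_e)

text \<open>Here \<open>\<Sum> x\<^sub>l J l = \<eta> (x - r \<eta>) = \<eta> x + r\<close>, whose product with \<open>cnj x\<close> is \<open>|x|\<^sup>2 \<eta> + r cnj x\<close> by \<open>oct_mult_mult_cnj\<close>; and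
\<open>J l cnj e\<^sub>l = \<eta>\<close> for each of the \<open>p + 1\<close> indices. The exponent \<open>p + 2\<close> makes the coefficients of \<open>\<eta>\<close> match.\<close>

lemma slice_CR_cauchy_kernel: "slice_CR (cauchy_kernel p)"
  unfolding slice_CR_def
proof
  fix x assume x: "x \<in> V - {0}"
  then have x0: "x \<noteq> 0" and xV: "x \<in> V" by auto
  have d: "dir_deriv b (cauchy_kernel p) x = (1 / sphere_area p) *\<^sub>R
     ((1 / norm x ^ (p + 2)) *\<^sub>R oct_cnj b - (real (p + 2) * (x \<bullet> b) / norm x ^ (p + 4)) *\<^sub>R oct_cnj x)" for b
  proof -
    have "((\<lambda>t. cauchy_reg p 0 (x + t *\<^sub>R b)) has_vector_derivative cauchy_reg_deriv p 0 b x) (at 0)"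
      by (rule cauchy_reg_has_derivative) (use x0 in simp)
    then show ?thesis
      unfolding dir_deriv_def cauchy_reg_zero
      by (subst vector_derivative_at) (auto simp: cauchy_reg_deriv_def norm_eq_sqrt_inner)
  qed
  have 1: "J l \<odot> oct_cnj (oct_e l) = \<eta>" if "l \<le> p" for l
    using that p_le oct_mult_mult_cnj[of \<eta> "oct_e l"] by (simp add: J_def oct_e_inner)
  have xe: "(\<Sum>l\<le>p. (x \<bullet> oct_e l) *\<^sub>R oct_e l) = x - (x \<bullet> \<eta>) *\<^sub>R \<eta>"
    using V_expand[OF xV] by (simp add: sum.atMost_Suc algebra_simps)
  have eta2: "\<eta> \<odot> \<eta> = - oct_e 0"
    using oct_cnj_mult_mult[of \<eta> "oct_e 0"] by (simp add: cnj_eta oct.minus_left eta_inner_eta minus_equation_iff)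
  have 2: "(\<Sum>l\<le>p. (x \<bullet> oct_e l) *\<^sub>R (J l \<odot> oct_cnj x)) = (norm x)\<^sup>2 *\<^sub>R \<eta> + (x \<bullet> \<eta>) *\<^sub>R oct_cnj x"
  proof -
    have "(\<Sum>l\<le>p. (x \<bullet> oct_e l) *\<^sub>R (J l \<odot> oct_cnj x)) = (\<eta> \<odot> (\<Sum>l\<le>p. (x \<bullet> oct_e l) *\<^sub>R oct_e l)) \<odot> oct_cnj x"
      by (simp add: J_def oct.sum_right oct.sum_left oct.scaleR_left oct.scaleR_right)
    also have "\<dots> = (norm x)\<^sup>2 *\<^sub>R \<eta> + (x \<bullet> \<eta>) *\<^sub>R oct_cnj x"
      unfolding xe by (simp add: oct.diff_right oct.diff_left oct.add_left oct_mult_mult_cnj oct.scaleR_right oct.scaleR_left eta2 oct.minus_left power2_norm_eq_inner)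
    finally show ?thesis .
  qed
  have "(\<Sum>l\<le>p. J l \<odot> dir_deriv (oct_e l) (cauchy_kernel p) x) = 
    (\<Sum>l\<le>p. (1 / sphere_area p) *\<^sub>R ((1 / norm x ^ (p + 2)) *\<^sub>R \<eta> - (real (p + 2) / norm x ^ (p + 4)) *\<^sub>R ((x \<bullet> oct_e l) *\<^sub>R (J l \<odot> oct_cnj x))))"
    by (rule sum.cong) (simp_all add: d oct.scaleR_right oct.diff_right 1)
  also have "\<dots> = (1 / sphere_area p) *\<^sub>R ((real (p + 1) / norm x ^ (p + 2)) *\<^sub>R \<eta> - (real (p + 2) / norm x ^ (p + 4)) *\<^sub>R ((norm x)\<^sup>2 *\<^sub>R \<eta> + (x \<bullet> \<eta>) *\<^sub>R oct_cnj x))"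
    unfolding 2[symmetric]
    unfolding scaleR_sum_right[symmetric] sum_subtractf sum_constant_scaleR by simp
  also have "\<dots> = dir_deriv \<eta> (cauchy_kernel p) x"
  proof -
    have "norm x ^ (p + 4) = norm x ^ (p + 2) * (norm x)\<^sup>2"
      unfolding power_add[symmetric] by (rule arg_cong[where f="\<lambda>n. norm x ^ n"]) simp
    then have "real (p + 2) / norm x ^ (p + 4) * (norm x)\<^sup>2 = real (p + 2) / norm x ^ (p + 2)"
      using x0 by simp
    then have m1: "(real (p + 2) / norm x ^ (p + 4)) *\<^sub>R ((norm x)\<^sup>2 *\<^sub>R \<eta> + (x \<bullet> \<eta>) *\<^sub>R oct_cnj x)
      = (real (p + 2) / norm x ^ (p + 2)) *\<^sub>R \<eta> + (real (p + 2) * (x \<bullet> \<eta>) / norm x ^ (p + 4)) *\<^sub>R oct_cnj x"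
      by (simp only: scaleR_add_right scaleR_scaleR) simp
    have m2: "(real (p + 1) / norm x ^ (p + 2)) *\<^sub>R \<eta> - (real (p + 2) / norm x ^ (p + 2)) *\<^sub>R \<eta> = (1 / norm x ^ (p + 2)) *\<^sub>R (- \<eta>)"
      by (simp add: scaleR_diff_left[symmetric] diff_divide_distrib[symmetric] flip: scaleR_minus_left)
    show ?thesis unfolding d cnj_eta m1 diff_diff_eq[symmetric] m2 ..
  qed
  finally show "(\<Sum>l\<le>p. J l \<odot> dir_deriv (oct_e l) (cauchy_kernel p) x) = dir_deriv \<eta> (cauchy_kernel p) x" .
qed

end

context slice_ball
begin

text \<open>Uniform continuity of the derivative on \<open>K \<times> {-d..d}\<close> makes the difference quotients converge uniformly on the sphere.\<close>

lemma S_has_vector_derivative: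
  fixes g g' :: "oct \<Rightarrow> real \<Rightarrow> oct"
  assumes d: "d > 0"
    and deriv: "\<And>y t. y \<in> K \<Longrightarrow> t \<in> {-d..d} \<Longrightarrow> (g y has_vector_derivative g' y t) (at t)"
    and g': "continuous_on (K \<times> {-d..d}) (\<lambda>z. g' (fst z) (snd z))"
    and g: "\<And>t. t \<in> {-d..d} \<Longrightarrow> continuous_on K (\<lambda>y. g y t)"
  shows "((\<lambda>t. S (\<lambda>y. g y t)) has_vector_derivative S (\<lambda>y. g' y 0)) (at 0)"
proof -
  let ?T = "{-d..d}"
  have g'0: "continuous_on K (\<lambda>y. g' y 0)"
  proof -
    have "continuous_on K ((\<lambda>z. g' (fst z) (snd z)) \<circ> (\<lambda>y. (y, 0)))"
      by (intro continuous_on_compose continuous_intros continuous_on_subset[OF g']) (use d in auto)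
    then show ?thesis by (simp add: o_def)
  qed
  have uc: "uniformly_continuous_on (K \<times> ?T) (\<lambda>z. g' (fst z) (snd z))"
    by (rule compact_uniformly_continuous[OF g' compact_Times[OF K_compact compact_Icc]])
  show ?thesis
    unfolding has_vector_derivative_def has_derivative_at_alt
  proof (intro conjI allI impI)
    show "bounded_linear (\<lambda>t. t *\<^sub>R S (\<lambda>y. g' y 0))" by (rule bounded_linear_scaleR_left)
    fix e :: real assume e: "e > 0"
    define e' where "e' = e / (area + 1)"
    have e': "e' > 0" "e' * area \<le> e" using e area_nonneg by (auto simp: e'_def field_simps)
    then obtain c where c: "c > 0" "\<And>z z'. z \<in> K \<times> ?T \<Longrightarrow> z' \<in> K \<times> ?T \<Longrightarrow> dist z' z < c \<Longrightarrow> dist (g' (fst z') (snd z')) (g' (fst z) (snd z)) < e'"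
      using uc[unfolded uniformly_continuous_on_def, rule_format, OF e'(1)] by metis
    show "\<exists>c>0. \<forall>t. norm (t - 0) < c \<longrightarrow> norm (S (\<lambda>y. g y t) - S (\<lambda>y. g y 0) - (t - 0) *\<^sub>R S (\<lambda>y. g' y 0)) \<le> e * norm (t - 0)"
    proof (intro exI[of _ "min c d"] conjI allI impI)
      show "min c d > 0" using c d by simp
      fix t :: real assume "norm (t - 0) < min c d"
      then have t: "\<bar>t\<bar> < c" "\<bar>t\<bar> < d" by auto
      have "t \<in> ?T" "0 \<in> ?T" using t d by (auto simp: abs_less_iff)
      then have gc: "continuous_on K (\<lambda>y. g y t)" "continuous_on K (\<lambda>y. g y 0)" using g by blast+
      have "norm (S (\<lambda>y. g y t - g y 0 - t *\<^sub>R g' y 0)) \<le> (\<bar>t\<bar> * e') * area"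
      proof (rule S_bound)
        show "continuous_on K (\<lambda>y. g y t - g y 0 - t *\<^sub>R g' y 0)" by (intro continuous_intros gc g'0)
        fix y assume y: "y \<in> K"
        have "norm (g y t - g y 0 - (t - 0) *\<^sub>R g' y 0) \<le> norm (t - 0) * e'"
        proof (rule vector_differentiable_bound_linearization[where S="closed_segment 0 t"])
          have seg: "s \<in> ?T \<and> \<bar>s\<bar> < c" if "s \<in> closed_segment 0 t" for s
            using that t by (auto simp: closed_segment_eq_real_ivl split: if_splits)
          show "(g y has_vector_derivative g' y s) (at s within closed_segment 0 t)" if "s \<in> closed_segment 0 t" for s
            using deriv[OF y] seg[OF that] by (blast intro: has_vector_derivative_at_within)
          show "norm (g' y s - g' y 0) \<le> e'" if "s \<in> closed_segment 0 t" for s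
            using c(2)[of "(y,0)" "(y,s)"] seg[OF that] y d by (simp add: dist_Pair_Pair dist_norm)
        qed auto
        then show "norm (g y t - g y 0 - t *\<^sub>R g' y 0) \<le> \<bar>t\<bar> * e'" by simp
      qed
      also have "\<dots> \<le> e * \<bar>t\<bar>" using mult_left_mono[OF e'(2), of "\<bar>t\<bar>"] by (simp add: ac_simps)
      also have "S (\<lambda>y. g y t - g y 0 - t *\<^sub>R g' y 0) = S (\<lambda>y. g y t) - S (\<lambda>y. g y 0) - t *\<^sub>R S (\<lambda>y. g' y 0)"
        using gc g'0 by (simp add: S_diff S_scaleR continuous_intros)
      finally show "norm (S (\<lambda>y. g y t) - S (\<lambda>y. g y 0) - (t - 0) *\<^sub>R S (\<lambda>y. g' y 0)) \<le> e * norm (t - 0)" by simp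
    qed
  qed
qed

lemma kernel_shift_continuous:
  assumes "kernel G" "norm x < R"
  shows "continuous_on K (\<lambda>y. G (y - x))"
  by (rule continuous_on_compose2[OF kernel_continuous[OF assms(1)]]) (use assms in \<open>auto intro!: continuous_intros simp: K_def\<close>)

text \<open>While \<open>x + t v\<close> stays inside the ball, its distance from the sphere is positive and the integrand is smooth in \<open>t\<close>.\<close>

lemma kernel_integral_deriv:
  assumes G: "kernel G" and F: "continuous_on K F" and x: "norm x < R"
  shows "((\<lambda>t. S (\<lambda>y. G (y - (x + t *\<^sub>R v)) \<odot> F y)) has_vector_derivative - S (\<lambda>y. dir_deriv v G (y - x) \<odot> F y)) (at 0)"
proof -
  define d where "d = (R - norm x) / (norm v + 1)"
  have nv: "norm v + 1 > 0" by (smt (verit) norm_ge_zero)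
  have d: "d / 2 > 0" using x nv by (simp add: d_def)
  have d': "d * (norm v + 1) = R - norm x" using nv by (simp add: d_def)
  have dv: "norm (x + t *\<^sub>R v) < R" if "t \<in> {-(d/2)..d/2}" for t
  proof -
    have "norm (x + t *\<^sub>R v) \<le> norm x + \<bar>t\<bar> * norm v" using norm_triangle_ineq[of x "t *\<^sub>R v"] by simp
    also have "\<bar>t\<bar> * norm v \<le> (d / 2) * norm v" using that by (intro mult_right_mono) auto
    also have "\<dots> \<le> (d / 2) * (norm v + 1)" using d by (intro mult_left_mono) auto
    also have "\<dots> = (R - norm x) / 2" using d' by simp
    also have "norm x + (R - norm x) / 2 < R" using x by (simp add: field_simps)
    finally show ?thesis by simp
  qed
  have "((\<lambda>t. S (\<lambda>y. G (y - (x + t *\<^sub>R v)) \<odot> F y)) has_vector_derivative S (\<lambda>y. (- dir_deriv v G (y - (x + 0 *\<^sub>R v))) \<odot> F y)) (at 0)"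
  proof (rule S_has_vector_derivative[OF d, where g="\<lambda>y t. G (y - (x + t *\<^sub>R v)) \<odot> F y" and g'="\<lambda>y t. (- dir_deriv v G (y - (x + t *\<^sub>R v))) \<odot> F y"])
    fix y t assume y: "y \<in> K" and t: "t \<in> {-(d/2)..d/2}"
    have ne: "y - (x + t *\<^sub>R v) \<noteq> 0" using dv[OF t] y by (auto simp: K_def)
    then have "((\<lambda>t. G (y - (x + t *\<^sub>R v))) has_vector_derivative - dir_deriv v G (y - (x + t *\<^sub>R v))) (at t)"
      using kernel_line_derivative[OF G, of "y - x" t v] by (simp add: diff_diff_eq)
    then show "((\<lambda>t. G (y - (x + t *\<^sub>R v)) \<odot> F y) has_vector_derivative (- dir_deriv v G (y - (x + t *\<^sub>R v))) \<odot> F y) (at t)"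
      by (rule bounded_linear.has_vector_derivative[OF oct.bounded_linear_left])
  next
    have "continuous_on (K \<times> {-(d/2)..d/2}) (\<lambda>z. dir_deriv v G (fst z - (x + snd z *\<^sub>R v)))"
      by (rule continuous_on_compose2[OF kernel_continuous[OF kernel_dir_deriv[OF G]]])
         (use dv in \<open>force intro!: continuous_intros simp: K_def\<close>)+
    moreover have "continuous_on (K \<times> {-(d/2)..d/2}) (\<lambda>z. F (fst z))"
      by (rule continuous_on_compose2[OF F]) (auto intro: continuous_intros)
    ultimately show "continuous_on (K \<times> {-(d/2)..d/2}) (\<lambda>z. (- dir_deriv v G (fst z - (x + snd z *\<^sub>R v))) \<odot> F (fst z))"
      by (intro oct.continuous_on continuous_on_minus)
  next
    show "continuous_on K (\<lambda>y. G (y - (x + t *\<^sub>R v)) \<odot> F y)" if "t \<in> {-(d/2)..d/2}" for t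
      by (intro oct.continuous_on kernel_shift_continuous G F dv that)
  qed
  moreover have "S (\<lambda>y. (- dir_deriv v G (y - (x + 0 *\<^sub>R v))) \<odot> F y) = - S (\<lambda>y. dir_deriv v G (y - x) \<odot> F y)"
    by (simp add: oct.minus_left S_minus oct.continuous_on kernel_shift_continuous kernel_dir_deriv G F x)
  ultimately show ?thesis by simp
qed

end

section \<open>Expansion of the Cauchy kernel along rays\<close>

text \<open>The coefficients of the binomial series of \<open>(1 - z) powr (- q / 2)\<close>.\<close>

definition binom_coeff :: "nat \<Rightarrow> nat \<Rightarrow> real" where
  "binom_coeff q n = (- 1) ^ n * ((- (real q / 2)) gchoose n)"

text \<open>The coefficients of the Cauchy square of the series with coefficients \<open>\<bar>binom_coeff q n\<bar>\<close>.\<close>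

definition binom_majorant :: "nat \<Rightarrow> nat \<Rightarrow> real" where
  "binom_majorant q n = (\<Sum>i\<le>n. \<bar>binom_coeff q i\<bar> * \<bar>binom_coeff q (n - i)\<bar>)"

lemma summable_abs_binom_coeff:
  assumes "0 \<le> s" "s < 1"
  shows "summable (\<lambda>n. \<bar>binom_coeff q n\<bar> * s ^ n)"
proof -
  obtain s' where s': "s < s'" "s' < 1" using dense[OF assms(2)] by blast
  have "(\<lambda>n. ((- (real q / 2)) gchoose n) * s' ^ n) sums (1 + s') powr (- (real q / 2))"
    by (rule gen_binomial_real) (use s' assms in auto)
  then have "summable (\<lambda>n. ((- (real q / 2)) gchoose n) * s' ^ n)" by (rule sums_summable)
  from powser_insidea[OF this, of s] have "summable (\<lambda>n. norm (((- (real q / 2)) gchoose n) * s ^ n))"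
    using s' assms by simp
  then show ?thesis using assms by (simp add: binom_coeff_def abs_mult power_abs)
qed

lemma summable_binom_majorant:
  assumes "0 \<le> s" "s < 1"
  shows "summable (\<lambda>n. binom_majorant q n * s ^ n)"
proof -
  have "summable (\<lambda>n. norm (\<bar>binom_coeff q n\<bar> * s ^ n))"
    using summable_abs_binom_coeff[OF assms, of q] assms by (simp add: abs_mult)
  from summable_Cauchy_product[OF this this]
  have "summable (\<lambda>n. \<Sum>i\<le>n. (\<bar>binom_coeff q i\<bar> * s ^ i) * (\<bar>binom_coeff q (n - i)\<bar> * s ^ (n - i)))" .
  moreover have "(\<Sum>i\<le>n. (\<bar>binom_coeff q i\<bar> * s ^ i) * (\<bar>binom_coeff q (n - i)\<bar> * s ^ (n - i))) = binom_majorant q n * s ^ n" for n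
    unfolding binom_majorant_def sum_distrib_right
    by (rule sum.cong) (auto simp: power_add[symmetric])
  ultimately show ?thesis by simp
qed

lemma binom_series_complex:
  assumes "norm (z::complex) < 1"
  shows "(\<lambda>n. of_real (binom_coeff q n) * z ^ n) sums (1 - z) powr (of_real (- (real q / 2)))"
proof -
  have "(\<lambda>n. ((of_real (- (real q / 2)) :: complex) gchoose n) * (- z) ^ n) sums (1 + (- z)) powr (of_real (- (real q / 2)))"
    by (rule gen_binomial_complex) (use assms in simp)
  moreover have "((of_real (- (real q / 2)) :: complex) gchoose n) * (- z) ^ n = of_real (binom_coeff q n) * z ^ n" for n
  proof -
    have "((of_real (- (real q / 2)) :: complex) gchoose n) = of_real ((- (real q / 2)) gchoose n)"
      by (simp add: gbinomial_prod_rev)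
    then show ?thesis by (simp add: binom_coeff_def power_minus[of z])
  qed
  ultimately show ?thesis by simp
qed

text \<open>The series for \<open>(1 - \<alpha> t) powr (- q / 2)\<close> has real coefficients in front of the powers of \<open>\<alpha>\<close>, so its conjugate is the series
for the conjugate of \<open>\<alpha>\<close>. The product of the two is the squared modulus \<open>|1 - \<alpha> t| powr (- q)\<close>. Up to a factor, the
coefficients are values of Gegenbauer polynomials.\<close>

lemma inverse_distance_power_series:
  fixes \<alpha> :: complex
  assumes \<alpha>: "norm \<alpha> \<le> s" "s < 1"
  shows "\<exists>c::nat \<Rightarrow> real. (\<forall>n. \<bar>c n\<bar> \<le> binom_majorant q n * s ^ n) \<and>
     (\<forall>t. \<bar>t\<bar> \<le> 1 \<longrightarrow> (\<lambda>n. c n * t ^ n) sums (1 / norm (1 - \<alpha> * of_real t) ^ q))"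
proof (intro exI conjI allI impI)
  define C where "C n = (\<Sum>i\<le>n. (of_real (binom_coeff q i) * \<alpha> ^ i) * cnj (of_real (binom_coeff q (n - i)) * \<alpha> ^ (n - i)))" for n
  fix n
  have "\<bar>Re (C n)\<bar> \<le> norm (C n)" by (rule abs_Re_le_cmod)
  also have "\<dots> \<le> (\<Sum>i\<le>n. \<bar>binom_coeff q i\<bar> * \<bar>binom_coeff q (n - i)\<bar> * s ^ n)"
    unfolding C_def
  proof (rule order_trans[OF norm_sum], rule sum_mono)
    fix i assume "i \<in> {..n}"
    then have "norm \<alpha> ^ i * norm \<alpha> ^ (n - i) = norm \<alpha> ^ n" by (simp add: power_add[symmetric])
    moreover have "norm \<alpha> ^ n \<le> s ^ n" using \<alpha> by (intro power_mono) auto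
    moreover have "norm ((of_real (binom_coeff q i) * \<alpha> ^ i) * cnj (of_real (binom_coeff q (n - i)) * \<alpha> ^ (n - i)))
       = (\<bar>binom_coeff q i\<bar> * \<bar>binom_coeff q (n - i)\<bar>) * (norm \<alpha> ^ i * norm \<alpha> ^ (n - i))"
      by (simp add: norm_mult norm_power)
    ultimately show "norm ((of_real (binom_coeff q i) * \<alpha> ^ i) * cnj (of_real (binom_coeff q (n - i)) * \<alpha> ^ (n - i))) \<le> \<bar>binom_coeff q i\<bar> * \<bar>binom_coeff q (n - i)\<bar> * s ^ n"
      using mult_left_mono[of "norm \<alpha> ^ n" "s ^ n" "\<bar>binom_coeff q i\<bar> * \<bar>binom_coeff q (n - i)\<bar>"] by simp
  qed
  also have "\<dots> = binom_majorant q n * s ^ n" by (simp add: binom_majorant_def sum_distrib_right)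
  finally show "\<bar>Re (C n)\<bar> \<le> binom_majorant q n * s ^ n" .
next
  define C where "C n = (\<Sum>i\<le>n. (of_real (binom_coeff q i) * \<alpha> ^ i) * cnj (of_real (binom_coeff q (n - i)) * \<alpha> ^ (n - i)))" for n
  fix t :: real assume t: "\<bar>t\<bar> \<le> 1"
  define z where "z = \<alpha> * of_real t"
  have "norm \<alpha> * \<bar>t\<bar> \<le> s * 1" using \<alpha> t order_trans[OF norm_ge_zero \<alpha>(1)] by (intro mult_mono) auto
  then have nz: "norm z \<le> s" by (simp add: z_def norm_mult)
  then have z: "norm z < 1" using \<alpha> by simp
  let ?a = "\<lambda>n. of_real (binom_coeff q n) * z ^ n"
  let ?P = "(1 - z) powr (of_real (- (real q / 2)))"
  have s: "?a sums ?P" by (rule binom_series_complex[OF z])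
  have sc: "(\<lambda>n. cnj (?a n)) sums cnj ?P" using s by (simp only: sums_cnj)
  have ns: "summable (\<lambda>n. norm (?a n))"
    using summable_abs_binom_coeff[of "norm z" q] z by (simp add: norm_mult norm_power)
  have "(\<lambda>n. \<Sum>i\<le>n. ?a i * cnj (?a (n - i))) sums ((\<Sum>n. ?a n) * (\<Sum>n. cnj (?a n)))"
    by (rule Cauchy_product_sums) (use ns in \<open>simp_all only: complex_mod_cnj\<close>)
  then have "(\<lambda>n. \<Sum>i\<le>n. ?a i * cnj (?a (n - i))) sums (?P * cnj ?P)"
    using sums_unique[OF s] sums_unique[OF sc] by simp
  then have "(\<lambda>n. Re (\<Sum>i\<le>n. ?a i * cnj (?a (n - i)))) sums Re (?P * cnj ?P)" by (rule sums_Re)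
  moreover have "Re (\<Sum>i\<le>n. ?a i * cnj (?a (n - i))) = Re (C n) * t ^ n" for n
  proof -
    have "(\<Sum>i\<le>n. ?a i * cnj (?a (n - i))) = C n * of_real (t ^ n)"
      unfolding C_def sum_distrib_right
    proof (rule sum.cong[OF refl])
      fix i assume "i \<in> {..n}"
      then have "(of_real t :: complex) ^ n = of_real t ^ i * of_real t ^ (n - i)" by (simp add: power_add[symmetric])
      then show "?a i * cnj (?a (n - i)) = (of_real (binom_coeff q i) * \<alpha> ^ i) * cnj (of_real (binom_coeff q (n - i)) * \<alpha> ^ (n - i)) * of_real (t ^ n)"
        by (simp add: z_def power_mult_distrib)
    qed
    then show ?thesis by simp
  qed
  moreover have "Re (?P * cnj ?P) = 1 / norm (1 - z) ^ q"
  proof -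
    have pos: "norm (1 - z) > 0" using z by auto
    have "?P * cnj ?P = of_real ((norm ?P)\<^sup>2)" by (rule complex_norm_square[symmetric])
    moreover have "norm ?P = norm (1 - z) powr (- (real q / 2))"
      by (subst norm_powr_real_powr') auto
    moreover have "(norm (1 - z) powr (- (real q / 2)))\<^sup>2 = 1 / norm (1 - z) ^ q"
    proof -
      have "(norm (1 - z) powr (- (real q / 2)))\<^sup>2 = norm (1 - z) powr (- real q)"
        by (simp add: power2_eq_square powr_add[symmetric])
      also have "\<dots> = 1 / norm (1 - z) ^ q" using pos by (simp add: powr_minus powr_realpow divide_inverse)
      finally show ?thesis .
    qed
    ultimately show ?thesis by simp
  qed
  ultimately show "(\<lambda>n. Re (C n) * t ^ n) sums (1 / norm (1 - \<alpha> * of_real t) ^ q)" by (simp add: z_def)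
qed

text \<open>The majorant \<open>M\<close> is independent of \<open>y\<close>, so the series may be integrated over the sphere term by term. The disc of
convergence has radius \<open>R / |x| > 1\<close>, hence contains \<open>t = 1\<close>.\<close>

lemma cauchy_kernel_series:
  assumes R: "R > 0" and x: "norm x < R"
  shows "\<exists>M. summable M \<and> (\<forall>y. norm y = R \<longrightarrow> (\<exists>C::nat \<Rightarrow> oct. (\<forall>n. norm (C n) \<le> M n) \<and>
     (\<forall>t. \<bar>t\<bar> \<le> 1 \<longrightarrow> (\<lambda>n. t ^ n *\<^sub>R C n) sums cauchy_kernel p (y - t *\<^sub>R x))))"
proof -
  define s where "s = norm x / R"
  have s: "0 \<le> s" "s < 1" using R x by (auto simp: s_def)
  define m where "m n = binom_majorant (p + 2) n * s ^ n" for n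
  have sm: "summable m" unfolding m_def by (rule summable_binom_majorant[OF s])
  define c1 where "c1 = 1 / (sphere_area p * R ^ (p + 2))"
  have c1: "c1 > 0" using R sphere_area_pos[of p] by (simp add: c1_def)
  define Mm where "Mm n = c1 * (m n * R + (case n of 0 \<Rightarrow> 0 | Suc k \<Rightarrow> m k) * R)" for n
  have "summable (\<lambda>n. case n of 0 \<Rightarrow> 0 | Suc k \<Rightarrow> m k)"
    by (subst summable_Suc_iff[symmetric]) (use sm in simp)
  then have "summable Mm" unfolding Mm_def using sm by (intro summable_mult summable_add summable_mult2)
  moreover have "\<exists>C::nat \<Rightarrow> oct. (\<forall>n. norm (C n) \<le> Mm n) \<and>
     (\<forall>t. \<bar>t\<bar> \<le> 1 \<longrightarrow> (\<lambda>n. t ^ n *\<^sub>R C n) sums cauchy_kernel p (y - t *\<^sub>R x))" if y: "norm y = R" for y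
  proof -
    define b where "b = y \<bullet> x"
    define d where "d = sqrt (R\<^sup>2 * (norm x)\<^sup>2 - b\<^sup>2)"
    have "b\<^sup>2 \<le> R\<^sup>2 * (norm x)\<^sup>2" using Cauchy_Schwarz_ineq[of y x] y by (simp add: b_def power2_norm_eq_inner[symmetric])
    then have d2: "d\<^sup>2 = R\<^sup>2 * (norm x)\<^sup>2 - b\<^sup>2" by (simp add: d_def)
    \<comment> \<open>\<open>R\<^sup>2 (1 - \<alpha> t) (1 - cnj \<alpha> t)\<close> is the quadratic polynomial \<open>|y - t x|\<^sup>2\<close> in \<open>t\<close>.\<close>
    define \<alpha> where "\<alpha> = Complex (b / R\<^sup>2) (d / R\<^sup>2)"
    have na: "(norm \<alpha>)\<^sup>2 = s\<^sup>2"
      unfolding cmod_power2 \<alpha>_def complex.sel power_divide d2 add_divide_distrib[symmetric] s_def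
      using R by (simp add: field_simps power2_eq_square)
    then have "norm \<alpha> = s" using s by (simp add: power2_eq_iff_nonneg)
    then obtain c where c: "\<And>n. \<bar>c n\<bar> \<le> m n" "\<And>t. \<bar>t\<bar> \<le> 1 \<Longrightarrow> (\<lambda>n. c n * t ^ n) sums (1 / norm (1 - \<alpha> * of_real t) ^ (p + 2))"
      using inverse_distance_power_series[of \<alpha> s "p + 2"] s unfolding m_def by auto
    have dist: "norm (y - t *\<^sub>R x) = R * norm (1 - \<alpha> * of_real t)" for t
    proof -
      have "(norm (1 - \<alpha> * of_real t))\<^sup>2 = 1 - 2 * t * Re \<alpha> + t\<^sup>2 * (norm \<alpha>)\<^sup>2"
        unfolding cmod_power2 by (simp add: algebra_simps power2_eq_square)
      then have "R\<^sup>2 * (norm (1 - \<alpha> * of_real t))\<^sup>2 = R\<^sup>2 - 2 * t * b + t\<^sup>2 * (norm x)\<^sup>2"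
        unfolding na using R by (simp add: \<alpha>_def s_def power_divide field_simps)
      also have "\<dots> = (norm (y - t *\<^sub>R x))\<^sup>2"
        unfolding y[symmetric] power2_norm_eq_inner b_def
        by (simp add: inner_diff_left inner_diff_right inner_commute power2_eq_square algebra_simps)
      finally have "(R * norm (1 - \<alpha> * of_real t))\<^sup>2 = (norm (y - t *\<^sub>R x))\<^sup>2" by (simp add: power_mult_distrib)
      then show ?thesis using R by (simp add: power2_eq_iff_nonneg)
    qed
    \<comment> \<open>The shift by one accounts for the factor \<open>t\<close> in \<open>cnj (y - t x) = cnj y - t cnj x\<close>.\<close>
    define c' where "c' n = (case n of 0 \<Rightarrow> 0 | Suc k \<Rightarrow> c k)" for n
    define C where "C n = c1 *\<^sub>R (c n *\<^sub>R oct_cnj y - c' n *\<^sub>R oct_cnj x)" for n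
    have ncnj: "norm (oct_cnj z) = norm z" for z
      by (simp add: norm_eq_sqrt_inner oct_inner oct_cnj_nth)
    have "norm (C n) \<le> Mm n" for n
    proof -
      have "norm (C n) \<le> c1 * (\<bar>c n\<bar> * R + \<bar>c' n\<bar> * norm x)"
        using c1 norm_triangle_ineq4[of "c n *\<^sub>R oct_cnj y" "c' n *\<^sub>R oct_cnj x"] y by (simp add: C_def ncnj)
      also have "\<dots> \<le> Mm n"
        unfolding Mm_def c'_def using c1 c(1) x R
        by (intro mult_left_mono add_mono mult_mono) (auto split: nat.split intro: order_trans[OF abs_ge_zero c(1)])
      finally show ?thesis .
    qed
    moreover have "(\<lambda>n. t ^ n *\<^sub>R C n) sums cauchy_kernel p (y - t *\<^sub>R x)" if t: "\<bar>t\<bar> \<le> 1" for t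
    proof -
      let ?S = "1 / norm (1 - \<alpha> * of_real t) ^ (p + 2)"
      have 1: "(\<lambda>n. c n * t ^ n) sums ?S" by (rule c(2)[OF t])
      have "(\<lambda>n. c' (Suc n) * t ^ Suc n) sums (?S * t)"
        using sums_mult2[OF 1, of t] by (simp add: c'_def mult_ac)
      then have 2: "(\<lambda>n. c' n * t ^ n) sums (?S * t)"
        by (subst (asm) sums_Suc_iff) (simp add: c'_def)
      have "(\<lambda>n. c1 *\<^sub>R ((c n * t ^ n) *\<^sub>R oct_cnj y - (c' n * t ^ n) *\<^sub>R oct_cnj x)) sums (c1 *\<^sub>R (?S *\<^sub>R oct_cnj y - (?S * t) *\<^sub>R oct_cnj x))"
        by (intro bounded_linear.sums[OF bounded_linear_scaleR_right] sums_diff bounded_linear.sums[OF bounded_linear_scaleR_left] 1 2)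
      moreover have "c1 *\<^sub>R ((c n * t ^ n) *\<^sub>R oct_cnj y - (c' n * t ^ n) *\<^sub>R oct_cnj x) = t ^ n *\<^sub>R C n" for n
        by (simp add: C_def scaleR_diff_right mult_ac)
      moreover have "c1 *\<^sub>R (?S *\<^sub>R oct_cnj y - (?S * t) *\<^sub>R oct_cnj x) = cauchy_kernel p (y - t *\<^sub>R x)"
      proof -
        have "c1 * ?S = 1 / (sphere_area p * norm (y - t *\<^sub>R x) ^ (p + 2))"
          by (simp add: c1_def dist power_mult_distrib mult_ac)
        moreover have "oct_cnj (y - t *\<^sub>R x) = oct_cnj y - t *\<^sub>R oct_cnj x"
          by (simp add: linear_diff[OF bounded_linear.linear[OF bounded_linear_oct_cnj]] linear_cmul[OF bounded_linear.linear[OF bounded_linear_oct_cnj]])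
        moreover have "c1 *\<^sub>R (?S *\<^sub>R oct_cnj y - (?S * t) *\<^sub>R oct_cnj x) = (c1 * ?S) *\<^sub>R (oct_cnj y - t *\<^sub>R oct_cnj x)"
          by (simp only: scaleR_diff_right scaleR_scaleR mult.assoc)
        ultimately show ?thesis unfolding cauchy_kernel_def by (simp only:)
      qed
      ultimately show ?thesis by simp
    qed
    ultimately show ?thesis by blast
  qed
  ultimately show ?thesis by blast
qed

lemma diffs_funpow: "(diffs ^^ k) c n = (fact (n + k) / fact n) * (c (n + k) :: real)"
proof (induction k arbitrary: n)
  case (Suc k)
  have "(diffs ^^ Suc k) c n = real (Suc n) * (diffs ^^ k) c (Suc n)" by (simp add: diffs_def)
  also have "\<dots> = (real (Suc n) / fact (Suc n)) * fact (Suc n + k) * c (Suc n + k)"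
    unfolding Suc by (simp del: of_nat_Suc fact_Suc)
  also have "real (Suc n) / fact (Suc n) = 1 / fact n" by (simp add: fact_Suc del: of_nat_Suc)
  also have "1 / fact n * fact (Suc n + k) * c (Suc n + k) = (fact (n + Suc k) / fact n) * c (n + Suc k)"
    by (simp del: fact_Suc)
  finally show ?case .
qed simp

text \<open>Uniqueness of power series expansions, for a function whose successive derivatives are given as a sequence \<open>g\<close>.\<close>

lemma power_series_coefficients_real:
  fixes g :: "nat \<Rightarrow> real \<Rightarrow> real"
  assumes s: "\<And>t. \<bar>t\<bar> < 1 \<Longrightarrow> (\<lambda>n. c n * t ^ n) sums g 0 t"
    and d: "\<And>k t. \<bar>t\<bar> < 1 \<Longrightarrow> (g k has_real_derivative g (Suc k) t) (at t)"
  shows "g k 0 = fact k * c k"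
proof -
  have *: "(\<lambda>n. (diffs ^^ k) c n * t ^ n) sums g k t" if "\<bar>t\<bar> < 1" for t
    using that
  proof (induction k arbitrary: t)
    case (Suc k)
    let ?c = "(diffs ^^ k) c"
    have sm: "summable (\<lambda>n. ?c n * z ^ n)" if "norm z < 1" for z
      using Suc.IH[of z] that by (simp add: sums_iff)
    have t: "norm t < 1" using Suc.prems by simp
    have "((\<lambda>z. \<Sum>n. ?c n * z ^ n) has_field_derivative (\<Sum>n. diffs ?c n * t ^ n)) (at t)"
      by (rule termdiffs_strong'[OF sm t])
    moreover have "((\<lambda>z. \<Sum>n. ?c n * z ^ n) has_field_derivative g (Suc k) t) (at t)"
    proof (rule has_field_derivative_transform_within_open[OF d[OF Suc.prems, of k], where S="{-1<..<1}"])
      fix z :: real assume "z \<in> {-1<..<1}"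
      then have "\<bar>z\<bar> < 1" by auto
      then show "g k z = (\<Sum>n. ?c n * z ^ n)" using sums_unique[OF Suc.IH] by simp
    qed (use Suc.prems in auto)
    ultimately have "(\<Sum>n. diffs ?c n * t ^ n) = g (Suc k) t" by (rule DERIV_unique)
    moreover have "summable (\<lambda>n. diffs ?c n * t ^ n)" by (rule termdiff_converges[OF t sm])
    ultimately show ?case by (simp add: sums_iff)
  qed (use s in simp)
  from *[of 0] have "g k 0 = (diffs ^^ k) c 0" by (simp add: powser_sums_zero_iff)
  then show ?thesis by (simp add: diffs_funpow)
qed

lemma cauchy_kernel_coefficients:
  fixes C :: "nat \<Rightarrow> oct"
  assumes C: "\<And>t. \<bar>t\<bar> \<le> 1 \<Longrightarrow> (\<lambda>n. t ^ n *\<^sub>R C n) sums cauchy_kernel p (y - t *\<^sub>R x)" and xy: "norm x < norm y"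
  shows "C n = ((- 1) ^ n / fact n) *\<^sub>R word_deriv (replicate n x) (cauchy_kernel p) y"
proof -
  define g where "g k t = (- 1) ^ k *\<^sub>R word_deriv (replicate k x) (cauchy_kernel p) (y - t *\<^sub>R x)" for k t
  have gd: "(g k has_vector_derivative g (Suc k) t) (at t)" if t: "\<bar>t\<bar> < 1" for k t
  proof -
    have "norm (t *\<^sub>R x) \<le> 1 * norm x" unfolding norm_scaleR using t by (intro mult_right_mono) auto
    then have ne: "y - t *\<^sub>R x \<noteq> 0" using xy by auto
    let ?G = "word_deriv (replicate k x) (cauchy_kernel p)"
    have G: "kernel ?G" by (rule kernel_word_deriv[OF cauchy_kernel_kernel])
    note hv = bounded_linear.has_vector_derivative[OF bounded_linear_scaleR_right kernel_line_derivative[OF G ne], of "(- 1) ^ k"]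
    have "g k = (\<lambda>t. (- 1) ^ k *\<^sub>R ?G (y - t *\<^sub>R x))" by (rule ext) (simp only: g_def)
    moreover have "g (Suc k) t = (- 1) ^ k *\<^sub>R (- dir_deriv x ?G (y - t *\<^sub>R x))"
      by (simp only: g_def replicate.simps foldr.simps o_apply power_Suc mult_minus1 scaleR_minus_left scaleR_minus_right)
    ultimately show ?thesis using hv by (simp only:)
  qed
  have "g n 0 \<bullet> b = fact n * (C n \<bullet> b)" for b
  proof (rule power_series_coefficients_real[where g="\<lambda>k t. g k t \<bullet> b" and c="\<lambda>n. C n \<bullet> b"])
    fix t :: real assume "\<bar>t\<bar> < 1"
    then show "(\<lambda>n. (C n \<bullet> b) * t ^ n) sums (g 0 t \<bullet> b)"
      using bounded_linear.sums[OF bounded_linear_inner_left C, of t b]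
      unfolding g_def inner_scaleR_left power_0 scaleR_one replicate_0 foldr_Nil id_apply
      by (simp only: mult.commute[of "t ^ _"] less_imp_le)
  next
    fix k and t :: real assume "\<bar>t\<bar> < 1"
    from bounded_linear.has_vector_derivative[OF bounded_linear_inner_left gd[OF this]]
    show "((\<lambda>t. g k t \<bullet> b) has_real_derivative (g (Suc k) t \<bullet> b)) (at t)"
      unfolding has_real_derivative_iff_has_vector_derivative .
  qed
  then have "g n 0 = fact n *\<^sub>R C n" by (simp add: euclidean_eq_iff[of "g n 0"])
  then have "C n = (1 / fact n) *\<^sub>R g n 0" by simp
  then show ?thesis unfolding g_def by (simp only: scaleR_zero_left diff_zero scaleR_scaleR times_divide_eq_left mult_1)
qed

section \<open>Fueter polynomials and derivatives of the kernel\<close>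

text \<open>Let \<open>\<mu>\<close> assign a value to each multiset of letters from \<open>{..p}\<close>, to be thought of as a mixed partial derivative. Summing \<open>\<mu>\<close> times
the product of the \<open>z\<^sub>l = c l + r J l\<close> over all words of length \<open>n\<close> gives \<open>sym_re\<close> times \<open>1\<close> plus
\<open>\<Sum> sym_im (\<mu> with m added) J m\<close>, see \<open>sum_words_real\<close>. In symbols, with \<open>\<partial>\<close> for the addition of a letter, these are
the components of the \<open>n\<close>-th power of \<open>\<langle>c, \<partial>\<rangle> + r \<Sum> J l \<partial>\<^sub>l\<close>, where \<open>(\<Sum> J l \<partial>\<^sub>l)\<^sup>2 = - \<Sum> \<partial>\<^sub>l\<^sup>2\<close>.\<close>

fun sym_re :: "nat \<Rightarrow> (nat \<Rightarrow> real) \<Rightarrow> real \<Rightarrow> nat \<Rightarrow> (nat multiset \<Rightarrow> 'v::real_vector) \<Rightarrow> 'v"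
  and sym_im :: "nat \<Rightarrow> (nat \<Rightarrow> real) \<Rightarrow> real \<Rightarrow> nat \<Rightarrow> (nat multiset \<Rightarrow> 'v) \<Rightarrow> 'v" where
  "sym_re p c r 0 \<mu> = \<mu> {#}"
| "sym_re p c r (Suc n) \<mu> = (\<Sum>l\<le>p. c l *\<^sub>R sym_re p c r n (\<lambda>M. \<mu> (add_mset l M)))
     - r *\<^sub>R (\<Sum>l\<le>p. sym_im p c r n (\<lambda>M. \<mu> (add_mset l (add_mset l M))))"
| "sym_im p c r 0 \<mu> = 0"
| "sym_im p c r (Suc n) \<mu> = (\<Sum>l\<le>p. c l *\<^sub>R sym_im p c r n (\<lambda>M. \<mu> (add_mset l M))) + r *\<^sub>R sym_re p c r n \<mu>"

lemma sym_linear: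
  assumes "linear A"
  shows "sym_re p c r n (\<lambda>M. A (\<mu> M)) = A (sym_re p c r n \<mu>)"
    and "sym_im p c r n (\<lambda>M. A (\<mu> M)) = A (sym_im p c r n \<mu>)"
  by (induction n arbitrary: \<mu>)
     (simp_all add: linear_0[OF assms] linear_diff[OF assms] linear_add[OF assms] linear_sum[OF assms] linear_cmul[OF assms])

lemma sym_add:
  "sym_re p c r n (\<lambda>M. \<mu> M + \<nu> M) = sym_re p c r n \<mu> + sym_re p c r n \<nu>"
  "sym_im p c r n (\<lambda>M. \<mu> M + \<nu> M) = sym_im p c r n \<mu> + sym_im p c r n \<nu>"
  by (induction n arbitrary: \<mu> \<nu>)
     (simp_all add: scaleR_add_right sum.distrib algebra_simps)

lemma sym_zero: "sym_re p c r n (\<lambda>M. 0::'v::real_vector) = 0" "sym_im p c r n (\<lambda>M. 0::'v) = 0"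
  by (induction n) simp_all

lemma sym_sum:
  "sym_im p c r n (\<lambda>M. \<Sum>i\<in>I. \<mu> i M) = (\<Sum>i\<in>I. sym_im p c r n (\<mu> i))"
  by (induction I rule: infinite_finite_induct) (simp_all add: sym_zero sym_add)

text \<open>In the same symbols, the \<open>n\<close>-th power of \<open>\<langle>c, \<partial>\<rangle> + r \<partial>\<^sub>\<eta>\<close>, where the letter \<open>Suc p\<close> stands for \<open>\<partial>\<^sub>\<eta>\<close>.\<close>

fun sym_all :: "nat \<Rightarrow> (nat \<Rightarrow> real) \<Rightarrow> real \<Rightarrow> nat \<Rightarrow> (nat multiset \<Rightarrow> 'v::real_vector) \<Rightarrow> 'v" where
  "sym_all p c r 0 \<mu> = \<mu> {#}"
| "sym_all p c r (Suc n) \<mu> = (\<Sum>l\<le>p. c l *\<^sub>R sym_all p c r n (\<lambda>M. \<mu> (add_mset l M))) + r *\<^sub>R sym_all p c r n (\<lambda>M. \<mu> (add_mset (Suc p) M))"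

text \<open>If \<open>\<partial>\<^sub>\<eta>\<^sup>2 = - \<Sum> \<partial>\<^sub>l\<^sup>2\<close>, then \<open>\<partial>\<^sub>\<eta>\<close> may take the place of \<open>\<Sum> J l \<partial>\<^sub>l\<close> in the recursion for \<open>sym_re\<close> and \<open>sym_im\<close>.\<close>

lemma sym_all_harmonic:
  assumes "\<And>M. \<mu> (add_mset (Suc p) (add_mset (Suc p) M)) = - (\<Sum>l\<le>p. \<mu> (add_mset l (add_mset l M)))"
  shows "sym_all p c r n \<mu> = sym_re p c r n \<mu> + sym_im p c r n (\<lambda>M. \<mu> (add_mset (Suc p) M))"
  using assms
proof (induction n arbitrary: \<mu>)
  case (Suc n)
  have IH: "sym_all p c r n (\<lambda>M. \<mu> (add_mset i M)) = sym_re p c r n (\<lambda>M. \<mu> (add_mset i M)) + sym_im p c r n (\<lambda>M. \<mu> (add_mset (Suc p) (add_mset i M)))" for i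
  proof -
    have "(\<lambda>M. \<mu> (add_mset (Suc p) (add_mset i M))) = (\<lambda>M. \<mu> (add_mset i (add_mset (Suc p) M)))"
      by (rule ext, rule arg_cong[where f=\<mu>], rule add_mset_commute)
    moreover have "\<mu> (add_mset i (add_mset (Suc p) (add_mset (Suc p) M))) = - (\<Sum>l\<le>p. \<mu> (add_mset i (add_mset l (add_mset l M))))" for M
    proof -
      have "add_mset i (add_mset j (add_mset j M)) = add_mset j (add_mset j (add_mset i M))" for j by simp
      then show ?thesis using Suc.prems[of "add_mset i M"] by (simp only:)
    qed
    ultimately show ?thesis using Suc.IH[of "\<lambda>M. \<mu> (add_mset i M)"] by (simp only:)
  qed
  have im: "sym_im p c r n (\<lambda>M. \<mu> (add_mset (Suc p) (add_mset (Suc p) M))) = - (\<Sum>l\<le>p. sym_im p c r n (\<lambda>M. \<mu> (add_mset l (add_mset l M))))"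
    unfolding Suc.prems sym_linear(2)[OF linear_uminus] sym_sum ..
  show ?case
    unfolding sym_all.simps sym_re.simps sym_im.simps IH im
    by (simp add: scaleR_add_right sum.distrib algebra_simps)
qed simp

text \<open>Polarisation of \<open>oct_cnj_mult_mult\<close>.\<close>

lemma oct_polarised: "oct_cnj a \<odot> (b \<odot> v) + oct_cnj b \<odot> (a \<odot> v) = (2 * (a \<bullet> b)) *\<^sub>R v"
proof -
  have cadd: "oct_cnj (a + b) = oct_cnj a + oct_cnj b" by (rule linear_add[OF bounded_linear.linear[OF bounded_linear_oct_cnj]])
  have "oct_cnj (a + b) \<odot> ((a + b) \<odot> v) = ((a + b) \<bullet> (a + b)) *\<^sub>R v" by (rule oct_cnj_mult_mult)
  then show ?thesis
    unfolding cadd by (simp add: oct.add_left oct.add_right oct_cnj_mult_mult inner_add_left inner_add_right inner_commute algebra_simps)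
qed

context oct_slice
begin

lemma J_inner: "l \<le> p \<Longrightarrow> m \<le> p \<Longrightarrow> J l \<bullet> J m = (if l = m then 1 else 0)"
  using p_le by (simp add: J_def oct_inner_mult_left oct_cnj_mult_mult eta_inner_eta oct_e_inner)

lemma cnj_J: "l \<le> p \<Longrightarrow> oct_cnj (J l) = - J l"
proof -
  assume l: "l \<le> p"
  have "J l \<bullet> oct_e 0 = 0"
    using l by (simp add: J_def oct_inner_mult_left cnj_eta eta_inner_e inner_commute[of "oct_e l"])
  then show ?thesis by (simp add: oct_cnj_eq)
qed

lemma J_anticommute:
  assumes "l \<le> p" "m \<le> p"
  shows "J l \<odot> (J m \<odot> v) + J m \<odot> (J l \<odot> v) = (if l = m then - 2 else 0) *\<^sub>R v"
proof -
  have "J l \<odot> (J m \<odot> v) + J m \<odot> (J l \<odot> v) = - (oct_cnj (J l) \<odot> (J m \<odot> v) + oct_cnj (J m) \<odot> (J l \<odot> v))"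
    by (simp add: cnj_J assms oct.minus_left)
  also have "\<dots> = - ((2 * (J l \<bullet> J m)) *\<^sub>R v)" by (simp only: oct_polarised)
  also have "\<dots> = (if l = m then - 2 else 0) *\<^sub>R v" by (simp add: J_inner assms)
  finally show ?thesis .
qed

text \<open>A double sum against symmetric coefficients only sees the anticommutators of left multiplications by the \<open>J l\<close>.\<close>

lemma sum_J_symmetric:
  assumes sym: "\<And>l m. X l m = X m l"
  shows "(\<Sum>l\<le>p. \<Sum>m\<le>p. J l \<odot> (J m \<odot> X l m)) = - (\<Sum>l\<le>p. X l l)"
proof -
  let ?s = "\<Sum>l\<le>p. \<Sum>m\<le>p. J l \<odot> (J m \<odot> X l m)"
  have "?s = (\<Sum>l\<le>p. \<Sum>m\<le>p. J m \<odot> (J l \<odot> X l m))"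
    by (subst sum.swap) (simp add: sym)
  then have "?s + ?s = (\<Sum>l\<le>p. \<Sum>m\<le>p. J l \<odot> (J m \<odot> X l m) + J m \<odot> (J l \<odot> X l m))"
    by (simp add: sum.distrib)
  also have "\<dots> = (\<Sum>l\<le>p. \<Sum>m\<le>p. if l = m then - 2 *\<^sub>R X l l else 0)"
    by (intro sum.cong refl) (auto simp: J_anticommute)
  also have "\<dots> = - 2 *\<^sub>R (\<Sum>l\<le>p. X l l)"
    by (simp add: sum.delta scaleR_sum_right)
  finally have "2 *\<^sub>R ?s = 2 *\<^sub>R (- (\<Sum>l\<le>p. X l l))" by (simp add: scaleR_2)
  then show ?thesis unfolding scaleR_cancel_left by simp
qed

definition words :: "nat \<Rightarrow> nat list set" where "words n = {w. set w \<subseteq> {..p} \<and> length w = n}"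

lemma finite_words: "finite (words n)" unfolding words_def by (rule finite_lists_length_eq) simp

lemma sum_words_Suc: "(\<Sum>w\<in>words (Suc n). f w) = (\<Sum>l\<le>p. \<Sum>w\<in>words n. f (w @ [l]))"
proof -
  have "(\<Sum>w\<in>words (Suc n). f w) = (\<Sum>(l, w)\<in>{..p} \<times> words n. f (w @ [l]))"
  proof (rule sum.reindex_bij_witness[where i="\<lambda>(l, w). w @ [l]" and j="\<lambda>w. (last w, butlast w)"])
    fix w assume w: "w \<in> words (Suc n)"
    then have "w \<noteq> []" by (auto simp: words_def)
    then show "(case (last w, butlast w) of (l, w) \<Rightarrow> w @ [l]) = w" by simp
    have "last w \<in> {..p}" using w last_in_set[OF \<open>w \<noteq> []\<close>] unfolding words_def by blast
    then show "(last w, butlast w) \<in> {..p} \<times> words n"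
      using w by (auto simp: words_def dest: in_set_butlastD)
    show "(case (last w, butlast w) of (l, w) \<Rightarrow> f (w @ [l])) = f w" using \<open>w \<noteq> []\<close> by simp
  qed (auto simp: words_def)
  then show ?thesis by (simp add: sum.cartesian_product)
qed

definition zprod :: "oct \<Rightarrow> nat list \<Rightarrow> oct" where
  "zprod x w = foldl (\<odot>) (oct_e 0) (map (\<lambda>i. fueter_var p i x) w)"

lemma oct_expand: "x = (\<Sum>i\<le>7. oct_coord x i *\<^sub>R oct_e i)"
  unfolding sum_atMost_7 oct_coord_nth oct_e_nth by (simp add: oct_eq_iff axis_def)

lemma fueter_var_slice:
  assumes x: "x \<in> V" and l: "l \<le> p"
  shows "fueter_var p l x = (x \<bullet> bas l) *\<^sub>R oct_e 0 + (x \<bullet> \<eta>) *\<^sub>R J l"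
proof -
  have u: "{..7} = {..p} \<union> {Suc p..7}" "{..p} \<inter> {Suc p..7} = {}" using p_le by auto
  have "x = (\<Sum>i\<le>p. oct_coord x i *\<^sub>R oct_e i) + (\<Sum>i=Suc p..7. oct_coord x i *\<^sub>R oct_e i)"
    by (rule trans[OF oct_expand], subst u(1), rule sum.union_disjoint) (use u(2) in auto)
  moreover have "x = (\<Sum>i\<le>p. oct_coord x i *\<^sub>R oct_e i) + (x \<bullet> \<eta>) *\<^sub>R \<eta>"
    by (rule trans[OF V_expand[OF x]]) (simp add: sum.atMost_Suc oct_coord_inner)
  ultimately have "(\<Sum>i\<le>p. oct_coord x i *\<^sub>R oct_e i) + (\<Sum>i=Suc p..7. oct_coord x i *\<^sub>R oct_e i)
     = (\<Sum>i\<le>p. oct_coord x i *\<^sub>R oct_e i) + (x \<bullet> \<eta>) *\<^sub>R \<eta>" by (rule trans[OF sym])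
  then have "(\<Sum>i=Suc p..7. oct_coord x i *\<^sub>R oct_e i) = (x \<bullet> \<eta>) *\<^sub>R \<eta>" by (rule add_left_imp_eq)
  then show ?thesis using l by (simp add: fueter_var_def oct_coord_inner oct.scaleR_left J_def)
qed

text \<open>Appending a letter \<open>l\<close> multiplies by \<open>c l + r J l\<close> from the right. Of the products \<open>J m J l\<close> only the symmetric part \<open>- \<delta>\<close>
survives, because \<open>\<mu>\<close> is symmetric in the letters; so the sum never leaves the span of \<open>1\<close> and the \<open>J m\<close>. Since
the coefficients are real, no associator arises.\<close>

lemma sum_words_real:
  fixes \<mu> :: "nat multiset \<Rightarrow> real"
  assumes x: "x \<in> V"
  defines "c \<equiv> \<lambda>l. x \<bullet> bas l" and "r \<equiv> x \<bullet> \<eta>"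
  shows "(\<Sum>w\<in>words n. \<mu> (mset w) *\<^sub>R zprod x w) =
     sym_re p c r n \<mu> *\<^sub>R oct_e 0 + (\<Sum>m\<le>p. sym_im p c r n (\<lambda>M. \<mu> (add_mset m M)) *\<^sub>R J m)"
proof (induction n arbitrary: \<mu>)
  case 0
  have "words 0 = {[]}" by (auto simp: words_def)
  then show ?case by (simp add: zprod_def)
next
  case (Suc n)
  let ?re = "sym_re p c r n" and ?im = "sym_im p c r n"
  let ?mu = "\<lambda>l M. \<mu> (add_mset l M)" and ?mu2 = "\<lambda>l m M. \<mu> (add_mset l (add_mset m M))"
  have sym: "?mu2 l m = ?mu2 m l" for l m by (rule ext) (simp add: add_mset_commute)
  have z: "fueter_var p l x = c l *\<^sub>R oct_e 0 + r *\<^sub>R J l" if "l \<le> p" for l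
    using fueter_var_slice[OF x that] by (simp add: c_def r_def)
  have "(\<Sum>w\<in>words (Suc n). \<mu> (mset w) *\<^sub>R zprod x w) = (\<Sum>l\<le>p. (\<Sum>w\<in>words n. ?mu l (mset w) *\<^sub>R zprod x w) \<odot> fueter_var p l x)"
    unfolding sum_words_Suc by (simp add: zprod_def oct.sum_left oct.scaleR_left)
  also have "\<dots> = (\<Sum>l\<le>p. (?re (?mu l) *\<^sub>R oct_e 0 + (\<Sum>m\<le>p. ?im (?mu2 l m) *\<^sub>R J m)) \<odot> (c l *\<^sub>R oct_e 0 + r *\<^sub>R J l))"
  proof (rule sum.cong[OF refl])
    fix l assume "l \<in> {..p}"
    then have l: "l \<le> p" by simp
    show "(\<Sum>w\<in>words n. ?mu l (mset w) *\<^sub>R zprod x w) \<odot> fueter_var p l x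
        = (?re (?mu l) *\<^sub>R oct_e 0 + (\<Sum>m\<le>p. ?im (?mu2 l m) *\<^sub>R J m)) \<odot> (c l *\<^sub>R oct_e 0 + r *\<^sub>R J l)"
      unfolding Suc.IH[of "?mu l"] z[OF l] ..
  qed
  also have "\<dots> = (\<Sum>l\<le>p. (c l * ?re (?mu l)) *\<^sub>R oct_e 0 + (r * ?re (?mu l)) *\<^sub>R J l
      + (\<Sum>m\<le>p. (c l * ?im (?mu2 l m)) *\<^sub>R J m) + (\<Sum>m\<le>p. r *\<^sub>R (J m \<odot> (J l \<odot> (?im (?mu2 l m) *\<^sub>R oct_e 0)))))"
    by (rule sum.cong)
       (simp_all add: oct.add_left oct.add_right oct.scaleR_left oct.scaleR_right oct.sum_left scaleR_sum_right scaleR_add_right mult_ac)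
  also have "\<dots> = (\<Sum>l\<le>p. c l * ?re (?mu l)) *\<^sub>R oct_e 0 + (\<Sum>l\<le>p. (r * ?re (?mu l)) *\<^sub>R J l)
      + (\<Sum>m\<le>p. (\<Sum>l\<le>p. c l * ?im (?mu2 l m)) *\<^sub>R J m) + r *\<^sub>R (\<Sum>l\<le>p. \<Sum>m\<le>p. J m \<odot> (J l \<odot> (?im (?mu2 l m) *\<^sub>R oct_e 0)))"
  proof -
    have "(\<Sum>l\<le>p. \<Sum>m\<le>p. (c l * ?im (?mu2 l m)) *\<^sub>R J m) = (\<Sum>m\<le>p. (\<Sum>l\<le>p. c l * ?im (?mu2 l m)) *\<^sub>R J m)"
      unfolding scaleR_sum_left by (rule sum.swap)
    then show ?thesis by (simp only: sum.distrib scaleR_sum_left[symmetric] scaleR_sum_right[symmetric])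
  qed
  also have "(\<Sum>l\<le>p. \<Sum>m\<le>p. J m \<odot> (J l \<odot> (?im (?mu2 l m) *\<^sub>R oct_e 0))) = - (\<Sum>l\<le>p. ?im (?mu2 l l) *\<^sub>R oct_e 0)"
    by (subst sum.swap, rule sum_J_symmetric[where X="\<lambda>m l. ?im (?mu2 l m) *\<^sub>R oct_e 0"]) (simp add: sym)
  also have "(\<Sum>l\<le>p. c l * ?re (?mu l)) *\<^sub>R oct_e 0 + (\<Sum>l\<le>p. (r * ?re (?mu l)) *\<^sub>R J l)
      + (\<Sum>m\<le>p. (\<Sum>l\<le>p. c l * ?im (?mu2 l m)) *\<^sub>R J m) + r *\<^sub>R (- (\<Sum>l\<le>p. ?im (?mu2 l l) *\<^sub>R oct_e 0))
     = ((\<Sum>l\<le>p. c l * ?re (?mu l)) - r * (\<Sum>l\<le>p. ?im (?mu2 l l))) *\<^sub>R oct_e 0 + (\<Sum>m\<le>p. ((\<Sum>l\<le>p. c l * ?im (?mu2 l m)) + r * ?re (?mu m)) *\<^sub>R J m)"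
    by (simp add: scaleR_diff_left scaleR_add_left sum.distrib scaleR_sum_left[symmetric])
  also have "\<dots> = sym_re p c r (Suc n) \<mu> *\<^sub>R oct_e 0 + (\<Sum>m\<le>p. sym_im p c r (Suc n) (\<lambda>M. \<mu> (add_mset m M)) *\<^sub>R J m)"
    using sym by simp
  finally show ?case .
qed

text \<open>The coordinates of an octonion-valued \<open>\<mu>\<close> are real, which reduces the claim to \<open>sum_words_real\<close>. The hypothesis allows
\<open>\<partial>\<^sub>\<eta>\<close> to be written for \<open>\<Sum> J l \<partial>\<^sub>l\<close>, and, used twice, it shows that \<open>\<mu>\<close> is harmonic as \<open>sym_all_harmonic\<close> requires.\<close>

lemma sum_words_oct:
  fixes \<mu> :: "nat multiset \<Rightarrow> oct"
  assumes x: "x \<in> V"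
    and CR: "\<And>M. (\<Sum>l\<le>p. J l \<odot> \<mu> (add_mset l M)) = \<mu> (add_mset (Suc p) M)"
  shows "(\<Sum>w\<in>words n. zprod x w \<odot> \<mu> (mset w)) = sym_all p (\<lambda>l. x \<bullet> bas l) (x \<bullet> \<eta>) n \<mu>"
proof -
  let ?re = "sym_re p (\<lambda>l. x \<bullet> bas l) (x \<bullet> \<eta>) n" and ?im = "sym_im p (\<lambda>l. x \<bullet> bas l) (x \<bullet> \<eta>) n"
  have lin: "linear (\<lambda>v::oct. v \<bullet> b)" for b by (rule bounded_linear.linear[OF bounded_linear_inner_left])
  have re_b: "sym_re p (\<lambda>l. x \<bullet> bas l) (x \<bullet> \<eta>) n (\<lambda>M. \<mu> M \<bullet> b) = ?re \<mu> \<bullet> b"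
    and im_b: "sym_im p (\<lambda>l. x \<bullet> bas l) (x \<bullet> \<eta>) n (\<lambda>M. \<nu> M \<bullet> b) = ?im \<nu> \<bullet> b" for b and \<nu> :: "nat multiset \<Rightarrow> oct"
    by (rule sym_linear[OF lin])+
  have "(\<Sum>w\<in>words n. zprod x w \<odot> \<mu> (mset w)) = (\<Sum>w\<in>words n. \<Sum>b\<in>Basis. ((\<mu> (mset w) \<bullet> b) *\<^sub>R zprod x w) \<odot> b)"
  proof (rule sum.cong[OF refl])
    fix w
    have "zprod x w \<odot> \<mu> (mset w) = zprod x w \<odot> (\<Sum>b\<in>Basis. (\<mu> (mset w) \<bullet> b) *\<^sub>R b)" by (simp add: euclidean_representation)
    then show "zprod x w \<odot> \<mu> (mset w) = (\<Sum>b\<in>Basis. ((\<mu> (mset w) \<bullet> b) *\<^sub>R zprod x w) \<odot> b)"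
      by (simp add: oct.sum_right oct.scaleR_left oct.scaleR_right)
  qed
  also have "\<dots> = (\<Sum>b\<in>Basis. (\<Sum>w\<in>words n. (\<mu> (mset w) \<bullet> b) *\<^sub>R zprod x w) \<odot> b)"
    by (subst sum.swap) (simp add: oct.sum_left)
  also have "\<dots> = (\<Sum>b\<in>Basis. (?re \<mu> \<bullet> b) *\<^sub>R b + (\<Sum>m\<le>p. J m \<odot> ((?im (\<lambda>M. \<mu> (add_mset m M)) \<bullet> b) *\<^sub>R b)))"
  proof (rule sum.cong[OF refl])
    fix b :: oct
    show "(\<Sum>w\<in>words n. (\<mu> (mset w) \<bullet> b) *\<^sub>R zprod x w) \<odot> b
        = (?re \<mu> \<bullet> b) *\<^sub>R b + (\<Sum>m\<le>p. J m \<odot> ((?im (\<lambda>M. \<mu> (add_mset m M)) \<bullet> b) *\<^sub>R b))"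
      unfolding sum_words_real[OF x, of "\<lambda>M. \<mu> M \<bullet> b"] re_b im_b
      by (simp add: oct.add_left oct.scaleR_left oct.scaleR_right oct.sum_left)
  qed
  also have "\<dots> = ?re \<mu> + (\<Sum>m\<le>p. J m \<odot> ?im (\<lambda>M. \<mu> (add_mset m M)))"
  proof -
    have "(\<Sum>b\<in>Basis. \<Sum>m\<le>p. J m \<odot> ((?im (\<lambda>M. \<mu> (add_mset m M)) \<bullet> b) *\<^sub>R b)) = (\<Sum>m\<le>p. J m \<odot> ?im (\<lambda>M. \<mu> (add_mset m M)))"
      by (subst sum.swap) (simp add: oct.sum_right[symmetric] euclidean_representation)
    then show ?thesis by (simp add: sum.distrib euclidean_representation)
  qed
  also have "(\<Sum>m\<le>p. J m \<odot> ?im (\<lambda>M. \<mu> (add_mset m M))) = ?im (\<lambda>M. \<mu> (add_mset (Suc p) M))"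
  proof -
    have "?im (\<lambda>M. J m \<odot> \<mu> (add_mset m M)) = J m \<odot> ?im (\<lambda>M. \<mu> (add_mset m M))" for m
      by (rule sym_linear(2)[OF bounded_linear.linear[OF oct.bounded_linear_right]])
    then show ?thesis unfolding CR[symmetric] sym_sum by simp
  qed
  also have "?re \<mu> + ?im (\<lambda>M. \<mu> (add_mset (Suc p) M)) = sym_all p (\<lambda>l. x \<bullet> bas l) (x \<bullet> \<eta>) n \<mu>"
  proof (rule sym_all_harmonic[symmetric])
    fix M
    have "\<mu> (add_mset (Suc p) (add_mset (Suc p) M)) = (\<Sum>l\<le>p. J l \<odot> \<mu> (add_mset l (add_mset (Suc p) M)))"
      by (rule CR[symmetric])
    also have "\<dots> = (\<Sum>l\<le>p. J l \<odot> \<mu> (add_mset (Suc p) (add_mset l M)))"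
      by (rule sum.cong[OF refl], rule arg_cong[where f="\<lambda>N. J _ \<odot> \<mu> N"], rule add_mset_commute)
    also have "\<dots> = (\<Sum>l\<le>p. J l \<odot> (\<Sum>m\<le>p. J m \<odot> \<mu> (add_mset m (add_mset l M))))"
      by (simp only: CR)
    also have "\<dots> = (\<Sum>l\<le>p. \<Sum>m\<le>p. J l \<odot> (J m \<odot> \<mu> (add_mset m (add_mset l M))))" by (simp add: oct.sum_right)
    also have "\<dots> = - (\<Sum>l\<le>p. \<mu> (add_mset l (add_mset l M)))"
      by (rule sum_J_symmetric) (simp add: add_mset_commute)
    finally show "\<mu> (add_mset (Suc p) (add_mset (Suc p) M)) = - (\<Sum>l\<le>p. \<mu> (add_mset l (add_mset l M)))" .
  qed
  finally show ?thesis .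
qed

text \<open>The letters are sorted only in order to single out one word for each multiset.\<close>

definition partials :: "(oct \<Rightarrow> oct) \<Rightarrow> oct \<Rightarrow> nat multiset \<Rightarrow> oct" where
  "partials G y M = word_deriv (map bas (sorted_list_of_multiset M)) G y"

lemma partials_word: "kernel G \<Longrightarrow> y \<noteq> 0 \<Longrightarrow> word_deriv (map bas w) G y = partials G y (mset w)"
  unfolding partials_def by (rule word_deriv_mset) simp_all

lemma partials_add: "kernel G \<Longrightarrow> y \<noteq> 0 \<Longrightarrow> partials G y (add_mset i M) = partials (dir_deriv (bas i) G) y M"
  using partials_word[of G y "sorted_list_of_multiset M @ [i]"] by (simp add: partials_def)

lemma partials_add': "kernel G \<Longrightarrow> y \<noteq> 0 \<Longrightarrow> partials G y (add_mset i M) = dir_deriv (bas i) (word_deriv (map bas (sorted_list_of_multiset M)) G) y"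
  using partials_word[of G y "i # sorted_list_of_multiset M"] by (simp add: partials_def)

lemma radial_deriv_sym_all:
  assumes x: "x \<in> V" and G: "kernel G" and y: "y \<noteq> 0"
  shows "word_deriv (replicate n x) G y = sym_all p (\<lambda>l. x \<bullet> bas l) (x \<bullet> \<eta>) n (partials G y)"
  using G
proof (induction n arbitrary: G)
  case 0
  then show ?case by (simp add: partials_def)
next
  case (Suc n)
  let ?H = "word_deriv (replicate n x) G"
  have kH: "kernel ?H" by (rule kernel_word_deriv[OF Suc.prems])
  note lin = bounded_linear.linear[OF kernel_dir_deriv_linear[OF kH y]]
  have "word_deriv (replicate (Suc n) x) G y = dir_deriv x ?H y" by simp
  also have "\<dots> = dir_deriv (\<Sum>i\<le>Suc p. (x \<bullet> bas i) *\<^sub>R bas i) ?H y" using V_expand[OF x] by simp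
  also have "\<dots> = (\<Sum>i\<le>Suc p. (x \<bullet> bas i) *\<^sub>R dir_deriv (bas i) ?H y)"
    by (simp only: linear_sum[OF lin] linear_cmul[OF lin])
  also have "\<dots> = (\<Sum>i\<le>Suc p. (x \<bullet> bas i) *\<^sub>R sym_all p (\<lambda>l. x \<bullet> bas l) (x \<bullet> \<eta>) n (\<lambda>M. partials G y (add_mset i M)))"
  proof (rule sum.cong[OF refl])
    fix i
    have "dir_deriv (bas i) ?H y = word_deriv (bas i # replicate n x) G y" by simp
    also have "\<dots> = word_deriv (replicate n x @ [bas i]) G y"
      by (rule word_deriv_mset[OF Suc.prems _ y]) simp
    also have "\<dots> = word_deriv (replicate n x) (dir_deriv (bas i) G) y" by simp
    also have "\<dots> = sym_all p (\<lambda>l. x \<bullet> bas l) (x \<bullet> \<eta>) n (partials (dir_deriv (bas i) G) y)"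
      by (rule Suc.IH[OF kernel_dir_deriv[OF Suc.prems]])
    also have "partials (dir_deriv (bas i) G) y = (\<lambda>M. partials G y (add_mset i M))"
      by (rule ext) (simp add: partials_add[OF Suc.prems y])
    finally show "(x \<bullet> bas i) *\<^sub>R dir_deriv (bas i) ?H y = (x \<bullet> bas i) *\<^sub>R sym_all p (\<lambda>l. x \<bullet> bas l) (x \<bullet> \<eta>) n (\<lambda>M. partials G y (add_mset i M))" by simp
  qed
  also have "\<dots> = sym_all p (\<lambda>l. x \<bullet> bas l) (x \<bullet> \<eta>) (Suc n) (partials G y)"
    by (simp add: sum.atMost_Suc)
  finally show ?case .
qed

lemma partials_CR:
  assumes G: "kernel G" "slice_CR G" and y: "y \<in> V" "y \<noteq> 0"
  shows "(\<Sum>l\<le>p. J l \<odot> partials G y (add_mset l M)) = partials G y (add_mset (Suc p) M)"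
proof -
  have "slice_CR (word_deriv (map bas (sorted_list_of_multiset M)) G)"
    by (rule slice_CR_word_deriv[OF G]) (auto intro: bas_in_V)
  then show ?thesis using y by (simp add: slice_CR_def partials_add'[OF G(1) y(2)])
qed

lemma count_index_list: "count (mset (index_list p k)) i = (if i \<le> p then k i else 0)"
proof -
  have "count (mset (concat (map (\<lambda>l. replicate (k l) l) ls))) i = (if i \<in> set ls then k i else 0)" if "distinct ls" for ls
    using that by (induction ls) (auto simp: not_in_iff)
  from this[of "[0..<Suc p]"] show ?thesis by (simp add: index_list_def less_Suc_eq_le del: upt_Suc)
qed

text \<open>Words of length \<open>n\<close> are classified by the number of occurrences of each letter.\<close>

lemma sum_multi_indices_words:
  "(\<Sum>k\<in>multi_indices p n. \<Sum>is\<in>permutations_of_multiset (mset (index_list p k)). F is) = (\<Sum>w\<in>words n. F w)"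
proof -
  have len: "length w = (\<Sum>i\<le>p. count (mset w) i)" if "set w \<subseteq> {..p}" for w
  proof -
    have "size (mset w) = (\<Sum>i\<in>set w. count (mset w) i)" by (simp add: size_multiset_overloaded_eq)
    also have "\<dots> = (\<Sum>i\<le>p. count (mset w) i)"
      by (rule sum.mono_neutral_left) (use that in \<open>auto simp: not_in_iff\<close>)
    finally show ?thesis by simp
  qed
  have inMI: "count (mset w) \<in> multi_indices p n" if "w \<in> words n" for w
    using that len[of w] by (auto simp: multi_indices_def words_def count_eq_zero_iff)
  have ms: "mset (index_list p (count (mset w))) = mset w" if "w \<in> words n" for w
    using that by (intro multiset_eqI) (auto simp: count_index_list words_def count_eq_zero_iff)
  have perm_words: "is \<in> words n" if "k \<in> multi_indices p n" "is \<in> permutations_of_multiset (mset (index_list p k))" for k "is"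
  proof -
    have m: "mset is = mset (index_list p k)" using that by (simp add: permutations_of_multiset_def)
    have s: "set is \<subseteq> {..p}"
    proof
      fix i assume "i \<in> set is"
      then have "count (mset is) i \<noteq> 0" by (simp add: count_eq_zero_iff)
      then show "i \<in> {..p}" unfolding m count_index_list by (auto split: if_splits)
    qed
    have "length is = n" unfolding len[OF s] m count_index_list using that by (simp add: multi_indices_def)
    then show ?thesis using s by (simp add: words_def)
  qed
  have ne: "index_list p k \<in> permutations_of_multiset (mset (index_list p k))" for k by (simp add: permutations_of_multiset_def)
  have kcount: "count (mset (index_list p k)) = k" if "k \<in> multi_indices p n" for k
    using that by (auto simp: count_index_list multi_indices_def)
  have "multi_indices p n = (\<lambda>w. count (mset w)) ` words n"
  proof
    show "multi_indices p n \<subseteq> (\<lambda>w. count (mset w)) ` words n"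
    proof
      fix k assume "k \<in> multi_indices p n"
      then show "k \<in> (\<lambda>w. count (mset w)) ` words n"
        using kcount perm_words[OF _ ne] by (intro image_eqI[of _ _ "index_list p k"]) auto
    qed
  qed (use inMI in auto)
  then have fin: "finite (multi_indices p n)" using finite_words by simp
  have U: "words n = (\<Union>k\<in>multi_indices p n. permutations_of_multiset (mset (index_list p k)))"
  proof
    show "words n \<subseteq> (\<Union>k\<in>multi_indices p n. permutations_of_multiset (mset (index_list p k)))"
    proof
      fix w assume "w \<in> words n"
      then show "w \<in> (\<Union>k\<in>multi_indices p n. permutations_of_multiset (mset (index_list p k)))"
        using inMI ms by (intro UN_I[of "count (mset w)"]) (auto simp: permutations_of_multiset_def)
    qed
  qed (use perm_words in auto)
  show "(\<Sum>k\<in>multi_indices p n. \<Sum>is\<in>permutations_of_multiset (mset (index_list p k)). F is) = (\<Sum>w\<in>words n. F w)"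
    unfolding U
  proof (rule sum.UNION_disjoint[symmetric])
    show "\<forall>k\<in>multi_indices p n. \<forall>k'\<in>multi_indices p n. k \<noteq> k' \<longrightarrow>
      permutations_of_multiset (mset (index_list p k)) \<inter> permutations_of_multiset (mset (index_list p k')) = {}"
    proof (intro ballI impI)
      fix k k' assume k: "k \<in> multi_indices p n" "k' \<in> multi_indices p n" "k \<noteq> k'"
      then have "mset (index_list p k) \<noteq> mset (index_list p k')" using kcount by metis
      then show "permutations_of_multiset (mset (index_list p k)) \<inter> permutations_of_multiset (mset (index_list p k')) = {}"
        by (auto simp: permutations_of_multiset_def)
    qed
  qed (use fin in auto)
qed

lemma index_list_le: "set (index_list p k) \<subseteq> {..p}"
  by (auto simp: index_list_def)

lemma map_bas_index_list: "map oct_e (index_list p k) = map bas (index_list p k)"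
  using index_list_le[of k] by (auto intro!: map_cong)

text \<open>Written out over words, the left side is the sum treated in \<open>sum_words_oct\<close>, with the partial derivatives of the Cauchy kernel
as coefficients.\<close>

theorem fueter_sum:
  assumes x: "x \<in> V" and y: "y \<in> V" "y \<noteq> 0"
  shows "(\<Sum>k\<in>multi_indices p n. fueter_poly p k x \<odot> cauchy_kernel_deriv p k y) =
    ((- 1) ^ n / fact n) *\<^sub>R word_deriv (replicate n x) (cauchy_kernel p) y"
proof -
  let ?mu = "partials (cauchy_kernel p) y"
  have "fueter_poly p k x \<odot> cauchy_kernel_deriv p k y =
     ((- 1) ^ n / fact n) *\<^sub>R (\<Sum>is\<in>permutations_of_multiset (mset (index_list p k)). zprod x is \<odot> ?mu (mset is))"
    if k: "k \<in> multi_indices p n" for k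
  proof -
    have kn: "(\<Sum>i\<le>p. k i) = n" using k by (simp add: multi_indices_def)
    have "cauchy_kernel_deriv p k y = (- 1) ^ n *\<^sub>R ?mu (mset (index_list p k))"
      unfolding cauchy_kernel_deriv_def kn multi_deriv_word map_bas_index_list
      by (simp add: partials_word[OF cauchy_kernel_kernel y(2)])
    moreover have "fueter_poly p k x = (1 / fact n) *\<^sub>R (\<Sum>is\<in>permutations_of_multiset (mset (index_list p k)). zprod x is)"
      unfolding fueter_poly_def kn zprod_def ..
    moreover have "(\<Sum>is\<in>permutations_of_multiset (mset (index_list p k)). zprod x is) \<odot> ?mu (mset (index_list p k))
       = (\<Sum>is\<in>permutations_of_multiset (mset (index_list p k)). zprod x is \<odot> ?mu (mset is))"
      unfolding oct.sum_left by (rule sum.cong) (auto simp: permutations_of_multiset_def)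
    ultimately show ?thesis by (simp add: oct.scaleR_left oct.scaleR_right)
  qed
  then have "(\<Sum>k\<in>multi_indices p n. fueter_poly p k x \<odot> cauchy_kernel_deriv p k y) =
     ((- 1) ^ n / fact n) *\<^sub>R (\<Sum>k\<in>multi_indices p n. \<Sum>is\<in>permutations_of_multiset (mset (index_list p k)). zprod x is \<odot> ?mu (mset is))"
    by (simp add: scaleR_sum_right)
  also have "\<dots> = ((- 1) ^ n / fact n) *\<^sub>R sym_all p (\<lambda>l. x \<bullet> bas l) (x \<bullet> \<eta>) n ?mu"
    unfolding sum_multi_indices_words
    by (subst sum_words_oct[OF x partials_CR[OF cauchy_kernel_kernel slice_CR_cauchy_kernel y]]) simp
  finally show ?thesis unfolding radial_deriv_sym_all[OF x cauchy_kernel_kernel y(2)] .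
qed

end

section \<open>The Taylor expansion\<close>

context oct_slice
begin

lemma norm_Y_mono: "(\<And>i. i \<le> Suc p \<Longrightarrow> \<bar>u i\<bar> \<le> \<bar>v i\<bar>) \<Longrightarrow> norm (Y u) \<le> norm (Y v)"
proof -
  assume "\<And>i. i \<le> Suc p \<Longrightarrow> \<bar>u i\<bar> \<le> \<bar>v i\<bar>"
  then have "(norm (Y u))\<^sup>2 \<le> (norm (Y v))\<^sup>2"
    unfolding norm_Y_sq by (intro sum_mono) (simp add: abs_le_square_iff)
  then show ?thesis by (rule power2_le_imp_le) simp
qed

text \<open>The points \<open>P j\<close> lead from \<open>y0\<close> to \<open>y\<close> by changing one coordinate at a time. All segments on the way stay within distance
\<open>|y - y0|\<close> of \<open>y0\<close>, as the coordinates are orthonormal.\<close>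

lemma partial_increment_bound:
  fixes f :: "oct \<Rightarrow> oct"
  assumes y0: "y0 \<in> V" and y: "y \<in> V"
    and deriv: "\<And>i z. i \<le> Suc p \<Longrightarrow> z \<in> V \<Longrightarrow> norm (z - y0) \<le> norm (y - y0) \<Longrightarrow> ((\<lambda>t. f (z + t *\<^sub>R bas i)) has_vector_derivative df i z) (at 0)"
    and bound: "\<And>i z. i \<le> Suc p \<Longrightarrow> z \<in> V \<Longrightarrow> norm (z - y0) \<le> norm (y - y0) \<Longrightarrow> norm (df i z) \<le> B"
  shows "norm (f y - f y0) \<le> real (p + 2) * (3 * B * norm (y - y0))"
proof -
  define P where "P j = Y (\<lambda>i. if i < j then y \<bullet> bas i else y0 \<bullet> bas i)" for j
  have P0: "P 0 = y0" using Y_coords[OF y0] by (simp add: P_def)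
  have Pn: "P (p + 2) = y"
  proof -
    have "P (p + 2) = Y (\<lambda>i. y \<bullet> bas i)" unfolding P_def by (rule Y_cong) auto
    then show ?thesis using Y_coords[OF y] by simp
  qed
  have yy0: "Y (\<lambda>i. (y - y0) \<bullet> bas i) = y - y0" by (rule Y_coords[OF V_diff[OF y y0]])
  have step: "norm (f (P (Suc j)) - f (P j)) \<le> 3 * B * norm (y - y0)" if j: "j \<le> Suc p" for j
  proof -
    define \<tau> where "\<tau> = (y - y0) \<bullet> bas j"
    have B0: "0 \<le> B" using order_trans[OF norm_ge_zero bound[of 0 y0]] y0 by simp
    have \<tau>: "\<bar>\<tau>\<bar> \<le> norm (y - y0)"
      using Cauchy_Schwarz_ineq2[of "y - y0" "bas j"] norm_bas[OF j] by (simp add: \<tau>_def)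
    have PS: "P (Suc j) = P j + \<tau> *\<^sub>R bas j"
    proof -
      have "P (Suc j) = Y ((\<lambda>i. if i < j then y \<bullet> bas i else y0 \<bullet> bas i)(j := y0 \<bullet> bas j + \<tau>))"
        unfolding P_def by (rule Y_cong) (auto simp: \<tau>_def inner_diff_left)
      also have "\<dots> = Y ((\<lambda>i. if i < j then y \<bullet> bas i else y0 \<bullet> bas i)(j := y0 \<bullet> bas j)) + \<tau> *\<^sub>R bas j"
        using Y_upd[OF j, of _ "y0 \<bullet> bas j + \<tau>"] Y_upd[OF j, of _ "y0 \<bullet> bas j"] by (simp add: scaleR_add_left)
      also have "Y ((\<lambda>i. if i < j then y \<bullet> bas i else y0 \<bullet> bas i)(j := y0 \<bullet> bas j)) = P j"
        unfolding P_def by (rule Y_cong) auto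
      finally show ?thesis .
    qed
    have near: "norm (P j + s *\<^sub>R bas j - y0) \<le> norm (y - y0)" and inV: "P j + s *\<^sub>R bas j \<in> V" if "\<bar>s\<bar> \<le> \<bar>\<tau>\<bar>" for s
    proof -
      let ?u = "\<lambda>i. if i < j then (y - y0) \<bullet> bas i else if i = j then s else 0"
      show V: "P j + s *\<^sub>R bas j \<in> V" unfolding P_def by (intro V_add V_scale Y_in_V bas_in_V)
      have "P j + s *\<^sub>R bas j - y0 = Y (\<lambda>i. (P j + s *\<^sub>R bas j - y0) \<bullet> bas i)"
        by (rule Y_coords[symmetric]) (rule V_diff[OF V y0])
      also have "\<dots> = Y ?u"
        by (rule Y_cong) (auto simp: P_def inner_diff_left inner_add_left Y_inner_bas bas_inner j)
      finally have "P j + s *\<^sub>R bas j - y0 = Y ?u" .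
      then show "norm (P j + s *\<^sub>R bas j - y0) \<le> norm (y - y0)"
        using norm_Y_mono[of ?u "\<lambda>i. (y - y0) \<bullet> bas i"] that unfolding yy0 \<tau>_def by auto
    qed
    have seg: "\<bar>s\<bar> \<le> \<bar>\<tau>\<bar>" if "s \<in> closed_segment 0 \<tau>" for s
      using that by (auto simp: closed_segment_eq_real_ivl split: if_splits)
    \<comment> \<open>The derivative along the segment differs by at most \<open>2 B\<close> from its initial value, which is itself bounded by \<open>B\<close>.\<close>
    have "norm (f (P j + \<tau> *\<^sub>R bas j) - f (P j + 0 *\<^sub>R bas j) - (\<tau> - 0) *\<^sub>R df j (P j + 0 *\<^sub>R bas j)) \<le> norm (\<tau> - 0) * (2 * B)"
    proof (rule vector_differentiable_bound_linearization[where S="closed_segment 0 \<tau>" and f="\<lambda>s. f (P j + s *\<^sub>R bas j)" and f'="\<lambda>s. df j (P j + s *\<^sub>R bas j)"])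
      fix s assume s: "s \<in> closed_segment 0 \<tau>"
      show "((\<lambda>s. f (P j + s *\<^sub>R bas j)) has_vector_derivative df j (P j + s *\<^sub>R bas j)) (at s within closed_segment 0 \<tau>)"
        by (rule has_vector_derivative_at_within, rule has_vector_derivative_shift_line[of f "P j" s "bas j"], rule deriv[OF j inV[OF seg[OF s]] near[OF seg[OF s]]])
      have "norm (df j (P j + s *\<^sub>R bas j) - df j (P j + 0 *\<^sub>R bas j)) \<le> norm (df j (P j + s *\<^sub>R bas j)) + norm (df j (P j + 0 *\<^sub>R bas j))"
        by (rule norm_triangle_ineq4)
      also have "\<dots> \<le> B + B"
        by (intro add_mono bound j inV near) (use seg[OF s] in auto)
      finally show "norm (df j (P j + s *\<^sub>R bas j) - df j (P j + 0 *\<^sub>R bas j)) \<le> 2 * B" by simp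
    qed auto
    then have 1: "norm (f (P (Suc j)) - f (P j) - \<tau> *\<^sub>R df j (P j)) \<le> \<bar>\<tau>\<bar> * (2 * B)" by (simp add: PS)
    have 2: "norm (\<tau> *\<^sub>R df j (P j)) \<le> \<bar>\<tau>\<bar> * B"
      using bound[OF j inV[of 0] near[of 0]] by (simp add: mult_left_mono)
    have "norm (f (P (Suc j)) - f (P j)) \<le> norm (f (P (Suc j)) - f (P j) - \<tau> *\<^sub>R df j (P j)) + norm (\<tau> *\<^sub>R df j (P j))"
      using norm_triangle_ineq[of "f (P (Suc j)) - f (P j) - \<tau> *\<^sub>R df j (P j)" "\<tau> *\<^sub>R df j (P j)"] by simp
    also have "\<dots> \<le> \<bar>\<tau>\<bar> * (3 * B)" using 1 2 by (simp add: algebra_simps)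
    also have "\<dots> \<le> norm (y - y0) * (3 * B)" using \<tau> B0 by (intro mult_right_mono) auto
    finally show ?thesis by (simp add: mult_ac)
  qed
  have "f y - f y0 = (\<Sum>j<p + 2. f (P (Suc j)) - f (P j))"
    using sum_lessThan_telescope[of "\<lambda>j. f (P j)" "p + 2"] P0 Pn by simp
  also have "norm \<dots> \<le> (\<Sum>j<p + 2. 3 * B * norm (y - y0))"
    by (rule sum_norm_le) (use step in auto)
  finally show ?thesis by simp
qed

lemma continuous_from_partials:
  fixes f :: "oct \<Rightarrow> oct"
  assumes deriv: "\<And>i z. i \<le> Suc p \<Longrightarrow> z \<in> V \<Longrightarrow> norm z < \<rho> \<Longrightarrow> ((\<lambda>t. f (z + t *\<^sub>R bas i)) has_vector_derivative df i z) (at 0)"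
    and cont: "\<And>i. i \<le> Suc p \<Longrightarrow> continuous_on (V \<inter> ball 0 \<rho>) (df i)"
  shows "continuous_on (V \<inter> ball 0 \<rho>) f"
  unfolding continuous_on_iff
proof (intro ballI allI impI)
  fix y0 and e :: real assume "y0 \<in> V \<inter> ball 0 \<rho>" and e: "e > 0"
  then have y0: "y0 \<in> V" "norm y0 < \<rho>" by auto
  define d where "d = (\<rho> - norm y0) / 2"
  have d: "d > 0" using y0 by (simp add: d_def)
  let ?C = "V \<inter> cball y0 d"
  have inball: "norm z < \<rho>" if "norm (z - y0) \<le> d" for z
  proof -
    have "norm z \<le> norm y0 + norm (z - y0)" using norm_triangle_sub[of z y0] by simp
    also have "\<dots> < \<rho>" using that y0 by (simp add: d_def)
    finally show ?thesis .
  qed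
  have C: "compact ?C" by (rule closed_Int_compact) auto
  have sub: "?C \<subseteq> V \<inter> ball 0 \<rho>"
    using inball by (auto simp: dist_norm norm_minus_commute)
  have "\<forall>i\<in>{..Suc p}. \<exists>B. \<forall>z\<in>?C. norm (df i z) \<le> B"
    using continuous_compact_bound[OF C continuous_on_subset[OF cont sub]] by blast
  then obtain b where b: "\<And>i z. i \<le> Suc p \<Longrightarrow> z \<in> ?C \<Longrightarrow> norm (df i z) \<le> b i" by (metis atMost_iff)
  define B where "B = (\<Sum>i\<le>Suc p. \<bar>b i\<bar>)"
  have B: "norm (df i z) \<le> B" if "i \<le> Suc p" "z \<in> ?C" for i z
  proof -
    have "norm (df i z) \<le> \<bar>b i\<bar>" using b[OF that] by linarith
    also have "\<dots> \<le> B" unfolding B_def by (rule member_le_sum) (use that in auto)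
    finally show ?thesis .
  qed
  have B0: "B \<ge> 0" by (simp add: B_def sum_nonneg)
  define L where "L = real (p + 2) * (3 * B)"
  have L: "L \<ge> 0" using B0 by (simp add: L_def)
  show "\<exists>\<delta>>0. \<forall>y\<in>V \<inter> ball 0 \<rho>. dist y y0 < \<delta> \<longrightarrow> dist (f y) (f y0) < e"
  proof (intro exI[of _ "min d (e / (L + 1))"] conjI ballI impI)
    show "min d (e / (L + 1)) > 0" using d e L by simp
    fix y assume y: "y \<in> V \<inter> ball 0 \<rho>" and dist: "dist y y0 < min d (e / (L + 1))"
    then have n: "norm (y - y0) < d" "norm (y - y0) < e / (L + 1)" by (auto simp: dist_norm)
    have "norm (f y - f y0) \<le> real (p + 2) * (3 * B * norm (y - y0))"
    proof (rule partial_increment_bound[where df=df])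
      show "y0 \<in> V" "y \<in> V" using y0 y by auto
      fix i z assume z: "i \<le> Suc p" "z \<in> V" "norm (z - y0) \<le> norm (y - y0)"
      then have zd: "norm (z - y0) \<le> d" using n by simp
      show "((\<lambda>t. f (z + t *\<^sub>R bas i)) has_vector_derivative df i z) (at 0)" by (rule deriv[OF z(1,2) inball[OF zd]])
      show "norm (df i z) \<le> B" by (rule B) (use z zd in \<open>auto simp: dist_norm norm_minus_commute\<close>)
    qed
    also have "\<dots> = L * norm (y - y0)" by (simp add: L_def)
    also have "\<dots> \<le> (L + 1) * norm (y - y0)" by (intro mult_right_mono) auto
    also have "\<dots> < e" using n(2) L by (simp add: field_simps)
    finally show "dist (f y) (f y0) < e" by (simp add: dist_norm)
  qed
qed

end

context slice_ball
begin

lemma monogenic_of_gps_monogenic: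
  assumes f: "gps_monogenic p (ball 0 \<rho>) f" and \<rho>: "R < \<rho>"
  shows "monogenic f (\<lambda>i. dir_deriv (bas i) f)"
proof -
  have sl: "slice p \<eta> (ball 0 \<rho>) = V \<inter> ball 0 \<rho>" by (auto simp: slice_def V_def)
  have C1: "C1_on_slice p \<eta> (ball 0 \<rho>) f"
    and eq: "\<And>y. y \<in> V \<inter> ball 0 \<rho> \<Longrightarrow> (\<Sum>i\<le>p. oct_e i \<odot> dir_deriv (oct_e i) f y) + \<eta> \<odot> dir_deriv \<eta> f y = 0"
    using f[unfolded gps_monogenic_def, THEN conjunct2, THEN conjunct2, rule_format, OF eta] unfolding sl by blast+
  have b: "bas i \<in> insert \<eta> (oct_e ` {..p})" for i by (auto simp: bas_def)
  have d: "((\<lambda>t. f (y + t *\<^sub>R bas i)) has_vector_derivative dir_deriv (bas i) f y) (at 0)" if "y \<in> V" "norm y < \<rho>" for i y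
  proof -
    have "(\<lambda>t::real. f (y + t *\<^sub>R bas i)) differentiable (at 0)"
      using C1 b[of i] that unfolding C1_on_slice_def sl by auto
    then show ?thesis unfolding dir_deriv_def by (simp add: vector_derivative_works)
  qed
  have c: "continuous_on (V \<inter> ball 0 \<rho>) (dir_deriv (bas i) f)" for i
    using C1 b[of i] unfolding C1_on_slice_def sl by blast
  have fc: "continuous_on (V \<inter> ball 0 \<rho>) f"
    by (rule continuous_from_partials[OF d c])
  have KBs: "KB \<subseteq> V \<inter> ball 0 \<rho>" using \<rho> by (auto simp: KB_def)
  show ?thesis
    unfolding monogenic_def
  proof (intro conjI allI impI ballI)
    show "continuous_on KB f" by (rule continuous_on_subset[OF fc KBs])
    show "continuous_on KB (dir_deriv (bas i) f)" for i by (rule continuous_on_subset[OF c KBs])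
    show "((\<lambda>t. f (y + t *\<^sub>R bas i)) has_vector_derivative dir_deriv (bas i) f y) (at 0)" if "y \<in> KB" for i y
      by (rule d) (use that \<rho> in \<open>auto simp: KB_def\<close>)
    show "(\<Sum>i\<le>Suc p. bas i \<odot> dir_deriv (bas i) f y) = 0" if "y \<in> KB" for y
      using eq[OF subsetD[OF KBs that]] by (simp add: sum.atMost_Suc)
  qed
qed

text \<open>Each derivative of \<open>f\<close> falls on the kernel and produces a sign, since the kernel depends on \<open>y - z\<close>.\<close>

lemma word_deriv_cauchy:
  assumes f: "monogenic f df" and ws: "set ws \<subseteq> {..p}" and z: "z \<in> V" "norm z < R"
  shows "word_deriv (map oct_e ws) f z =
    (- 1) ^ length ws *\<^sub>R S (\<lambda>y. word_deriv (map oct_e ws) (cauchy_kernel p) (y - z) \<odot> ((y /\<^sub>R R) \<odot> f y))"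
  using ws z
proof (induction ws arbitrary: z)
  case Nil
  then show ?case using cauchy_formula[OF f, of z] by simp
next
  case (Cons i ws)
  let ?H = "word_deriv (map oct_e ws) f" and ?G = "word_deriv (map oct_e ws) (cauchy_kernel p)"
  let ?F = "\<lambda>y. (y /\<^sub>R R) \<odot> f y"
  have i: "i \<le> p" and ws: "set ws \<subseteq> {..p}" using Cons.prems by auto
  have "continuous_on K f" using f continuous_on_subset[OF _ K_subset_KB] by (auto simp: monogenic_def)
  then have Fc: "continuous_on K ?F" by (intro oct.continuous_on continuous_intros)
  have G: "kernel ?G" by (rule kernel_word_deriv[OF cauchy_kernel_kernel])
  have ev: "eventually (\<lambda>t. t \<in> UNIV \<longrightarrow> ?H (z + t *\<^sub>R oct_e i) = (- 1) ^ length ws *\<^sub>R S (\<lambda>y. ?G (y - (z + t *\<^sub>R oct_e i)) \<odot> ?F y)) (nhds (0::real))"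
  proof -
    have "((\<lambda>t. norm (z + t *\<^sub>R oct_e i)) \<longlongrightarrow> norm (z + 0 *\<^sub>R oct_e i)) (nhds (0::real))"
      by (intro tendsto_intros filterlim_ident)
    then have "eventually (\<lambda>t. norm (z + t *\<^sub>R oct_e i) < R) (nhds (0::real))"
      using Cons.prems by (intro order_tendstoD(2)) auto
    then show ?thesis
    proof eventually_elim
      case (elim t)
      have "oct_e i \<in> V" using bas_in_V[of i] i by simp
      then have "z + t *\<^sub>R oct_e i \<in> V" using Cons.prems by (intro V_add V_scale) auto
      then show ?case using Cons.IH[OF ws _ elim] by blast
    qed
  qed
  have "dir_deriv (oct_e i) ?H z = vector_derivative (\<lambda>t. (- 1) ^ length ws *\<^sub>R S (\<lambda>y. ?G (y - (z + t *\<^sub>R oct_e i)) \<odot> ?F y)) (at 0)"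
    unfolding dir_deriv_def[of "oct_e i" ?H z] by (rule vector_derivative_cong_eq[OF ev]) auto
  also have "\<dots> = (- 1) ^ length ws *\<^sub>R (- S (\<lambda>y. dir_deriv (oct_e i) ?G (y - z) \<odot> ?F y))"
    by (rule vector_derivative_at, rule bounded_linear.has_vector_derivative[OF bounded_linear_scaleR_right kernel_integral_deriv[OF G Fc Cons.prems(3)]])
  finally show ?case by simp
qed

lemma multi_deriv_cauchy:
  assumes f: "monogenic f df" and k: "k \<in> multi_indices p n"
  shows "multi_deriv p k f 0 = S (\<lambda>y. cauchy_kernel_deriv p k y \<odot> ((y /\<^sub>R R) \<odot> f y))"
proof -
  let ?w = "index_list p k"
  let ?F = "\<lambda>y. (y /\<^sub>R R) \<odot> f y"
  have "length ?w = (\<Sum>i\<le>p. k i)"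
    by (simp add: index_list_def length_concat o_def sum_list_distinct_conv_sum_set atLeast0LessThan lessThan_Suc_atMost del: upt_Suc)
  then have len: "length ?w = n" "(\<Sum>i\<le>p. k i) = n" using k by (auto simp: multi_indices_def)
  have "continuous_on K f" using f continuous_on_subset[OF _ K_subset_KB] by (auto simp: monogenic_def)
  then have Fc: "continuous_on K ?F" by (intro oct.continuous_on continuous_intros)
  have Gc: "continuous_on K (\<lambda>y. word_deriv (map oct_e ?w) (cauchy_kernel p) (y - 0))"
    by (rule kernel_shift_continuous) (use R_pos in \<open>auto intro: kernel_word_deriv cauchy_kernel_kernel\<close>)
  have "multi_deriv p k f 0 = (- 1) ^ n *\<^sub>R S (\<lambda>y. word_deriv (map oct_e ?w) (cauchy_kernel p) (y - 0) \<odot> ?F y)"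
    unfolding multi_deriv_word using word_deriv_cauchy[OF f index_list_le V_0, of k] R_pos len by simp
  also have "\<dots> = S (\<lambda>y. (- 1) ^ n *\<^sub>R (word_deriv (map oct_e ?w) (cauchy_kernel p) (y - 0) \<odot> ?F y))"
    by (rule S_scaleR[symmetric]) (intro oct.continuous_on Gc Fc)
  also have "\<dots> = S (\<lambda>y. cauchy_kernel_deriv p k y \<odot> ?F y)"
    unfolding cauchy_kernel_deriv_def len(2) multi_deriv_word by (simp add: oct.scaleR_left)
  finally show ?thesis .
qed

lemma cauchy_kernel_deriv_continuous: "continuous_on K (cauchy_kernel_deriv p k)"
proof -
  have "continuous_on K (\<lambda>y. word_deriv (map oct_e (index_list p k)) (cauchy_kernel p) (y - 0))"
    by (rule kernel_shift_continuous) (use R_pos in \<open>auto intro: kernel_word_deriv cauchy_kernel_kernel\<close>)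
  then show ?thesis
    unfolding cauchy_kernel_deriv_def[abs_def] multi_deriv_word by (intro continuous_intros) simp
qed

text \<open>By the summable majorant the partial sums converge uniformly on the sphere.\<close>

lemma S_uniform_sums:
  assumes c: "\<And>n. continuous_on K (c n)" and E: "continuous_on K E" and F: "continuous_on K F"
    and m: "summable m" and bound: "\<And>n y. y \<in> K \<Longrightarrow> norm (c n y) \<le> m n"
    and sums: "\<And>y. y \<in> K \<Longrightarrow> (\<lambda>n. c n y) sums E y"
  shows "(\<lambda>n. S (\<lambda>y. c n y \<odot> F y)) sums S (\<lambda>y. E y \<odot> F y)"
proof -
  obtain b where b: "\<And>x y. norm (x \<odot> y) \<le> norm x * norm y * b" "b \<ge> 0"
    using oct.nonneg_bounded by blast
  obtain B where B: "\<And>y. y \<in> K \<Longrightarrow> norm (F y) \<le> B"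
    using continuous_compact_bound[OF K_compact F] by blast
  have tail: "(\<lambda>N. suminf m - (\<Sum>n<N. m n)) \<longlonglongrightarrow> 0"
    using tendsto_diff[OF tendsto_const[of "suminf m"] summable_LIMSEQ[OF m]] by simp
  have est: "norm ((\<Sum>n<N. S (\<lambda>y. c n y \<odot> F y)) - S (\<lambda>y. E y \<odot> F y)) \<le> ((suminf m - (\<Sum>n<N. m n)) * \<bar>B\<bar> * b) * area" for N
  proof -
    have cN: "continuous_on K (\<lambda>y. (\<Sum>n<N. c n y) - E y)" by (intro continuous_intros c E)
    have "(\<Sum>n<N. S (\<lambda>y. c n y \<odot> F y)) - S (\<lambda>y. E y \<odot> F y) = S (\<lambda>y. (\<Sum>n<N. c n y \<odot> F y) - E y \<odot> F y)"
      by (simp add: S_diff S_sum oct.continuous_on c E F continuous_on_sum)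
    also have "\<dots> = S (\<lambda>y. ((\<Sum>n<N. c n y) - E y) \<odot> F y)"
      by (simp add: oct.diff_left oct.sum_left)
    also have "norm \<dots> \<le> ((suminf m - (\<Sum>n<N. m n)) * \<bar>B\<bar> * b) * area"
    proof (rule S_bound)
      show "continuous_on K (\<lambda>y. ((\<Sum>n<N. c n y) - E y) \<odot> F y)" by (intro oct.continuous_on cN F)
      fix y assume y: "y \<in> K"
      have cs: "summable (\<lambda>n. c n y)" using sums[OF y] by (rule sums_summable)
      have "E y - (\<Sum>n<N. c n y) = (\<Sum>n. c (n + N) y)"
        using suminf_minus_initial_segment[OF cs, of N] sums_unique[OF sums[OF y]] by simp
      also have "norm \<dots> \<le> (\<Sum>n. m (n + N))"
        by (rule norm_suminf_le) (use bound[OF y] m in \<open>auto simp: summable_iff_shift\<close>)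
      also have "\<dots> = suminf m - (\<Sum>n<N. m n)" by (rule suminf_minus_initial_segment[OF m])
      finally have t: "norm ((\<Sum>n<N. c n y) - E y) \<le> suminf m - (\<Sum>n<N. m n)" by (simp add: norm_minus_commute)
      have "norm (((\<Sum>n<N. c n y) - E y) \<odot> F y) \<le> norm ((\<Sum>n<N. c n y) - E y) * norm (F y) * b" by (rule b)
      also have "\<dots> \<le> (suminf m - (\<Sum>n<N. m n)) * \<bar>B\<bar> * b"
        using t B[OF y] b(2) order_trans[OF norm_ge_zero t] by (intro mult_right_mono mult_mono) auto
      finally show "norm (((\<Sum>n<N. c n y) - E y) \<odot> F y) \<le> (suminf m - (\<Sum>n<N. m n)) * \<bar>B\<bar> * b" .
    qed
    finally show ?thesis .
  qed
  have "(\<lambda>N. ((suminf m - (\<Sum>n<N. m n)) * \<bar>B\<bar> * b) * area) \<longlonglongrightarrow> (0 * \<bar>B\<bar> * b) * area"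
    by (intro tendsto_intros tail)
  then have "(\<lambda>N. (\<Sum>n<N. S (\<lambda>y. c n y \<odot> F y)) - S (\<lambda>y. E y \<odot> F y)) \<longlonglongrightarrow> 0"
    by (intro Lim_null_comparison[OF always_eventually[OF allI[OF est]]]) simp
  then show ?thesis unfolding sums_def by (simp add: LIM_zero_iff)
qed

text \<open>The kernel series is integrated term by term. In each term \<open>(P\<^sub>k(x) Q\<^sub>k(y)) (n f)\<close> is split into \<open>P\<^sub>k(x) (Q\<^sub>k(y) (n f))\<close> and an
associator; the first part integrates to \<open>P\<^sub>k(x) \<partial>\<^sub>k f(0)\<close>.\<close>

theorem taylor_series:
  assumes f: "monogenic f df" and x: "x \<in> V" "norm x < R"
  shows "(\<lambda>n. \<Sum>k\<in>multi_indices p n. fueter_poly p k x \<odot> multi_deriv p k f 0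
     + S (\<lambda>y. oct_associator (fueter_poly p k x) (cauchy_kernel_deriv p k y) ((y /\<^sub>R R) \<odot> f y))) sums f x"
proof -
  let ?F = "\<lambda>y. (y /\<^sub>R R) \<odot> f y" and ?E = "cauchy_kernel p"
  define c where "c n y = (\<Sum>k\<in>multi_indices p n. fueter_poly p k x \<odot> cauchy_kernel_deriv p k y)" for n y
  have cc: "continuous_on K (c n)" for n
    unfolding c_def by (intro continuous_on_sum oct.continuous_on continuous_on_const cauchy_kernel_deriv_continuous)
  have "continuous_on K f" using f continuous_on_subset[OF _ K_subset_KB] by (auto simp: monogenic_def)
  then have Fc: "continuous_on K ?F" by (intro oct.continuous_on continuous_intros)
  have Ec: "continuous_on K (\<lambda>y. ?E (y - x))" by (rule kernel_shift_continuous[OF cauchy_kernel_kernel x(2)])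
  obtain m where m: "summable m" "\<And>y. norm y = R \<Longrightarrow> \<exists>C::nat \<Rightarrow> oct. (\<forall>n. norm (C n) \<le> m n) \<and>
     (\<forall>t. \<bar>t\<bar> \<le> 1 \<longrightarrow> (\<lambda>n. t ^ n *\<^sub>R C n) sums ?E (y - t *\<^sub>R x))"
    using cauchy_kernel_series[OF R_pos x(2), of p] by blast
  have series: "(\<forall>n. norm (c n y) \<le> m n) \<and> (\<lambda>n. c n y) sums ?E (y - x)" if y: "y \<in> K" for y
  proof -
    have yK: "y \<in> V" "norm y = R" "y \<noteq> 0" using y R_pos by (auto simp: K_def)
    obtain C :: "nat \<Rightarrow> oct" where C: "\<And>n. norm (C n) \<le> m n" "\<And>t. \<bar>t\<bar> \<le> 1 \<Longrightarrow> (\<lambda>n. t ^ n *\<^sub>R C n) sums ?E (y - t *\<^sub>R x)"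
      using m(2)[OF yK(2)] by blast
    have "C n = c n y" for n
      unfolding c_def fueter_sum[OF x(1) yK(1,3)]
      by (rule cauchy_kernel_coefficients[OF C(2)]) (use x yK in auto)
    then show ?thesis using C(1) C(2)[of 1] by simp
  qed
  have "(\<lambda>n. S (\<lambda>y. c n y \<odot> ?F y)) sums S (\<lambda>y. ?E (y - x) \<odot> ?F y)"
    by (rule S_uniform_sums[OF cc Ec Fc m(1)]) (use series in auto)
  moreover have "S (\<lambda>y. ?E (y - x) \<odot> ?F y) = f x" by (rule cauchy_formula[OF f x, symmetric])
  moreover have "S (\<lambda>y. c n y \<odot> ?F y) = (\<Sum>k\<in>multi_indices p n. fueter_poly p k x \<odot> multi_deriv p k f 0
     + S (\<lambda>y. oct_associator (fueter_poly p k x) (cauchy_kernel_deriv p k y) (?F y)))" for n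
  proof -
    let ?P = "\<lambda>k. fueter_poly p k x" and ?Q = "cauchy_kernel_deriv p"
    have QF: "continuous_on K (\<lambda>y. ?Q k y \<odot> ?F y)" for k by (intro oct.continuous_on cauchy_kernel_deriv_continuous Fc)
    have ac: "continuous_on K (\<lambda>y. oct_associator (?P k) (?Q k y) (?F y))" for k
      unfolding oct_associator_def by (intro continuous_on_diff oct.continuous_on continuous_on_const cauchy_kernel_deriv_continuous Fc)
    have PQF: "continuous_on K (\<lambda>y. ?P k \<odot> (?Q k y \<odot> ?F y))" for k by (intro oct.continuous_on continuous_on_const cauchy_kernel_deriv_continuous Fc)
    have "S (\<lambda>y. c n y \<odot> ?F y) = S (\<lambda>y. \<Sum>k\<in>multi_indices p n. ?P k \<odot> (?Q k y \<odot> ?F y) + oct_associator (?P k) (?Q k y) (?F y))"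
      by (rule arg_cong[where f=S], rule ext) (simp add: c_def oct.sum_left oct_associator_def)
    also have "\<dots> = (\<Sum>k\<in>multi_indices p n. S (\<lambda>y. ?P k \<odot> (?Q k y \<odot> ?F y) + oct_associator (?P k) (?Q k y) (?F y)))"
      by (rule S_sum) (intro continuous_on_add PQF ac)
    also have "\<dots> = (\<Sum>k\<in>multi_indices p n. ?P k \<odot> multi_deriv p k f 0 + S (\<lambda>y. oct_associator (?P k) (?Q k y) (?F y)))"
    proof (rule sum.cong[OF refl])
      fix k assume k: "k \<in> multi_indices p n"
      have "S (\<lambda>y. ?P k \<odot> (?Q k y \<odot> ?F y) + oct_associator (?P k) (?Q k y) (?F y)) =
        S (\<lambda>y. ?P k \<odot> (?Q k y \<odot> ?F y)) + S (\<lambda>y. oct_associator (?P k) (?Q k y) (?F y))"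
        by (rule S_add[OF PQF ac])
      also have "S (\<lambda>y. ?P k \<odot> (?Q k y \<odot> ?F y)) = ?P k \<odot> S (\<lambda>y. ?Q k y \<odot> ?F y)"
        by (rule S_linear[OF oct.bounded_linear_right QF])
      also have "S (\<lambda>y. ?Q k y \<odot> ?F y) = multi_deriv p k f 0" by (rule multi_deriv_cauchy[OF f k, symmetric])
      finally show "S (\<lambda>y. ?P k \<odot> (?Q k y \<odot> ?F y) + oct_associator (?P k) (?Q k y) (?F y)) =
        ?P k \<odot> multi_deriv p k f 0 + S (\<lambda>y. oct_associator (?P k) (?Q k y) (?F y))" .
    qed
    finally show ?thesis .
  qed
  ultimately show ?thesis by simp
qed

end

theorem theorem6p16:
  fixes p :: nat and \<rho> R :: real and f :: "oct \<Rightarrow> oct" and \<eta> x :: oct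
  assumes "p \<le> 6"
    and "\<rho> > 0"
    and "gps_monogenic p (ball 0 \<rho>) f"
    and "0 < R" and "R < \<rho>"
    and "\<eta> \<in> imag_sphere p"
    and "x \<in> slice p \<eta> (ball 0 R)"
  shows "(\<lambda>n. \<Sum>k \<in> multi_indices p n.
            fueter_poly p k x \<odot> multi_deriv p k f 0
            + slice_sphere_integral p \<eta> R
                (\<lambda>y. oct_associator (fueter_poly p k x) (cauchy_kernel_deriv p k y)
                       ((y /\<^sub>R R) \<odot> f y)))
         sums f x"
proof -
  interpret slice_ball p \<eta> R
    by unfold_locales (use assms in auto)
  show ?thesis
  proof (rule taylor_series[OF monogenic_of_gps_monogenic])
    show "gps_monogenic p (ball 0 \<rho>) f" "R < \<rho>" by (fact assms)+
    show "x \<in> V" "norm x < R" using assms(7) by (auto simp: slice_def V_def)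
  qed
qed

end
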